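(* Let $V$ be an irreducible integrable $\tau(B)$-module with finite dimensional weight spaces with respect to $H$, such that $K_0$ acts on $V$ by a positive integer $c_0$ and $K_i$ acts trivially on $V$ for $1\le i\le n$. Let $T=\{v\in V:\tau(B)^+v=0\}$. Then the dimensions of the weight spaces $T_\mu=T\cap V_\mu$ ($\mu\in H^*$) of $T$ are uniformly bounded.
   Context: Everything is over $\mathbb C$. $\dot{\mathfrak g}$ is a finite dimensional simple Lie algebra with Cartan subalgebra $\dot{\mathfrak h}$, root system $\dot\Delta$, triangular decomposition $\dot{\mathfrak g}=\dot{\mathfrak g}^-\oplus\dot{\mathfrak h}\oplus\dot{\mathfrak g}^+$, and normalized invariant non-degenerate symmetric bilinear form $(\cdot,\cdot)$. $n\ge 1$ is an integer and $B$ is a commutative associative finitely generated unital $\mathbb C$-algebra. $A=\mathbb C[t_0^{\pm1},\dots,t_n^{\pm1}]$, $t^{\underline m}=t_1^{m_1}\cdots t_n^{m_n}$ for $\underline m\in\mathbb Z^n$. $\Omega_A$ is the vector space with basis $t_0^{k_0}t^{\underline k}K_i$ ($0\le i\le n$, $k_0\in\mathbb Z$, $\underline k\in\mathbb Z^n$), $dA$ is the span of the elements $\sum_{i=0}^n k_i t_0^{k_0}t^{\underline k}K_i$, and $Z=\Omega_A/dA$. $\tau_0=\dot{\mathfrak g}\otimes A\oplus Z$ with $Z$ central and $[x\otimes t_0^{k_0}t^{\underline k},y\otimes t_0^{r_0}t^{\underline r}]=[x,y]\otimes t_0^{k_0+r_0}t^{\underline k+\underline r}+(x,y)\sum_{i=0}^n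 k_i t_0^{k_0+r_0}t^{\underline k+\underline r}K_i$. $\tau(B)=\tau_0\otimes B\oplus D$, $D=\mathrm{span}\{d_0,\dots,d_n\}$, with $[x\otimes b,y\otimes b']=[x,y]\otimes bb'$, $[d_i,x\otimes t_0^{k_0}t^{\underline k}\otimes b]=k_i\,x\otimes t_0^{k_0}t^{\underline k}\otimes b$, $[d_i,t_0^{k_0}t^{\underline k}K_j\otimes b]=k_i\,t_0^{k_0}t^{\underline k}K_j\otimes b$, $[d_i,d_j]=0$. $K_i$ and $\dot{\mathfrak h}$ are identified with $K_i\otimes 1$ and $\dot{\mathfrak h}\otimes1\otimes1$; $H=\dot{\mathfrak h}\oplus\bigoplus_i\mathbb CK_i\oplus\bigoplus_i\mathbb Cd_i$. A $\tau(B)$-module $V$ is integrable if $V=\bigoplus_{\lambda\in H^*}V_\lambda$ with $V_\lambda=\{v:hv=\lambda(h)v\ \forall h\in H\}$ (weight spaces), and for all $\alpha\in\dot\Delta$, $(m_0,\underline m)\in\mathbb Z^{n+1}$, $b\in B$, $v\in V$ there is $k$ with $(X_\alpha\otimes t_0^{m_0}t^{\underline m}\otimes b)^k v=0$, where $X_\alpha$ is a root vector of root $\alpha$. $\tau(B)^+=\dot{\mathfrak g}^+\otimes\mathbb C[t_1^{\pm1},\dots,t_n^{\pm1}]\otimes B+\dot{\mathfrak g}\otimes t_0\mathbb C[t_0,t_1^{\pm1},\dots,t_n^{\pm1}]\otimes B+\sum_{i=0}^nt_0\mathbb C[t_0,t_1^{\pm1},\dots,t_n^{\pm1}]K_i\otimes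 B$. *)

theory Defs
  imports
    "HOL-Analysis.Finite_Cartesian_Product"
    "HOL-Library.Poly_Mapping"
    "HOL-Library.Product_Plus"
begin

section \<open>Complex vector spaces and algebras\<close>

class complex_vector = ab_group_add +
  fixes scaleC :: "complex \<Rightarrow> 'a \<Rightarrow> 'a"  (infixr \<open>*\<^sub>C\<close> 75)
  assumes scaleC_add_right: "a *\<^sub>C (x + y) = a *\<^sub>C x + a *\<^sub>C y"
    and scaleC_add_left: "(a + b) *\<^sub>C x = a *\<^sub>C x + b *\<^sub>C x"
    and scaleC_scaleC: "a *\<^sub>C b *\<^sub>C x = (a * b) *\<^sub>C x"
    and scaleC_one: "1 *\<^sub>C x = x"

class complex_comm_algebra_1 = complex_vector + comm_ring_1 +
  assumes mult_scaleC_left: "(a *\<^sub>C x) * y = a *\<^sub>C (x * y)"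

global_interpretation complex_vector: vector_space "scaleC :: complex \<Rightarrow> 'a \<Rightarrow> 'a::complex_vector"
  by unfold_locales (simp_all add: scaleC_add_right scaleC_add_left scaleC_scaleC scaleC_one)

lemmas scaleC_simps = complex_vector.scale_right_diff_distrib complex_vector.scale_left_diff_distrib
  scaleC_add_right scaleC_add_left

lemma mult_scaleC_right: "x * (a *\<^sub>C y) = a *\<^sub>C (x * y)"
  for x y :: "'a::complex_comm_algebra_1"
  by (metis mult.commute mult_scaleC_left)

instantiation complex :: complex_comm_algebra_1
begin
definition scaleC_complex_def [simp]: "scaleC a (x::complex) = a * x"
instance by standard (simp_all add: algebra_simps)
end

instantiation prod :: (complex_vector, complex_vector) complex_vector
begin
definition scaleC_prod_def: "scaleC a x = (a *\<^sub>C fst x, a *\<^sub>C snd x)"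
instance by standard (simp_all add: scaleC_prod_def scaleC_simps)
end

instantiation vec :: (complex_vector, finite) complex_vector
begin
definition scaleC_vec_def: "scaleC a x = (\<chi> i. a *\<^sub>C (x $ i))"
instance by standard (simp_all add: scaleC_vec_def vec_eq_iff scaleC_simps)
end

instantiation poly_mapping :: (type, complex_vector) complex_vector
begin
lift_definition scaleC_poly_mapping :: "complex \<Rightarrow> ('a \<Rightarrow>\<^sub>0 'b) \<Rightarrow> ('a \<Rightarrow>\<^sub>0 'b)"
  is "\<lambda>c f k. c *\<^sub>C f k"
  by (erule finite_subset[rotated]) (auto simp: scaleC_simps)
instance by standard (transfer; auto simp: fun_eq_iff scaleC_simps)+
end

lemma lookup_scaleC: "Poly_Mapping.lookup (c *\<^sub>C p) k = c *\<^sub>C Poly_Mapping.lookup p k"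
  by (rule scaleC_poly_mapping.rep_eq[THEN fun_cong])

abbreviation clinear :: "('a::complex_vector \<Rightarrow> 'b::complex_vector) \<Rightarrow> bool"
  where "clinear \<equiv> Vector_Spaces.linear scaleC scaleC"

definition bilin :: "('a::complex_vector \<Rightarrow> 'b::complex_vector \<Rightarrow> 'c::complex_vector) \<Rightarrow> bool"
  where "bilin f \<longleftrightarrow> (\<forall>y. clinear (\<lambda>x. f x y)) \<and> (\<forall>x. clinear (f x))"

definition fin_dim :: "'a::complex_vector set \<Rightarrow> bool"
  where "fin_dim S \<longleftrightarrow> (\<exists>F. finite F \<and> S \<subseteq> complex_vector.span F)"

definition finitely_generated_algebra :: "'b::complex_comm_algebra_1 itself \<Rightarrow> bool"
  where "finitely_generated_algebra _ \<longleftrightarrow>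
    (\<exists>F::'b set. finite F \<and>
      (\<forall>S. complex_vector.subspace S \<and> 1 \<in> S \<and> (\<forall>x\<in>S. \<forall>y\<in>S. x * y \<in> S) \<and> F \<subseteq> S
        \<longrightarrow> S = UNIV))"

text \<open>The dual of a subspace. A functional on \<open>S\<close> is represented by its extension by zero,
  so that distinct elements of \<open>dual S\<close> are distinct functionals.\<close>

definition dual :: "'a::complex_vector set \<Rightarrow> ('a \<Rightarrow> complex) set"
  where "dual S = {f. (\<forall>x\<in>S. \<forall>y\<in>S. f (x + y) = f x + f y) \<and>
    (\<forall>c. \<forall>x\<in>S. f (c *\<^sub>C x) = c * f x) \<and> (\<forall>x. x \<notin> S \<longrightarrow> f x = 0)}"

lemma clinearI:
  assumes "\<And>x y. f (x + y) = f x + f y" "\<And>c x. f (c *\<^sub>C x) = c *\<^sub>C f x"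
  shows "clinear f"
  by unfold_locales (use assms in \<open>auto simp: scaleC_simps\<close>)

lemma clinearD:
  assumes "clinear f"
  shows "f (x + y) = f x + f y" "f (c *\<^sub>C x) = c *\<^sub>C f x" "f 0 = 0" "f (- x) = - f x"
    "f (x - y) = f x - f y"
proof -
  interpret Vector_Spaces.linear scaleC scaleC f by (rule assms)
  show "f (x + y) = f x + f y" "f (c *\<^sub>C x) = c *\<^sub>C f x" "f 0 = 0" "f (- x) = - f x"
    "f (x - y) = f x - f y"
    by (simp_all add: add scale zero neg diff)
qed

lemma bilinI:
  assumes "\<And>x x' y. f (x + x') y = f x y + f x' y" "\<And>c x y. f (c *\<^sub>C x) y = c *\<^sub>C f x y"
    "\<And>x y y'. f x (y + y') = f x y + f x y'" "\<And>c x y. f x (c *\<^sub>C y) = c *\<^sub>C f x y"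
  shows "bilin f"
  unfolding bilin_def by (intro conjI allI clinearI) (use assms in auto)

lemma bilinD:
  assumes "bilin f"
  shows "f (x + x') y = f x y + f x' y" "f (c *\<^sub>C x) y = c *\<^sub>C f x y"
    "f x (y + y') = f x y + f x y'" "f x (c *\<^sub>C y) = c *\<^sub>C f x y"
    "f 0 y = 0" "f x 0 = 0" "f (- x) y = - f x y" "f x (- y) = - f x y"
    "f (x - x') y = f x y - f x' y" "f x (y - y') = f x y - f x y'"
  using assms unfolding bilin_def by (auto dest: clinearD)


section \<open>Free vector spaces and tensor products\<close>

text \<open>\<open>'a \<Rightarrow>\<^sub>0 complex\<close> is the vector space with basis \<open>'a\<close>.\<close>

definition free_lift :: "('a \<Rightarrow> 'b::complex_vector) \<Rightarrow> ('a \<Rightarrow>\<^sub>0 complex) \<Rightarrow> 'b"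
  where "free_lift f p = (\<Sum>x\<in>Poly_Mapping.keys p. Poly_Mapping.lookup p x *\<^sub>C f x)"

lemma free_lift_superset:
  "finite K \<Longrightarrow> Poly_Mapping.keys p \<subseteq> K \<Longrightarrow> free_lift f p = (\<Sum>x\<in>K. Poly_Mapping.lookup p x *\<^sub>C f x)"
  unfolding free_lift_def
  by (rule sum.mono_neutral_left) (auto simp: in_keys_iff scaleC_simps)

lemma clinear_free_lift: "clinear (free_lift f)"
proof (rule clinearI)
  fix p q :: "'a \<Rightarrow>\<^sub>0 complex" and c :: complex
  have "free_lift f (p + q) = (\<Sum>x\<in>Poly_Mapping.keys p \<union> Poly_Mapping.keys q. Poly_Mapping.lookup (p + q) x *\<^sub>C f x)"
    by (rule free_lift_superset) (auto simp: keys_add)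
  moreover have "free_lift f p = (\<Sum>x\<in>Poly_Mapping.keys p \<union> Poly_Mapping.keys q. Poly_Mapping.lookup p x *\<^sub>C f x)"
    "free_lift f q = (\<Sum>x\<in>Poly_Mapping.keys p \<union> Poly_Mapping.keys q. Poly_Mapping.lookup q x *\<^sub>C f x)"
    by (rule free_lift_superset; auto)+
  ultimately show "free_lift f (p + q) = free_lift f p + free_lift f q"
    by (simp add: lookup_add scaleC_simps sum.distrib)
  have "free_lift f (c *\<^sub>C p) = (\<Sum>x\<in>Poly_Mapping.keys p. Poly_Mapping.lookup (c *\<^sub>C p) x *\<^sub>C f x)"
    by (rule free_lift_superset) (auto simp: in_keys_iff lookup_scaleC)
  then show "free_lift f (c *\<^sub>C p) = c *\<^sub>C free_lift f p"
    by (simp add: lookup_scaleC free_lift_def complex_vector.scale_sum_right scaleC_simps)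
qed

lemma free_lift_single [simp]: "free_lift f (Poly_Mapping.single x c) = c *\<^sub>C f x"
  by (cases "c = 0") (simp_all add: free_lift_def scaleC_simps)

lemma single_scaleC:
  "Poly_Mapping.single x (c::complex) = c *\<^sub>C Poly_Mapping.single x 1"
  by (rule poly_mapping_eqI) (simp only: lookup_scaleC lookup_single when_def, simp)

lemma free_induct [case_names zero single add]:
  fixes p :: "'a \<Rightarrow>\<^sub>0 complex"
  assumes "P 0" "\<And>c x. P (c *\<^sub>C Poly_Mapping.single x 1)" "\<And>p q. P p \<Longrightarrow> P q \<Longrightarrow> P (p + q)"
  shows "P p"
proof -
  have "P (\<Sum>x\<in>K. c x *\<^sub>C Poly_Mapping.single x 1)" if "finite K" for K and c :: "'a \<Rightarrow> complex"
    using that by (induction K) (simp_all add: assms)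
  from this[OF finite_keys[of p], of "Poly_Mapping.lookup p"]
  have "P (\<Sum>x\<in>Poly_Mapping.keys p. Poly_Mapping.lookup p x *\<^sub>C Poly_Mapping.single x 1)" .
  moreover have "p = (\<Sum>x\<in>Poly_Mapping.keys p. Poly_Mapping.lookup p x *\<^sub>C Poly_Mapping.single x 1)"
  proof (rule poly_mapping_eqI)
    fix k
    have "(\<Sum>x\<in>Poly_Mapping.keys p. Poly_Mapping.lookup (Poly_Mapping.lookup p x *\<^sub>C Poly_Mapping.single x 1) k)
        = (\<Sum>x\<in>Poly_Mapping.keys p. if x = k then Poly_Mapping.lookup p k else 0)"
      by (rule sum.cong) (simp_all only: lookup_scaleC lookup_single when_def, auto)
    also have "\<dots> = Poly_Mapping.lookup p k"
      by (simp add: sum.delta in_keys_iff)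
    finally show "Poly_Mapping.lookup p k = Poly_Mapping.lookup
        (\<Sum>x\<in>Poly_Mapping.keys p. Poly_Mapping.lookup p x *\<^sub>C Poly_Mapping.single x 1) k"
      by (simp add: lookup_sum)
  qed
  ultimately show ?thesis by (rule back_subst[of P, OF _ sym])
qed

inductive_set tensor_relations ::
    "(('a::complex_vector \<times> 'b::complex_vector) \<Rightarrow>\<^sub>0 complex) set" where
  "Poly_Mapping.single (x + x', y) 1 - Poly_Mapping.single (x, y) 1 - Poly_Mapping.single (x', y) 1
     \<in> tensor_relations"
| "Poly_Mapping.single (x, y + y') 1 - Poly_Mapping.single (x, y) 1 - Poly_Mapping.single (x, y') 1
     \<in> tensor_relations"
| "Poly_Mapping.single (c *\<^sub>C x, y) 1 - c *\<^sub>C Poly_Mapping.single (x, y) 1 \<in> tensor_relations"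
| "Poly_Mapping.single (x, c *\<^sub>C y) 1 - c *\<^sub>C Poly_Mapping.single (x, y) 1 \<in> tensor_relations"

lemma equivp_subspace:
  assumes "complex_vector.subspace S"
  shows "equivp (\<lambda>p q. p - q \<in> S)"
proof (rule equivpI)
  show "reflp (\<lambda>p q. p - q \<in> S)"
    using assms by (auto simp: reflp_def complex_vector.subspace_0)
  show "symp (\<lambda>p q. p - q \<in> S)"
  proof (rule sympI)
    fix p q assume "p - q \<in> S"
    from complex_vector.subspace_neg[OF assms this] show "q - p \<in> S" by simp
  qed
  show "transp (\<lambda>p q. p - q \<in> S)"
  proof (rule transpI)
    fix p q r assume "p - q \<in> S" "q - r \<in> S"
    from complex_vector.subspace_add[OF assms this] show "p - r \<in> S" by simp
  qed
qed

quotient_type (overloaded) ('a, 'b) tensor =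
    "('a::complex_vector \<times> 'b::complex_vector) \<Rightarrow>\<^sub>0 complex" /
    "\<lambda>p q. p - q \<in> complex_vector.span tensor_relations"
  by (rule equivp_subspace) (rule complex_vector.subspace_span)

lemma span_diff_congs:
  fixes p q r s :: "'a::complex_vector"
  assumes "p - q \<in> complex_vector.span S"
  shows "r - s \<in> complex_vector.span S \<Longrightarrow> (p + r) - (q + s) \<in> complex_vector.span S"
    and "r - s \<in> complex_vector.span S \<Longrightarrow> (p - r) - (q - s) \<in> complex_vector.span S"
    and "(- p) - (- q) \<in> complex_vector.span S"
    and "c *\<^sub>C p - c *\<^sub>C q \<in> complex_vector.span S"
proof -
  show "(p + r) - (q + s) \<in> complex_vector.span S" if "r - s \<in> complex_vector.span S"
    using complex_vector.span_add[OF assms that] by (simp add: algebra_simps)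
  show "(p - r) - (q - s) \<in> complex_vector.span S" if "r - s \<in> complex_vector.span S"
    using complex_vector.span_diff[OF assms that] by (simp add: algebra_simps)
  show "(- p) - (- q) \<in> complex_vector.span S"
    using complex_vector.span_neg[OF assms] by (simp add: algebra_simps)
  show "c *\<^sub>C p - c *\<^sub>C q \<in> complex_vector.span S"
    using complex_vector.span_scale[OF assms, of c] by (simp add: scaleC_simps)
qed

instantiation tensor :: (complex_vector, complex_vector) complex_vector
begin
lift_definition zero_tensor :: "('a, 'b) tensor" is 0 .
lift_definition plus_tensor :: "('a, 'b) tensor \<Rightarrow> ('a, 'b) tensor \<Rightarrow> ('a, 'b) tensor"
  is "(+)" by (rule span_diff_congs)
lift_definition minus_tensor :: "('a, 'b) tensor \<Rightarrow> ('a, 'b) tensor \<Rightarrow> ('a, 'b) tensor"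
  is "(-)" by (rule span_diff_congs)
lift_definition uminus_tensor :: "('a, 'b) tensor \<Rightarrow> ('a, 'b) tensor"
  is "uminus" by (rule span_diff_congs)
lift_definition scaleC_tensor :: "complex \<Rightarrow> ('a, 'b) tensor \<Rightarrow> ('a, 'b) tensor"
  is "scaleC" by (rule span_diff_congs)
instance
proof
  fix a b :: complex and x y z :: "('a, 'b) tensor"
  note [simp] = complex_vector.span_zero
  show "x + y + z = x + (y + z)" by transfer (simp add: add.assoc)
  show "x + y = y + x" by transfer (simp add: add.commute)
  show "0 + x = x" by transfer simp
  show "- x + x = 0" by transfer simp
  show "x - y = x + - y" by transfer simp
  show "a *\<^sub>C (x + y) = a *\<^sub>C x + a *\<^sub>C y" by transfer (simp add: scaleC_add_right)
  show "(a + b) *\<^sub>C x = a *\<^sub>C x + b *\<^sub>C x" by transfer (simp add: scaleC_add_left)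
  show "a *\<^sub>C b *\<^sub>C x = (a * b) *\<^sub>C x" by transfer simp
  show "1 *\<^sub>C x = x" by transfer simp
qed
end

lift_definition tensor :: "'a::complex_vector \<Rightarrow> 'b::complex_vector \<Rightarrow> ('a, 'b) tensor"
    (infixr \<open>\<otimes>\<close> 78)
  is "\<lambda>x y. Poly_Mapping.single (x, y) 1" .

lemma bilin_tensor: "bilin (\<otimes>)"
proof (rule bilinI)
  fix x x' :: 'a and y y' :: 'b and c :: complex
  note base = complex_vector.span_base[OF tensor_relations.intros(1)]
    complex_vector.span_base[OF tensor_relations.intros(2)]
    complex_vector.span_base[OF tensor_relations.intros(3)]
    complex_vector.span_base[OF tensor_relations.intros(4)]
  show "(x + x') \<otimes> y = x \<otimes> y + x' \<otimes> y"
    by transfer (simp only: diff_diff_add[symmetric] base)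
  show "x \<otimes> (y + y') = x \<otimes> y + x \<otimes> y'"
    by transfer (simp only: diff_diff_add[symmetric] base)
  show "(c *\<^sub>C x) \<otimes> y = c *\<^sub>C (x \<otimes> y)" by transfer (rule base)
  show "x \<otimes> (c *\<^sub>C y) = c *\<^sub>C (x \<otimes> y)" by transfer (rule base)
qed

lemma abs_tensor_linear:
  "abs_tensor (p + q) = abs_tensor p + abs_tensor q"
  "abs_tensor (c *\<^sub>C p) = c *\<^sub>C abs_tensor p"
  by (simp_all add: plus_tensor.abs_eq scaleC_tensor.abs_eq)

lemma tensor_induct [case_names zero tensor add]:
  assumes "P 0" "\<And>x y. P (x \<otimes> y)" "\<And>s t. P s \<Longrightarrow> P t \<Longrightarrow> P (s + t)"
  shows "P t"
proof -
  have "P (abs_tensor p)" for p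
  proof (induction p rule: free_induct)
    case zero
    then show ?case using assms(1) by (simp add: zero_tensor.abs_eq)
  next
    case (single c x)
    have "abs_tensor (c *\<^sub>C Poly_Mapping.single x 1) = c *\<^sub>C (fst x \<otimes> snd x)"
      by (simp add: abs_tensor_linear tensor.abs_eq)
    also have "\<dots> = (c *\<^sub>C fst x) \<otimes> snd x"
      by (simp add: bilinD[OF bilin_tensor])
    finally show ?case using assms(2) by simp
  next
    case (add p q)
    then show ?case using assms(3) by (simp add: abs_tensor_linear)
  qed
  from this[of "rep_tensor t"] show ?thesis
    by (simp add: Quotient3_abs_rep[OF Quotient3_tensor])
qed

text \<open>The linear map on the tensor product induced by a bilinear map \<open>f\<close>; for other \<open>f\<close>
  the value depends on the chosen representative and is of no interest.\<close>

definition tensor_lift ::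
    "('a::complex_vector \<Rightarrow> 'b::complex_vector \<Rightarrow> 'c::complex_vector) \<Rightarrow> ('a, 'b) tensor \<Rightarrow> 'c"
  where "tensor_lift f t = free_lift (\<lambda>(x, y). f x y) (rep_tensor t)"

lemma tensor_lift_abs:
  assumes "bilin f"
  shows "tensor_lift f (abs_tensor p) = free_lift (\<lambda>(x, y). f x y) p"
proof -
  let ?F = "free_lift (\<lambda>(x, y). f x y)"
  have *: "?F q = 0" if "q \<in> complex_vector.span tensor_relations" for q
    using that
  proof (induction rule: complex_vector.span_induct_alt)
    case base
    show ?case by (simp add: clinearD[OF clinear_free_lift])
  next
    case (step c x y)
    from step(1) have "?F x = 0"
      by cases (simp_all add: clinearD[OF clinear_free_lift] bilinD[OF assms] scaleC_simps)
    then show ?case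
      using step by (simp add: clinearD[OF clinear_free_lift] scaleC_simps)
  qed
  have "rep_tensor (abs_tensor p) - p \<in> complex_vector.span tensor_relations"
    by (simp add: rep_abs_rsp_left[OF Quotient3_tensor] complex_vector.span_zero)
  from *[OF this] show ?thesis
    by (simp add: tensor_lift_def clinearD[OF clinear_free_lift])
qed

lemma tensor_lift_tensor: "bilin f \<Longrightarrow> tensor_lift f (x \<otimes> y) = f x y"
  by (simp add: tensor.abs_eq tensor_lift_abs scaleC_simps)

lemma clinear_tensor_lift:
  assumes "bilin f"
  shows "clinear (tensor_lift f)"
proof (rule clinearI)
  fix s t :: "('a, 'b) tensor" and c :: complex
  have "s = abs_tensor (rep_tensor s)" "t = abs_tensor (rep_tensor t)"
    by (simp_all add: Quotient3_abs_rep[OF Quotient3_tensor])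
  then obtain p q where "s = abs_tensor p" "t = abs_tensor q" by blast
  then show "tensor_lift f (s + t) = tensor_lift f s + tensor_lift f t"
    "tensor_lift f (c *\<^sub>C s) = c *\<^sub>C tensor_lift f s"
    by (simp_all flip: abs_tensor_linear
        add: tensor_lift_abs[OF assms] clinearD[OF clinear_free_lift])
qed


text \<open>Bilinear maps on a pair of tensor products.\<close>

definition tensor_lift2 ::
    "('a::complex_vector \<Rightarrow> 'b::complex_vector \<Rightarrow> 'c::complex_vector \<Rightarrow> 'd::complex_vector \<Rightarrow> 'e::complex_vector)
      \<Rightarrow> ('a, 'b) tensor \<Rightarrow> ('c, 'd) tensor \<Rightarrow> 'e"
  where "tensor_lift2 g s t = tensor_lift (\<lambda>x a. tensor_lift (g x a) t) s"

lemma tensor_lift2: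
  fixes g :: "'a::complex_vector \<Rightarrow> 'b::complex_vector \<Rightarrow> 'c::complex_vector \<Rightarrow> 'd::complex_vector
    \<Rightarrow> 'e::complex_vector"
  assumes "\<And>y b. bilin (\<lambda>x a. g x a y b)" "\<And>x a. bilin (g x a)"
  shows "bilin (tensor_lift2 g)" "tensor_lift2 g (x \<otimes> a) (y \<otimes> b) = g x a y b"
proof -
  note lin = clinearD[OF clinear_tensor_lift[OF assms(2)]]
  have 1: "bilin (\<lambda>x a. tensor_lift (g x a) t)" for t
  proof (rule bilinI)
    fix x x' a a' c
    show "tensor_lift (g (x + x') a) t = tensor_lift (g x a) t + tensor_lift (g x' a) t"
      by (induction t rule: tensor_induct)
        (simp_all add: lin tensor_lift_tensor[OF assms(2)] algebra_simps, simp add: bilinD[OF assms(1)])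
    show "tensor_lift (g x (a + a')) t = tensor_lift (g x a) t + tensor_lift (g x a') t"
      by (induction t rule: tensor_induct)
        (simp_all add: lin tensor_lift_tensor[OF assms(2)] algebra_simps, simp add: bilinD[OF assms(1)])
    show "tensor_lift (g (c *\<^sub>C x) a) t = c *\<^sub>C tensor_lift (g x a) t"
      by (induction t rule: tensor_induct)
        (simp_all add: lin tensor_lift_tensor[OF assms(2)] scaleC_simps, simp add: bilinD[OF assms(1)])
    show "tensor_lift (g x (c *\<^sub>C a)) t = c *\<^sub>C tensor_lift (g x a) t"
      by (induction t rule: tensor_induct)
        (simp_all add: lin tensor_lift_tensor[OF assms(2)] scaleC_simps, simp add: bilinD[OF assms(1)])
  qed
  note lin1 = clinearD[OF clinear_tensor_lift[OF 1]]
  show "bilin (tensor_lift2 g)"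
  proof (rule bilinI; unfold tensor_lift2_def)
    fix s s' :: "('a, 'b) tensor" and t t' :: "('c, 'd) tensor" and c
    show "tensor_lift (\<lambda>x a. tensor_lift (g x a) t) (s + s') =
      tensor_lift (\<lambda>x a. tensor_lift (g x a) t) s + tensor_lift (\<lambda>x a. tensor_lift (g x a) t) s'"
      "tensor_lift (\<lambda>x a. tensor_lift (g x a) t) (c *\<^sub>C s) =
      c *\<^sub>C tensor_lift (\<lambda>x a. tensor_lift (g x a) t) s"
      by (simp_all add: lin1)
    show "tensor_lift (\<lambda>x a. tensor_lift (g x a) (t + t')) s =
      tensor_lift (\<lambda>x a. tensor_lift (g x a) t) s + tensor_lift (\<lambda>x a. tensor_lift (g x a) t') s"
      by (induction s rule: tensor_induct)
        (simp_all add: lin1 tensor_lift_tensor[OF 1] algebra_simps, simp add: lin)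
    show "tensor_lift (\<lambda>x a. tensor_lift (g x a) (c *\<^sub>C t)) s =
      c *\<^sub>C tensor_lift (\<lambda>x a. tensor_lift (g x a) t) s"
      by (induction s rule: tensor_induct)
        (simp_all add: lin1 tensor_lift_tensor[OF 1] scaleC_simps, simp add: lin)
  qed
  show "tensor_lift2 g (x \<otimes> a) (y \<otimes> b) = g x a y b"
    by (simp add: tensor_lift2_def tensor_lift_tensor[OF 1] tensor_lift_tensor[OF assms(1)]
        tensor_lift_tensor[OF assms(2)])
qed


section \<open>Lie algebras\<close>

locale lie_algebra =
  fixes br :: "'a::complex_vector \<Rightarrow> 'a \<Rightarrow> 'a"
  assumes bilin_br: "bilin br"
    and br_self: "br x x = 0"
    and jacobi: "br x (br y z) + br y (br z x) + br z (br x y) = 0"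

lemma complex_vector_double_zero:
  fixes x :: "'a::complex_vector"
  assumes "x = - x"
  shows "x = 0"
proof -
  have "2 *\<^sub>C x = x + x" using scaleC_add_left[of 1 1 x] by simp
  also have "\<dots> = 0" using assms by (metis add.right_inverse)
  finally show ?thesis by simp
qed

lemma lie_algebraI:
  assumes "bilin br" "\<And>x y. br y x = - br x y"
    "\<And>x y z. br x (br y z) + br y (br z x) + br z (br x y) = 0"
  shows "lie_algebra br"
proof
  show "br x x = 0" for x
    by (rule complex_vector_double_zero) (rule assms(2))
qed (rule assms)+

lemma (in lie_algebra) br_anti: "br y x = - br x y"
proof -
  have "br x y + br y x = 0"
    using br_self[of "x + y"] unfolding bilinD[OF bilin_br] by (simp add: br_self add.commute)
  then show ?thesis by (simp add: eq_neg_iff_add_eq_0 add.commute)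
qed

definition invariant_form ::
    "('g::complex_vector \<Rightarrow> 'g \<Rightarrow> 'g) \<Rightarrow> ('g \<Rightarrow> 'g \<Rightarrow> complex) \<Rightarrow> bool"
  where "invariant_form br form \<longleftrightarrow> bilin form \<and> (\<forall>x y. form x y = form y x) \<and>
    (\<forall>x y z. form (br x y) z = form x (br y z))"

text \<open>The bracket \<open>[x \<otimes> a, y \<otimes> b] = [x, y] \<otimes> ab\<close> on the tensor product of a Lie algebra and a
  commutative algebra, and the extension of a linear map \<open>D\<close> to \<open>x \<otimes> a \<mapsto> D x \<otimes> a\<close>.\<close>

definition current_bracket ::
    "('l::complex_vector \<Rightarrow> 'l \<Rightarrow> 'l) \<Rightarrow>
      ('l, 'b::complex_comm_algebra_1) tensor \<Rightarrow> ('l, 'b) tensor \<Rightarrow> ('l, 'b) tensor"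
  where "current_bracket br = tensor_lift2 (\<lambda>x a y b. br x y \<otimes> (a * b))"

definition current_map ::
    "('l::complex_vector \<Rightarrow> 'm::complex_vector) \<Rightarrow>
      ('l, 'b::complex_comm_algebra_1) tensor \<Rightarrow> ('m, 'b) tensor"
  where "current_map D = tensor_lift (\<lambda>x a. D x \<otimes> a)"

lemma current_bracket:
  fixes br :: "'l::complex_vector \<Rightarrow> 'l \<Rightarrow> 'l" and a b :: "'b::complex_comm_algebra_1"
  assumes "bilin br"
  shows "bilin (current_bracket br :: ('l, 'b) tensor \<Rightarrow> _)"
    "current_bracket br (x \<otimes> a) (y \<otimes> b) = br x y \<otimes> (a * b)"
proof -
  note simps = bilinD(1-4)[OF assms] bilinD(1-4)[OF bilin_tensor] distrib_left distrib_right
    mult_scaleC_left mult_scaleC_right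
  let ?g = "\<lambda>x (a::'b) y b. br x y \<otimes> (a * b)"
  have 1: "bilin (\<lambda>x a. ?g x a y b)" for y b
    by (rule bilinI) (simp_all only: simps)
  have 2: "bilin (?g x a)" for x a
    by (rule bilinI) (simp_all only: simps)
  show "bilin (current_bracket br :: ('l, 'b) tensor \<Rightarrow> _)"
    unfolding current_bracket_def by (rule tensor_lift2(1)[OF 1 2])
  show "current_bracket br (x \<otimes> a) (y \<otimes> b) = br x y \<otimes> (a * b)"
    unfolding current_bracket_def by (rule tensor_lift2(2)[where g = ?g, OF 1 2])
qed

lemma current_map:
  assumes "clinear D"
  shows "clinear (current_map D)" "current_map D (x \<otimes> a) = D x \<otimes> a"
proof -
  have "bilin (\<lambda>x a. D x \<otimes> a)"
    by (rule bilinI) (simp_all add: clinearD[OF assms] bilinD[OF bilin_tensor])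
  from clinear_tensor_lift[OF this] tensor_lift_tensor[OF this]
  show "clinear (current_map D)" "current_map D (x \<otimes> a) = D x \<otimes> a"
    unfolding current_map_def by blast+
qed

lemma trilinear_zero_tensor:
  assumes "\<And>s t. clinear (\<lambda>r. J r s t)" "\<And>r t. clinear (\<lambda>s. J r s t)" "\<And>r s. clinear (J r s)"
    and "\<And>x a y b z c. J (x \<otimes> a) (y \<otimes> b) (z \<otimes> c) = 0"
  shows "J r s t = 0"
proof -
  have 1: "J (x \<otimes> a) (y \<otimes> b) t = 0" for x a y b t
    by (induction t rule: tensor_induct) (simp_all add: clinearD[OF assms(3)] assms(4))
  have 2: "J (x \<otimes> a) s t = 0" for x a s t
    by (induction s rule: tensor_induct) (simp_all add: clinearD[OF assms(2)] 1)
  show ?thesis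
    by (induction r rule: tensor_induct) (simp_all add: clinearD[OF assms(1)] 2)
qed

lemma bilinear_zero_tensor:
  assumes "bilin J" and "\<And>x a y b. J (x \<otimes> a) (y \<otimes> b) = 0"
  shows "J s t = 0"
proof -
  have 1: "J (x \<otimes> a) t = 0" for x a t
    by (induction t rule: tensor_induct) (simp_all add: bilinD[OF assms(1)] assms(2))
  show ?thesis
    by (induction s rule: tensor_induct) (simp_all add: bilinD[OF assms(1)] 1)
qed

lemma jacobi_linear:
  assumes "bilin br" "bilin f"
  defines "J \<equiv> \<lambda>x y z. f x (br y z) + f y (br z x) + f z (br x y)"
  shows "clinear (\<lambda>x. J x y z)" "clinear (\<lambda>y. J x y z)" "clinear (J x y)"
  unfolding J_def
  by (rule clinearI;
      simp only: bilinD(1-4)[OF assms(1)] bilinD(1-4)[OF assms(2)] scaleC_add_right add_ac)+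

lemma lie_algebra_current:
  fixes br :: "'l::complex_vector \<Rightarrow> 'l \<Rightarrow> 'l"
  assumes "lie_algebra br"
  shows "lie_algebra (current_bracket br :: ('l, 'b::complex_comm_algebra_1) tensor \<Rightarrow> _)"
proof -
  interpret lie_algebra br by fact
  note cb = current_bracket[OF bilin_br]
  show ?thesis
  proof (rule lie_algebraI)
    show "bilin (current_bracket br)" by (rule cb)
    fix r s t :: "('l, 'b) tensor"
    have "current_bracket br t s + current_bracket br s t = 0"
    proof (rule bilinear_zero_tensor[of "\<lambda>t s. current_bracket br t s + current_bracket br s t"])
      show "bilin (\<lambda>t s. current_bracket br t s + current_bracket br s t)"
        by (rule bilinI) (simp_all add: bilinD[OF cb(1)] scaleC_simps algebra_simps)
      fix x y :: 'l and a b :: 'b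
      have "br x y \<otimes> (a * b) + br y x \<otimes> (b * a) = (br x y + br y x) \<otimes> (a * b)"
        by (simp add: bilinD[OF bilin_tensor] mult.commute)
      then show "current_bracket br (x \<otimes> a) (y \<otimes> b) + current_bracket br (y \<otimes> b) (x \<otimes> a) = 0"
        by (simp add: cb br_anti[of y x] bilinD[OF bilin_tensor] mult.commute[of b a])
    qed
    then show "current_bracket br t s = - current_bracket br s t"
      by (simp add: eq_neg_iff_add_eq_0)
    show "current_bracket br r (current_bracket br s t)
      + current_bracket br s (current_bracket br t r)
      + current_bracket br t (current_bracket br r s) = 0"
    proof (rule trilinear_zero_tensor[of "\<lambda>r s t. current_bracket br r (current_bracket br s t)
      + current_bracket br s (current_bracket br t r)
      + current_bracket br t (current_bracket br r s)"])
      fix x y z :: 'l and a b c :: 'b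
      have "br x (br y z) \<otimes> (a * (b * c)) + br y (br z x) \<otimes> (b * (c * a))
         + br z (br x y) \<otimes> (c * (a * b))
         = (br x (br y z) + br y (br z x) + br z (br x y)) \<otimes> (a * b * c)"
        by (simp add: bilinD[OF bilin_tensor] mult_ac)
      then show "current_bracket br (x \<otimes> a) (current_bracket br (y \<otimes> b) (z \<otimes> c))
        + current_bracket br (y \<otimes> b) (current_bracket br (z \<otimes> c) (x \<otimes> a))
        + current_bracket br (z \<otimes> c) (current_bracket br (x \<otimes> a) (y \<otimes> b)) = 0"
        by (simp add: cb jacobi bilinD[OF bilin_tensor])
    qed (rule jacobi_linear[OF cb(1) cb(1)])+
  qed
qed


section \<open>Laurent polynomials and the central extension\<close>

text \<open>The type \<open>'n\<close> indexes the variables \<open>t\<^sub>1, \<dots>, t\<^sub>n\<close>, so that \<open>n = CARD('n) \<ge> 1\<close>; the index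
  \<open>None\<close> of \<open>'n option\<close> stands for \<open>0\<close>. The Laurent polynomials in \<open>t\<^sub>0, \<dots>, t\<^sub>n\<close> are the group
  algebra of the exponent lattice, with the convolution product of \<open>\<Rightarrow>\<^sub>0\<close>.\<close>

type_synonym 'n mdeg = "int ^ ('n option)"
type_synonym 'n laurent = "'n mdeg \<Rightarrow>\<^sub>0 complex"

lemma scaleC_poly_mapping_eq_mult:
  fixes p :: "'a::comm_monoid_add \<Rightarrow>\<^sub>0 'b::complex_comm_algebra_1"
  shows "c *\<^sub>C p = Poly_Mapping.single 0 (c *\<^sub>C 1) * p"
proof -
  have "c *\<^sub>C p = Poly_Mapping.map ((*) (c *\<^sub>C 1)) p"
    by (rule poly_mapping_eqI)
      (auto simp: lookup_scaleC Poly_Mapping.map.rep_eq when_def mult_scaleC_left)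
  then show ?thesis by (simp add: mult_map_scale_conv_mult)
qed

instance poly_mapping :: (comm_monoid_add, complex_comm_algebra_1) complex_comm_algebra_1
  by standard (simp only: scaleC_poly_mapping_eq_mult mult.assoc)

abbreviation monom :: "'n::finite mdeg \<Rightarrow> 'n laurent"
  where "monom k \<equiv> Poly_Mapping.single k 1"

lemma monom_mult: "monom k * monom r = monom (k + r)"
  by (simp add: mult_single)

definition laurent_deriv :: "'n::finite option \<Rightarrow> 'n laurent \<Rightarrow> 'n laurent"
  where "laurent_deriv i = free_lift (\<lambda>k. of_int (k $ i) *\<^sub>C monom k)"

text \<open>\<open>\<Omega>\<^sub>A\<close> has the basis \<open>t\<^sup>k K\<^sub>i\<close>, indexed here by the pairs \<open>(i, k)\<close>.\<close>

type_synonym 'n omega = "('n option \<times> 'n mdeg) \<Rightarrow>\<^sub>0 complex"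

definition exact_form :: "'n::finite mdeg \<Rightarrow> 'n omega"
  where "exact_form k = (\<Sum>i\<in>UNIV. of_int (k $ i) *\<^sub>C Poly_Mapping.single (i, k) 1)"

text \<open>The quotient \<open>Z = \<Omega>\<^sub>A / dA\<close>.\<close>

quotient_type 'n omega_mod_exact = "'n::finite omega" /
    "\<lambda>p q. p - q \<in> complex_vector.span (range exact_form)"
  by (rule equivp_subspace) (rule complex_vector.subspace_span)

instantiation omega_mod_exact :: (finite) complex_vector
begin
lift_definition zero_omega_mod_exact :: "'a omega_mod_exact" is 0 .
lift_definition plus_omega_mod_exact ::
    "'a omega_mod_exact \<Rightarrow> 'a omega_mod_exact \<Rightarrow> 'a omega_mod_exact"
  is "(+)" by (rule span_diff_congs)
lift_definition minus_omega_mod_exact ::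
    "'a omega_mod_exact \<Rightarrow> 'a omega_mod_exact \<Rightarrow> 'a omega_mod_exact"
  is "(-)" by (rule span_diff_congs)
lift_definition uminus_omega_mod_exact :: "'a omega_mod_exact \<Rightarrow> 'a omega_mod_exact"
  is "uminus" by (rule span_diff_congs)
lift_definition scaleC_omega_mod_exact :: "complex \<Rightarrow> 'a omega_mod_exact \<Rightarrow> 'a omega_mod_exact"
  is "scaleC" by (rule span_diff_congs)
instance
proof
  fix a b :: complex and x y z :: "'a omega_mod_exact"
  note [simp] = complex_vector.span_zero
  show "x + y + z = x + (y + z)" by transfer (simp add: add.assoc)
  show "x + y = y + x" by transfer (simp add: add.commute)
  show "0 + x = x" by transfer simp
  show "- x + x = 0" by transfer simp
  show "x - y = x + - y" by transfer simp
  show "a *\<^sub>C (x + y) = a *\<^sub>C x + a *\<^sub>C y" by transfer (simp add: scaleC_add_right)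
  show "(a + b) *\<^sub>C x = a *\<^sub>C x + b *\<^sub>C x" by transfer (simp add: scaleC_add_left)
  show "a *\<^sub>C b *\<^sub>C x = (a * b) *\<^sub>C x" by transfer simp
  show "1 *\<^sub>C x = x" by transfer simp
qed
end

lift_definition tK :: "'n::finite mdeg \<Rightarrow> 'n option \<Rightarrow> 'n omega_mod_exact"
  is "\<lambda>k i. Poly_Mapping.single (i, k) 1" .

lemma abs_omega_linear:
  "abs_omega_mod_exact 0 = 0"
  "abs_omega_mod_exact (p + q) = abs_omega_mod_exact p + abs_omega_mod_exact q"
  "abs_omega_mod_exact (c *\<^sub>C p) = c *\<^sub>C abs_omega_mod_exact p"
  by (simp_all add: zero_omega_mod_exact.abs_eq plus_omega_mod_exact.abs_eq
      scaleC_omega_mod_exact.abs_eq)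

lemma abs_omega_sum: "abs_omega_mod_exact (sum f S) = (\<Sum>i\<in>S. abs_omega_mod_exact (f i))"
  by (induction S rule: infinite_finite_induct) (simp_all add: abs_omega_linear)

lemma tK_exact: "(\<Sum>i\<in>UNIV. of_int (k $ i) *\<^sub>C tK k i) = 0"
proof -
  have "(\<Sum>i\<in>UNIV. of_int (k $ i) *\<^sub>C tK k i) = abs_omega_mod_exact (exact_form k)"
    by (simp add: exact_form_def abs_omega_sum abs_omega_linear tK.abs_eq)
  also have "\<dots> = 0"
    unfolding zero_omega_mod_exact.abs_eq omega_mod_exact.abs_eq_iff
    by (simp add: complex_vector.span_base)
  finally show ?thesis .
qed

lemma omega_induct [case_names zero tK add]:
  assumes "P 0" "\<And>c k i. P (c *\<^sub>C tK k i)" "\<And>s t. P s \<Longrightarrow> P t \<Longrightarrow> P (s + t)"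
  shows "P z"
proof -
  have "P (abs_omega_mod_exact p)" for p
  proof (induction p rule: free_induct)
    case (single c x)
    then show ?case using assms(2)[of c "snd x" "fst x"]
      by (simp add: abs_omega_linear tK.abs_eq)
  qed (use assms in \<open>simp_all add: abs_omega_linear\<close>)
  from this[of "rep_omega_mod_exact z"] show ?thesis
    by (simp add: Quotient3_abs_rep[OF Quotient3_omega_mod_exact])
qed

text \<open>The derivation \<open>t\<^sup>k K\<^sub>i \<mapsto> k\<^sub>j t\<^sup>k K\<^sub>i\<close> of \<open>Z\<close>.\<close>

definition omega_deriv :: "'n::finite option \<Rightarrow> 'n omega_mod_exact \<Rightarrow> 'n omega_mod_exact"
  where "omega_deriv j z =
    free_lift (\<lambda>(i, k). of_int (k $ j) *\<^sub>C tK k i) (rep_omega_mod_exact z)"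

lemma omega_deriv_abs:
  "omega_deriv j (abs_omega_mod_exact p) = free_lift (\<lambda>(i, k). of_int (k $ j) *\<^sub>C tK k i) p"
proof -
  let ?F = "free_lift (\<lambda>(i, k). of_int (k $ j) *\<^sub>C tK k i)"
  note lin = clinearD[OF clinear_free_lift]
  have F_sum: "?F (sum f S) = (\<Sum>i\<in>S. ?F (f i))" for f and S :: "'a option set"
    by (induction S rule: infinite_finite_induct) (simp_all add: lin)
  have ex: "?F (exact_form k) = 0" for k
  proof -
    have "?F (exact_form k) = of_int (k $ j) *\<^sub>C (\<Sum>i\<in>UNIV. of_int (k $ i) *\<^sub>C tK k i)"
      by (simp add: exact_form_def F_sum lin complex_vector.scale_sum_right mult.commute)
    then show ?thesis by (simp add: tK_exact)
  qed
  have *: "?F q = 0" if "q \<in> complex_vector.span (range exact_form)" for q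
    using that
    by (induction rule: complex_vector.span_induct_alt) (auto simp: lin ex)
  have "rep_omega_mod_exact (abs_omega_mod_exact p) - p \<in> complex_vector.span (range exact_form)"
    by (simp add: rep_abs_rsp_left[OF Quotient3_omega_mod_exact] complex_vector.span_zero)
  from *[OF this] show ?thesis by (simp add: omega_deriv_def lin)
qed

lemma omega_deriv_tK: "omega_deriv j (tK k i) = of_int (k $ j) *\<^sub>C tK k i"
  by (simp add: tK.abs_eq omega_deriv_abs)

lemma clinear_omega_deriv: "clinear (omega_deriv j)"
proof (rule clinearI)
  fix s t :: "'a omega_mod_exact" and c :: complex
  have "s = abs_omega_mod_exact (rep_omega_mod_exact s)"
    "t = abs_omega_mod_exact (rep_omega_mod_exact t)"
    by (simp_all add: Quotient3_abs_rep[OF Quotient3_omega_mod_exact])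
  then obtain p q where "s = abs_omega_mod_exact p" "t = abs_omega_mod_exact q" by blast
  then show "omega_deriv j (s + t) = omega_deriv j s + omega_deriv j t"
    "omega_deriv j (c *\<^sub>C s) = c *\<^sub>C omega_deriv j s"
    by (simp_all flip: abs_omega_linear add: omega_deriv_abs clinearD[OF clinear_free_lift])
qed

text \<open>The bilinear map \<open>(t\<^sup>k, t\<^sup>r) \<mapsto> \<Sum>\<^sub>i k\<^sub>i t\<^sup>k\<^sup>+\<^sup>r K\<^sub>i\<close>.\<close>

definition omega_pairing :: "'n::finite laurent \<Rightarrow> 'n laurent \<Rightarrow> 'n omega_mod_exact"
  where "omega_pairing p q =
    free_lift (\<lambda>k. free_lift (\<lambda>r. \<Sum>i\<in>UNIV. of_int (k $ i) *\<^sub>C tK (k + r) i) q) p"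

lemma free_lift_linear_param:
  assumes "\<And>x. clinear (\<lambda>q. f q x)"
  shows "clinear (\<lambda>q. free_lift (f q) p)"
  by (rule clinearI)
    (simp_all add: free_lift_def clinearD[OF assms] scaleC_simps sum.distrib
      complex_vector.scale_sum_right mult.commute)

lemma bilin_omega_pairing: "bilin omega_pairing"
  unfolding bilin_def omega_pairing_def
  by (intro conjI allI clinear_free_lift free_lift_linear_param)

lemma omega_pairing_monom:
  "omega_pairing (monom k) (monom r) = (\<Sum>i\<in>UNIV. of_int (k $ i) *\<^sub>C tK (k + r) i)"
  by (simp add: omega_pairing_def)


lemma omega_pairing_anti: "omega_pairing p q + omega_pairing q p = 0"
proof -
  note lin = bilinD(1-6)[OF bilin_omega_pairing]
  have 1: "omega_pairing (monom k) (monom r) + omega_pairing (monom r) (monom k) = 0"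
    for k r :: "'a mdeg"
  proof -
    have "omega_pairing (monom k) (monom r) + omega_pairing (monom r) (monom k)
        = (\<Sum>i\<in>UNIV. of_int ((k + r) $ i) *\<^sub>C tK (k + r) i)"
      by (simp add: omega_pairing_monom sum.distrib[symmetric] scaleC_add_left add.commute[of r k])
    then show ?thesis by (simp only: tK_exact)
  qed
  have 2: "omega_pairing (monom k) q + omega_pairing q (monom k) = 0" for k
  proof (induction q rule: free_induct)
    case (single c x)
    show ?case by (simp only: lin scaleC_add_right[symmetric] 1 complex_vector.scale_zero_right)
  next
    case (add p q)
    have "omega_pairing (monom k) (p + q) + omega_pairing (p + q) (monom k) =
      (omega_pairing (monom k) p + omega_pairing p (monom k)) +
      (omega_pairing (monom k) q + omega_pairing q (monom k))"
      by (simp only: lin add_ac)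
    then show ?case by (simp only: add add_0_left)
  qed (simp add: lin)
  show ?thesis
  proof (induction p rule: free_induct)
    case (single c x)
    show ?case by (simp only: lin scaleC_add_right[symmetric] 2 complex_vector.scale_zero_right)
  next
    case (add p p')
    have "omega_pairing (p + p') q + omega_pairing q (p + p') =
      (omega_pairing p q + omega_pairing q p) + (omega_pairing p' q + omega_pairing q p')"
      by (simp only: lin add_ac)
    then show ?case by (simp only: add add_0_left)
  qed (simp add: lin)
qed

lemma clinear_zero_free:
  fixes f :: "('a \<Rightarrow>\<^sub>0 complex) \<Rightarrow> 'b::complex_vector"
  assumes "clinear f" "\<And>k. f (Poly_Mapping.single k 1) = 0"
  shows "f p = 0"
  by (induction p rule: free_induct) (simp_all add: clinearD[OF assms(1)] assms(2))

lemma omega_pairing_cyclic: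
  "omega_pairing p (q * r) + omega_pairing q (r * p) + omega_pairing r (p * q) = 0"
proof -
  note lin = bilinD(1-4)[OF bilin_omega_pairing] distrib_left distrib_right
    mult_scaleC_left mult_scaleC_right scaleC_add_right add_ac
  let ?J = "\<lambda>p q r :: 'a laurent.
    omega_pairing p (q * r) + omega_pairing q (r * p) + omega_pairing r (p * q)"
  have lin1: "clinear (\<lambda>p. ?J p q r)" for q r by (rule clinearI) (simp_all only: lin)
  have lin2: "clinear (\<lambda>q. ?J p q r)" for p r by (rule clinearI) (simp_all only: lin)
  have lin3: "clinear (?J p q)" for p q by (rule clinearI) (simp_all only: lin)
  have 0: "?J (monom k) (monom l) (monom m) = 0" for k l m
  proof -
    have "?J (monom k) (monom l) (monom m)
        = (\<Sum>i\<in>UNIV. of_int ((k + l + m) $ i) *\<^sub>C tK (k + l + m) i)"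
      by (simp add: monom_mult omega_pairing_monom sum.distrib[symmetric] scaleC_add_left
          add.assoc add.commute[of m "k + l"] add.commute[of l "m + k"] add.commute[of m k]
          add.left_commute[of m] add.left_commute[of l k] add.commute[of m l])
    then show ?thesis by (simp only: tK_exact)
  qed
  have 1: "?J (monom k) (monom l) r = 0" for k l r
    by (rule clinear_zero_free[OF lin3]) (rule 0)
  have 2: "?J (monom k) q r = 0" for k q r
    by (rule clinear_zero_free[OF lin2]) (rule 1)
  show ?thesis
    by (rule clinear_zero_free[OF lin1]) (rule 2)
qed

lemma clinear_laurent_deriv: "clinear (laurent_deriv i)"
  unfolding laurent_deriv_def by (rule clinear_free_lift)

lemma laurent_deriv_monom: "laurent_deriv i (monom k) = of_int (k $ i) *\<^sub>C monom k"
  by (simp add: laurent_deriv_def)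

lemma bilinear_eq_free:
  fixes f g :: "('a \<Rightarrow>\<^sub>0 complex) \<Rightarrow> ('b \<Rightarrow>\<^sub>0 complex) \<Rightarrow> 'c::complex_vector"
  assumes "bilin f" "bilin g"
    and "\<And>k l. f (Poly_Mapping.single k 1) (Poly_Mapping.single l 1)
      = g (Poly_Mapping.single k 1) (Poly_Mapping.single l 1)"
  shows "f p q = g p q"
proof -
  have 1: "f (Poly_Mapping.single k 1) q = g (Poly_Mapping.single k 1) q" for k
    by (induction q rule: free_induct)
      (simp_all add: bilinD[OF assms(1)] bilinD[OF assms(2)] assms(3))
  show ?thesis
    by (induction p rule: free_induct) (simp_all add: bilinD[OF assms(1)] bilinD[OF assms(2)] 1)
qed

lemma laurent_deriv_mult:
  "laurent_deriv i (p * q) = laurent_deriv i p * q + p * laurent_deriv i q"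
proof (rule bilinear_eq_free[of "\<lambda>p q. laurent_deriv i (p * q)"
      "\<lambda>p q. laurent_deriv i p * q + p * laurent_deriv i q"])
  note lin = clinearD(1,2)[OF clinear_laurent_deriv] distrib_left distrib_right
    mult_scaleC_left mult_scaleC_right scaleC_add_right add_ac
  show "bilin (\<lambda>p q. laurent_deriv i (p * q))"
    by (rule bilinI) (simp_all only: lin)
  show "bilin (\<lambda>p q. laurent_deriv i p * q + p * laurent_deriv i q)"
    by (rule bilinI) (simp_all only: lin)
qed (simp add: laurent_deriv_monom monom_mult mult_scaleC_left mult_scaleC_right scaleC_add_left)

lemma omega_deriv_pairing:
  "omega_deriv i (omega_pairing p q)
    = omega_pairing (laurent_deriv i p) q + omega_pairing p (laurent_deriv i q)"
proof (rule bilinear_eq_free[of "\<lambda>p q. omega_deriv i (omega_pairing p q)"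
      "\<lambda>p q. omega_pairing (laurent_deriv i p) q + omega_pairing p (laurent_deriv i q)"])
  note lin = clinearD(1,2)[OF clinear_laurent_deriv] clinearD(1,2)[OF clinear_omega_deriv]
    bilinD(1-4)[OF bilin_omega_pairing] scaleC_add_right add_ac
  show "bilin (\<lambda>p q. omega_deriv i (omega_pairing p q))"
    by (rule bilinI) (simp_all only: lin)
  show "bilin (\<lambda>p q. omega_pairing (laurent_deriv i p) q + omega_pairing p (laurent_deriv i q))"
    by (rule bilinI) (simp_all only: lin)
  have sum: "omega_deriv i (sum f S) = (\<Sum>j\<in>S. omega_deriv i (f j))" for f and S :: "'a option set"
    by (induction S rule: infinite_finite_induct)
      (simp_all add: clinearD[OF clinear_omega_deriv])
  fix k l
  have "omega_deriv i (omega_pairing (monom k) (monom l)) =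
      (of_int (k $ i) + of_int (l $ i)) *\<^sub>C omega_pairing (monom k) (monom l)"
    by (simp add: omega_pairing_monom sum clinearD(2)[OF clinear_omega_deriv] omega_deriv_tK
        complex_vector.scale_sum_right mult.commute)
  then show "omega_deriv i (omega_pairing (monom k) (monom l)) =
      omega_pairing (laurent_deriv i (monom k)) (monom l)
      + omega_pairing (monom k) (laurent_deriv i (monom l))"
    by (simp only: laurent_deriv_monom bilinD[OF bilin_omega_pairing] scaleC_add_left)
qed

text \<open>\<open>\<tau>\<^sub>0 = g \<otimes> A \<oplus> Z\<close>.\<close>

type_synonym ('g, 'n) tau0 = "('g, 'n laurent) tensor \<times> 'n omega_mod_exact"

definition tau0_cocycle ::
    "('g::complex_vector \<Rightarrow> 'g \<Rightarrow> complex) \<Rightarrow>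
      ('g, 'n::finite laurent) tensor \<Rightarrow> ('g, 'n laurent) tensor \<Rightarrow> 'n omega_mod_exact"
  where "tau0_cocycle form = tensor_lift2 (\<lambda>x p y q. form x y *\<^sub>C omega_pairing p q)"

definition tau0_bracket ::
    "('g::complex_vector \<Rightarrow> 'g \<Rightarrow> 'g) \<Rightarrow> ('g \<Rightarrow> 'g \<Rightarrow> complex) \<Rightarrow>
      ('g, 'n::finite) tau0 \<Rightarrow> ('g, 'n) tau0 \<Rightarrow> ('g, 'n) tau0"
  where "tau0_bracket br form X Y =
    (current_bracket br (fst X) (fst Y), tau0_cocycle form (fst X) (fst Y))"

definition tau0_deriv ::
    "'n::finite option \<Rightarrow> ('g::complex_vector, 'n) tau0 \<Rightarrow> ('g, 'n) tau0"
  where "tau0_deriv i X = (tensor_lift (\<lambda>x p. x \<otimes> laurent_deriv i p) (fst X), omega_deriv i (snd X))"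

text \<open>\<open>\<tau>(B) = \<tau>\<^sub>0 \<otimes> B \<oplus> D\<close>; an element \<open>\<delta>\<close> of \<open>complex ^ 'n option\<close> stands for
  \<open>\<Sum>\<^sub>i \<delta>\<^sub>i d\<^sub>i\<close>.\<close>

type_synonym ('g, 'n, 'b) toroidal = "(('g, 'n) tau0, 'b) tensor \<times> (complex ^ ('n option))"

definition toroidal_deriv ::
    "complex ^ ('n::finite option) \<Rightarrow> (('g::complex_vector, 'n) tau0, 'b::complex_comm_algebra_1) tensor
      \<Rightarrow> (('g, 'n) tau0, 'b) tensor"
  where "toroidal_deriv \<delta> u = (\<Sum>i\<in>UNIV. (\<delta> $ i) *\<^sub>C current_map (tau0_deriv i) u)"

definition toroidal_bracket ::
    "('g::complex_vector \<Rightarrow> 'g \<Rightarrow> 'g) \<Rightarrow> ('g \<Rightarrow> 'g \<Rightarrow> complex) \<Rightarrow>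
      ('g, 'n::finite, 'b::complex_comm_algebra_1) toroidal \<Rightarrow> ('g, 'n, 'b) toroidal
      \<Rightarrow> ('g, 'n, 'b) toroidal"
  where "toroidal_bracket br form X Y =
    (current_bracket (tau0_bracket br form) (fst X) (fst Y)
      + toroidal_deriv (snd X) (fst Y) - toroidal_deriv (snd Y) (fst X), 0)"

text \<open>The elements \<open>x \<otimes> t\<^sup>k \<otimes> b\<close>, \<open>t\<^sup>k K\<^sub>i \<otimes> b\<close> and \<open>d\<^sub>i\<close> of \<open>\<tau>(B)\<close>.\<close>

definition loop_elt ::
    "'g::complex_vector \<Rightarrow> 'n::finite mdeg \<Rightarrow> 'b::complex_comm_algebra_1 \<Rightarrow> ('g, 'n, 'b) toroidal"
  where "loop_elt x k b = ((x \<otimes> monom k, 0) \<otimes> b, 0)"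

definition central_elt ::
    "'n::finite mdeg \<Rightarrow> 'n option \<Rightarrow> 'b::complex_comm_algebra_1 \<Rightarrow> ('g::complex_vector, 'n, 'b) toroidal"
  where "central_elt k i b = ((0, tK k i) \<otimes> b, 0)"

definition degree_elt ::
    "'n::finite option \<Rightarrow> ('g::complex_vector, 'n, 'b::complex_comm_algebra_1) toroidal"
  where "degree_elt i = (0, axis i 1)"

lemma bilin_tau0_cocycle:
  fixes form :: "'g::complex_vector \<Rightarrow> 'g \<Rightarrow> complex"
  assumes "bilin form"
  shows "bilin (tau0_cocycle form :: ('g, 'n::finite laurent) tensor \<Rightarrow> _)"
    and "tau0_cocycle form (x \<otimes> p) (y \<otimes> (q :: 'n laurent)) = form x y *\<^sub>C omega_pairing p q"
proof -
  let ?g = "\<lambda>x (p :: 'n laurent) y q. form x y *\<^sub>C omega_pairing p q"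
  note simps = bilinD(1-4)[OF assms] bilinD(1-4)[OF bilin_omega_pairing] scaleC_add_left
    scaleC_add_right complex_vector.scale_scale scaleC_complex_def mult_ac
  have 1: "bilin (\<lambda>x p. ?g x p y q)" for y q by (rule bilinI) (simp_all only: simps)
  have 2: "bilin (?g x p)" for x p by (rule bilinI) (simp_all only: simps)
  show "bilin (tau0_cocycle form :: ('g, 'n laurent) tensor \<Rightarrow> _)"
    unfolding tau0_cocycle_def by (rule tensor_lift2(1)[OF 1 2])
  show "tau0_cocycle form (x \<otimes> p) (y \<otimes> q) = form x y *\<^sub>C omega_pairing p q"
    unfolding tau0_cocycle_def by (rule tensor_lift2(2)[where g = ?g, OF 1 2])
qed

lemma bilin_tau0_bracket:
  assumes "bilin br" "bilin form"
  shows "bilin (tau0_bracket br form)"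
  by (rule bilinI)
    (simp_all add: tau0_bracket_def scaleC_prod_def bilinD(1-4)[OF current_bracket(1)[OF assms(1)]]
      bilinD(1-4)[OF bilin_tau0_cocycle(1)[OF assms(2)]])

lemma loop_deriv:
  "clinear (tensor_lift (\<lambda>x p. x \<otimes> laurent_deriv i p))"
  "tensor_lift (\<lambda>x p. x \<otimes> laurent_deriv i p) (x \<otimes> p) = x \<otimes> laurent_deriv i p"
proof -
  have *: "bilin (\<lambda>x p. x \<otimes> laurent_deriv i p)"
    by (rule bilinI)
      (simp_all only: bilinD[OF bilin_tensor] clinearD[OF clinear_laurent_deriv])
  show "clinear (tensor_lift (\<lambda>x p. x \<otimes> laurent_deriv i p))"
    by (rule clinear_tensor_lift[OF *])
  show "tensor_lift (\<lambda>x p. x \<otimes> laurent_deriv i p) (x \<otimes> p) = x \<otimes> laurent_deriv i p"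
    by (rule tensor_lift_tensor[OF *])
qed

lemma clinear_tau0_deriv: "clinear (tau0_deriv i)"
  by (rule clinearI)
    (simp_all add: tau0_deriv_def scaleC_prod_def clinearD(1,2)[OF loop_deriv(1)]
      clinearD(1,2)[OF clinear_omega_deriv])

lemma lie_algebra_tau0:
  fixes br :: "'g::complex_vector \<Rightarrow> 'g \<Rightarrow> 'g"
  assumes "lie_algebra br" "invariant_form br form"
  shows "lie_algebra (tau0_bracket br form :: ('g, 'n::finite) tau0 \<Rightarrow> _)"
proof -
  interpret lie_algebra br by fact
  interpret cur: lie_algebra "current_bracket br :: ('g, 'n laurent) tensor \<Rightarrow> _"
    by (rule lie_algebra_current) fact
  have bilin_form: "bilin form" and sym: "\<And>x y. form x y = form y x"
    and inv: "\<And>x y z. form (br x y) z = form x (br y z)"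
    using assms(2) by (auto simp: invariant_form_def)
  note cc = bilin_tau0_cocycle[OF bilin_form] and cb = current_bracket[OF bilin_br]
  have anti: "tau0_cocycle form s t + tau0_cocycle form t s = 0"
    for s t :: "('g, 'n laurent) tensor"
  proof (rule bilinear_zero_tensor[of "\<lambda>s t. tau0_cocycle form s t + tau0_cocycle form t s"])
    show "bilin (\<lambda>s t. tau0_cocycle form s t + tau0_cocycle form t s)"
      by (rule bilinI) (simp_all only: bilinD(1-4)[OF cc(1)] scaleC_add_right add_ac)
    fix x y :: 'g and p q :: "'n laurent"
    have "form x y *\<^sub>C omega_pairing p q + form y x *\<^sub>C omega_pairing q p
        = form x y *\<^sub>C (omega_pairing p q + omega_pairing q p)"
      by (simp only: sym[of y x] scaleC_add_right)
    then show "tau0_cocycle form (x \<otimes> p) (y \<otimes> q) + tau0_cocycle form (y \<otimes> q) (x \<otimes> p) = 0"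
      by (simp only: cc(2) omega_pairing_anti complex_vector.scale_zero_right)
  qed
  have cyc: "tau0_cocycle form r (current_bracket br s t)
      + tau0_cocycle form s (current_bracket br t r)
      + tau0_cocycle form t (current_bracket br r s) = 0" for r s t :: "('g, 'n laurent) tensor"
  proof (rule trilinear_zero_tensor[of "\<lambda>r s t. tau0_cocycle form r (current_bracket br s t)
      + tau0_cocycle form s (current_bracket br t r)
      + tau0_cocycle form t (current_bracket br r s)"])
    fix x y z :: 'g and p q r :: "'n laurent"
    have 1: "form y (br z x) = form x (br y z)" "form z (br x y) = form x (br y z)"
      using inv[of y z x] sym[of "br y z" x] inv[of x y z] sym[of "br x y" z] by simp_all
    have "form x (br y z) *\<^sub>C omega_pairing p (q * r) + form y (br z x) *\<^sub>C omega_pairing q (r * p)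
        + form z (br x y) *\<^sub>C omega_pairing r (p * q)
        = form x (br y z) *\<^sub>C
          (omega_pairing p (q * r) + omega_pairing q (r * p) + omega_pairing r (p * q))"
      by (simp only: 1 scaleC_add_right)
    then show "tau0_cocycle form (x \<otimes> p) (current_bracket br (y \<otimes> q) (z \<otimes> r))
      + tau0_cocycle form (y \<otimes> q) (current_bracket br (z \<otimes> r) (x \<otimes> p))
      + tau0_cocycle form (z \<otimes> r) (current_bracket br (x \<otimes> p) (y \<otimes> q)) = 0"
      by (simp only: cc(2) cb(2) omega_pairing_cyclic complex_vector.scale_zero_right)
  qed (rule jacobi_linear[OF cb(1) cc(1)])+
  show ?thesis
  proof (rule lie_algebraI)
    show "bilin (tau0_bracket br form :: ('g, 'n) tau0 \<Rightarrow> _)"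
      by (rule bilin_tau0_bracket[OF bilin_br bilin_form])
    fix X Y Z :: "('g, 'n) tau0"
    show "tau0_bracket br form Y X = - tau0_bracket br form X Y"
      using anti[of "fst Y" "fst X"] cur.br_anti[of "fst Y" "fst X"]
      by (simp add: tau0_bracket_def eq_neg_iff_add_eq_0)
    show "tau0_bracket br form X (tau0_bracket br form Y Z)
      + tau0_bracket br form Y (tau0_bracket br form Z X)
      + tau0_bracket br form Z (tau0_bracket br form X Y) = 0"
      by (simp add: tau0_bracket_def cur.jacobi cyc zero_prod_def)
  qed
qed

lemma bilinear_eq_tensor:
  assumes "bilin f" "bilin g" "\<And>x a y b. f (x \<otimes> a) (y \<otimes> b) = g (x \<otimes> a) (y \<otimes> b)"
  shows "f s t = g s t"
proof -
  have 1: "f (x \<otimes> a) t = g (x \<otimes> a) t" for x a t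
    by (induction t rule: tensor_induct)
      (simp_all add: bilinD[OF assms(1)] bilinD[OF assms(2)] assms(3))
  show ?thesis
    by (induction s rule: tensor_induct)
      (simp_all add: bilinD[OF assms(1)] bilinD[OF assms(2)] 1)
qed

lemma bilin_derivation:
  assumes "bilin f" "clinear D" "clinear E"
  shows "bilin (\<lambda>x y. E (f x y))" "bilin (\<lambda>x y. f (D x) y + f x (D y))"
  by (rule bilinI;
      simp only: bilinD(1-4)[OF assms(1)] clinearD(1,2)[OF assms(2)] clinearD(1,2)[OF assms(3)]
        scaleC_add_right add_ac)+

lemma tau0_deriv_bracket:
  fixes br :: "'g::complex_vector \<Rightarrow> 'g \<Rightarrow> 'g" and X Y :: "('g, 'n::finite) tau0"
  assumes "bilin br" "bilin form"
  shows "tau0_deriv i (tau0_bracket br form X Y)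
    = tau0_bracket br form (tau0_deriv i X) Y + tau0_bracket br form X (tau0_deriv i Y)"
proof -
  note cc = bilin_tau0_cocycle[OF assms(2)] and cb = current_bracket[OF assms(1)]
  let ?D = "tensor_lift (\<lambda>(x::'g) p. x \<otimes> laurent_deriv i p)"
  have 1: "?D (current_bracket br s t) = current_bracket br (?D s) t + current_bracket br s (?D t)"
    for s t
    by (rule bilinear_eq_tensor[OF bilin_derivation[OF cb(1) loop_deriv(1) loop_deriv(1)]])
      (simp only: cb(2) loop_deriv(2) laurent_deriv_mult bilinD(3)[OF bilin_tensor])
  have 2: "omega_deriv i (tau0_cocycle form s t) = tau0_cocycle form (?D s) t + tau0_cocycle form s (?D t)"
    for s t
    by (rule bilinear_eq_tensor[OF bilin_derivation[OF cc(1) loop_deriv(1) clinear_omega_deriv]])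
      (simp only: cc(2) loop_deriv(2) omega_deriv_pairing clinearD(2)[OF clinear_omega_deriv]
        scaleC_add_right)
  show ?thesis by (simp add: tau0_deriv_def tau0_bracket_def 1 2)
qed

lemma tau0_deriv_commute:
  fixes X :: "('g::complex_vector, 'n::finite) tau0"
  shows "tau0_deriv i (tau0_deriv j X) = tau0_deriv j (tau0_deriv i X)"
proof -
  have 0: "laurent_deriv i (laurent_deriv j p) = laurent_deriv j (laurent_deriv i p)" for p
    by (induction p rule: free_induct)
      (simp_all add: clinearD[OF clinear_laurent_deriv] laurent_deriv_monom mult_ac)
  let ?D = "\<lambda>i. tensor_lift (\<lambda>(x::'g) p. x \<otimes> laurent_deriv i p)"
  have 1: "?D i (?D j t) = ?D j (?D i t)" for t :: "('g, 'n laurent) tensor"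
    by (induction t rule: tensor_induct)
      (simp_all only: clinearD[OF loop_deriv(1)] loop_deriv(2) 0)
  have 2: "omega_deriv i (omega_deriv j z) = omega_deriv j (omega_deriv i z)" for z
    by (induction z rule: omega_induct)
      (simp_all add: clinearD[OF clinear_omega_deriv] omega_deriv_tK mult_ac)
  show ?thesis by (simp add: tau0_deriv_def 1 2)
qed

lemma current_map_derivation:
  assumes "bilin br" "clinear D" "\<And>x y. D (br x y) = br (D x) y + br x (D y)"
  shows "current_map D (current_bracket br s t)
    = current_bracket br (current_map D s) t + current_bracket br s (current_map D t)"
  by (rule bilinear_eq_tensor[OF bilin_derivation[OF current_bracket(1)[OF assms(1)]
        current_map(1)[OF assms(2)] current_map(1)[OF assms(2)]]])
    (simp only: current_bracket(2)[OF assms(1)] current_map(2)[OF assms(2)] assms(3)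
      bilinD(1)[OF bilin_tensor])

lemma bilin_toroidal_deriv: "bilin toroidal_deriv"
  by (rule bilinI)
    (simp_all add: toroidal_deriv_def clinearD(1,2)[OF current_map(1)[OF clinear_tau0_deriv]]
      scaleC_vec_def scaleC_simps sum.distrib complex_vector.scale_sum_right mult_ac)

lemma toroidal_deriv_bracket:
  fixes br :: "'g::complex_vector \<Rightarrow> 'g \<Rightarrow> 'g"
    and s t :: "(('g, 'n::finite) tau0, 'b::complex_comm_algebra_1) tensor"
  assumes "bilin br" "bilin form"
  defines "cb \<equiv> current_bracket (tau0_bracket br form)"
  shows "toroidal_deriv \<delta> (cb s t) = cb (toroidal_deriv \<delta> s) t + cb s (toroidal_deriv \<delta> t)"
proof -
  note bil = bilin_tau0_bracket[OF assms(1,2)]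
  note lin = bilinD[OF current_bracket(1)[OF bil]]
  have sum1: "cb (sum f S) t = (\<Sum>i\<in>S. cb (f i) t)" for t f and S :: "'n option set"
    unfolding cb_def by (induction S rule: infinite_finite_induct) (simp_all add: lin(1,5))
  have sum2: "cb s (sum f S) = (\<Sum>i\<in>S. cb s (f i))" for s f and S :: "'n option set"
    unfolding cb_def by (induction S rule: infinite_finite_induct) (simp_all add: lin(3,6))
  have "current_map (tau0_deriv i) (cb s t)
      = cb (current_map (tau0_deriv i) s) t + cb s (current_map (tau0_deriv i) t)" for i
    unfolding cb_def
    by (rule current_map_derivation[where D = "tau0_deriv i" and br = "tau0_bracket br form"])
      (rule bil clinear_tau0_deriv tau0_deriv_bracket[OF assms(1,2)])+
  then have "toroidal_deriv \<delta> (cb s t) =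
      (\<Sum>i\<in>UNIV. (\<delta> $ i) *\<^sub>C cb (current_map (tau0_deriv i) s) t)
      + (\<Sum>i\<in>UNIV. (\<delta> $ i) *\<^sub>C cb s (current_map (tau0_deriv i) t))"
    by (simp only: toroidal_deriv_def scaleC_add_right sum.distrib)
  also have "\<dots> = cb (toroidal_deriv \<delta> s) t + cb s (toroidal_deriv \<delta> t)"
    unfolding toroidal_deriv_def sum1 sum2 by (simp only: cb_def lin(2,4))
  finally show ?thesis .
qed

lemma toroidal_deriv_commute:
  fixes u :: "(('g::complex_vector, 'n::finite) tau0, 'b::complex_comm_algebra_1) tensor"
  shows "toroidal_deriv \<delta> (toroidal_deriv \<epsilon> u) = toroidal_deriv \<epsilon> (toroidal_deriv \<delta> u)"
proof -
  note lin = clinearD[OF current_map(1)[OF clinear_tau0_deriv]]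
  have comm: "current_map (tau0_deriv i) (current_map (tau0_deriv j) u)
      = current_map (tau0_deriv j) (current_map (tau0_deriv i) u)" for i j
    by (induction u rule: tensor_induct)
      (simp_all only: lin current_map(2)[OF clinear_tau0_deriv] tau0_deriv_commute[of i j])
  have sum: "current_map (tau0_deriv i) (sum f S) = (\<Sum>j\<in>S. current_map (tau0_deriv i) (f j))"
    for i :: "'n option" and f :: "_ \<Rightarrow> (('g, 'n) tau0, 'b) tensor" and S :: "'n option set"
    by (induction S rule: infinite_finite_induct) (simp_all add: lin)
  have "toroidal_deriv \<delta> (toroidal_deriv \<epsilon> u)
     = (\<Sum>i\<in>UNIV. \<Sum>j\<in>UNIV. (\<delta> $ i * \<epsilon> $ j) *\<^sub>C current_map (tau0_deriv i) (current_map (tau0_deriv j) u))"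
    by (simp add: toroidal_deriv_def sum lin complex_vector.scale_sum_right)
  also have "\<dots> = (\<Sum>j\<in>UNIV. \<Sum>i\<in>UNIV.
      (\<delta> $ i * \<epsilon> $ j) *\<^sub>C current_map (tau0_deriv i) (current_map (tau0_deriv j) u))"
    by (rule sum.swap)
  also have "\<dots> = (\<Sum>j\<in>UNIV. \<Sum>i\<in>UNIV.
      (\<epsilon> $ j * \<delta> $ i) *\<^sub>C current_map (tau0_deriv j) (current_map (tau0_deriv i) u))"
    by (intro sum.cong refl) (simp only: comm mult.commute)
  also have "\<dots> = toroidal_deriv \<epsilon> (toroidal_deriv \<delta> u)"
    by (simp add: toroidal_deriv_def sum lin complex_vector.scale_sum_right)
  finally show ?thesis .
qed

theorem lie_algebra_toroidal:
  fixes br :: "'g::complex_vector \<Rightarrow> 'g \<Rightarrow> 'g"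
  assumes "lie_algebra br" "invariant_form br form"
  shows "lie_algebra (toroidal_bracket br form
    :: ('g, 'n::finite, 'b::complex_comm_algebra_1) toroidal \<Rightarrow> _)"
proof -
  interpret lie_algebra br by fact
  have bilin_form: "bilin form" using assms(2) by (auto simp: invariant_form_def)
  let ?c = "current_bracket (tau0_bracket br form)
    :: (('g, 'n) tau0, 'b) tensor \<Rightarrow> (('g, 'n) tau0, 'b) tensor \<Rightarrow> (('g, 'n) tau0, 'b) tensor"
  interpret cur: lie_algebra ?c
    by (intro lie_algebra_current lie_algebra_tau0 assms)
  note lin = bilinD[OF cur.bilin_br] and dlin = bilinD[OF bilin_toroidal_deriv]
  show ?thesis
  proof (rule lie_algebraI)
    show "bilin (toroidal_bracket br form :: ('g, 'n, 'b) toroidal \<Rightarrow> _)"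
      by (rule bilinI)
        (simp_all add: toroidal_bracket_def scaleC_prod_def lin(1-4) dlin(1-4)
          scaleC_simps)
    fix X Y Z :: "('g, 'n, 'b) toroidal"
    show "toroidal_bracket br form Y X = - toroidal_bracket br form X Y"
      using cur.br_anti[of "fst Y" "fst X"] by (simp add: toroidal_bracket_def)
    obtain x \<delta> y \<epsilon> z \<zeta> where XYZ: "X = (x, \<delta>)" "Y = (y, \<epsilon>)" "Z = (z, \<zeta>)"
      by (metis surj_pair)
    have D: "toroidal_deriv \<delta> (?c s t) = ?c (toroidal_deriv \<delta> s) t + ?c s (toroidal_deriv \<delta> t)" for \<delta> s t
      by (rule toroidal_deriv_bracket[OF bilin_br bilin_form])
    have a: "?c z (?c x y) = - ?c x (?c y z) - ?c y (?c z x)"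
      using cur.jacobi[of x y z] by (simp add: algebra_simps eq_neg_iff_add_eq_0)
    show "toroidal_bracket br form X (toroidal_bracket br form Y Z)
      + toroidal_bracket br form Y (toroidal_bracket br form Z X)
      + toroidal_bracket br form Z (toroidal_bracket br form X Y) = 0"
      by (simp add: XYZ toroidal_bracket_def zero_prod_def lin dlin D a
          cur.br_anti[of "toroidal_deriv \<zeta> x" y] cur.br_anti[of "toroidal_deriv \<delta> y" z]
          cur.br_anti[of "toroidal_deriv \<epsilon> z" x]
          toroidal_deriv_commute[of \<epsilon> \<delta>] toroidal_deriv_commute[of \<zeta> \<epsilon>]
          toroidal_deriv_commute[of \<zeta> \<delta>])
  qed
qed

theorem toroidal_bracket_relations:
  fixes br :: "'g::complex_vector \<Rightarrow> 'g \<Rightarrow> 'g" and k r :: "'n::finite mdeg"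
    and a b :: "'b::complex_comm_algebra_1" and x y :: 'g
    and i j :: "'n option"
  assumes "bilin br" "bilin form"
  shows "toroidal_bracket br form (loop_elt x k a) (loop_elt y r b)
      = loop_elt (br x y) (k + r) (a * b)
        + form x y *\<^sub>C (\<Sum>i\<in>UNIV. of_int (k $ i) *\<^sub>C central_elt (k + r) i (a * b))"
    and "toroidal_bracket br form (central_elt k i a) (loop_elt y r b) = 0"
    and "toroidal_bracket br form (central_elt k i a) (central_elt r j b :: ('g, 'n, 'b) toroidal) = 0"
    and "toroidal_bracket br form (degree_elt i) (loop_elt x k b) = of_int (k $ i) *\<^sub>C loop_elt x k b"
    and "toroidal_bracket br form (degree_elt i) (central_elt k j b :: ('g, 'n, 'b) toroidal)
      = of_int (k $ i) *\<^sub>C central_elt k j b"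
    and "toroidal_bracket br form (degree_elt i) (degree_elt j :: ('g, 'n, 'b) toroidal) = 0"
    and "(\<Sum>i\<in>UNIV. of_int (k $ i) *\<^sub>C (central_elt k i b :: ('g, 'n, 'b) toroidal)) = 0"
proof -
  note tlin = bilinD[OF bilin_tensor]
  note cb = current_bracket[OF bilin_tau0_bracket[OF assms]]
  note cc = bilin_tau0_cocycle[OF assms(2)] and c0 = current_bracket[OF assms(1)]
  note dlin = bilinD[OF bilin_toroidal_deriv]
  have axis: "toroidal_deriv (axis i 1) u = current_map (tau0_deriv i) u"
    for i and u :: "(('g, 'n) tau0, 'b) tensor"
  proof -
    have "toroidal_deriv (axis i 1) u
        = (\<Sum>j\<in>UNIV. if j = i then current_map (tau0_deriv j) u else 0)"
      unfolding toroidal_deriv_def by (rule sum.cong) (auto simp: axis_def)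
    then show ?thesis by simp
  qed
  have sum1: "(\<Sum>i\<in>S. c i *\<^sub>C (central_elt k i b :: ('g, 'n, 'b) toroidal))
      = ((0, \<Sum>i\<in>S. c i *\<^sub>C tK k i) \<otimes> b, 0)" for S c k and b :: 'b
  proof (induction S rule: infinite_finite_induct)
    case (insert i S)
    have "((0, c i *\<^sub>C tK k i + (\<Sum>i\<in>S. c i *\<^sub>C tK k i)) :: ('g, 'n) tau0) \<otimes> b
        = (c i *\<^sub>C (0, tK k i) + (0, \<Sum>i\<in>S. c i *\<^sub>C tK k i)) \<otimes> b"
      by (simp only: scaleC_prod_def fst_conv snd_conv add_Pair complex_vector.scale_zero_right add_0_left)
    then show ?case
      unfolding sum.insert[OF insert(1,2)] insert(3)
      by (simp only: tlin central_elt_def scaleC_prod_def[of _ "(_ \<otimes> _, _)"] fst_conv snd_conv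
          add_Pair complex_vector.scale_zero_right add_0_left)
  qed (simp_all add: tlin flip: zero_prod_def)
  show "(\<Sum>i\<in>UNIV. of_int (k $ i) *\<^sub>C (central_elt k i b :: ('g, 'n, 'b) toroidal)) = 0"
    unfolding sum1[where c = "\<lambda>i. of_int (k $ i)"] tK_exact
    by (simp only: zero_prod_def[symmetric] tlin)
  have split: "(u, z) \<otimes> b = (u, 0) \<otimes> b + (0, z) \<otimes> b"
    for u :: "('g, 'n laurent) tensor" and z :: "'n omega_mod_exact" and b :: 'b
    by (simp flip: tlin)
  show "toroidal_bracket br form (loop_elt x k a) (loop_elt y r b)
      = loop_elt (br x y) (k + r) (a * b)
        + form x y *\<^sub>C (\<Sum>i\<in>UNIV. of_int (k $ i) *\<^sub>C central_elt (k + r) i (a * b))"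
  proof -
    have "toroidal_bracket br form (loop_elt x k a) (loop_elt y r b) =
      ((br x y \<otimes> monom (k + r), form x y *\<^sub>C omega_pairing (monom k) (monom r)) \<otimes> (a * b), 0)"
      by (simp add: toroidal_bracket_def loop_elt_def cb tau0_bracket_def cc c0 monom_mult dlin)
    moreover have "((0, form x y *\<^sub>C omega_pairing (monom k) (monom r)) :: ('g, 'n) tau0) \<otimes> (a * b)
      = form x y *\<^sub>C ((0, omega_pairing (monom k) (monom r)) \<otimes> (a * b))"
      by (simp flip: tlin add: scaleC_prod_def)
    ultimately have "toroidal_bracket br form (loop_elt x k a) (loop_elt y r b) =
      ((br x y \<otimes> monom (k + r), 0) \<otimes> (a * b)
        + form x y *\<^sub>C ((0, omega_pairing (monom k) (monom r)) \<otimes> (a * b)), 0)"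
      by (subst (asm) split) simp
    then show ?thesis
      unfolding sum1 omega_pairing_monom by (simp add: loop_elt_def scaleC_prod_def)
  qed
  show "toroidal_bracket br form (central_elt k i a) (loop_elt y r b) = 0"
    "toroidal_bracket br form (central_elt k i a) (central_elt r j b :: ('g, 'n, 'b) toroidal) = 0"
    by (simp_all add: toroidal_bracket_def central_elt_def loop_elt_def cb tau0_bracket_def
        bilinD[OF cc(1)] bilinD[OF c0(1)] dlin tlin flip: zero_prod_def)
  show "toroidal_bracket br form (degree_elt i) (degree_elt j :: ('g, 'n, 'b) toroidal) = 0"
    by (simp add: toroidal_bracket_def degree_elt_def bilinD[OF cb(1)] dlin flip: zero_prod_def)
  show "toroidal_bracket br form (degree_elt i) (loop_elt x k b) = of_int (k $ i) *\<^sub>C loop_elt x k b"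
  proof -
    have "tau0_deriv i (x \<otimes> monom k, 0) = of_int (k $ i) *\<^sub>C (x \<otimes> monom k, 0)"
      by (simp add: tau0_deriv_def loop_deriv laurent_deriv_monom tlin scaleC_prod_def
          clinearD[OF clinear_omega_deriv])
    then have "current_map (tau0_deriv i) ((x \<otimes> monom k, 0) \<otimes> b) = of_int (k $ i) *\<^sub>C ((x \<otimes> monom k, 0) \<otimes> b)"
      by (simp only: current_map(2)[OF clinear_tau0_deriv] tlin)
    then show ?thesis
      by (simp add: toroidal_bracket_def degree_elt_def loop_elt_def axis bilinD[OF cb(1)] dlin
          scaleC_prod_def[of _ "(_ \<otimes> _, _)"])
  qed
  show "toroidal_bracket br form (degree_elt i) (central_elt k j b :: ('g, 'n, 'b) toroidal)
      = of_int (k $ i) *\<^sub>C central_elt k j b"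
  proof -
    have "tau0_deriv i ((0, tK k j) :: ('g, 'n) tau0) = of_int (k $ i) *\<^sub>C (0, tK k j)"
      by (simp add: tau0_deriv_def clinearD[OF loop_deriv(1)] omega_deriv_tK scaleC_prod_def)
    then have "current_map (tau0_deriv i) ((0, tK k j) \<otimes> b) = of_int (k $ i) *\<^sub>C (((0, tK k j) :: ('g, 'n) tau0) \<otimes> b)"
      by (simp only: current_map(2)[OF clinear_tau0_deriv] tlin)
    then show ?thesis
      by (simp add: toroidal_bracket_def degree_elt_def central_elt_def axis bilinD[OF cb(1)] dlin
          scaleC_prod_def[of _ "(_ \<otimes> _, _)"])
  qed
qed



section \<open>Simple Lie algebras\<close>

definition lie_ideal :: "('g::complex_vector \<Rightarrow> 'g \<Rightarrow> 'g) \<Rightarrow> 'g set \<Rightarrow> bool"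
  where "lie_ideal br I \<longleftrightarrow> complex_vector.subspace I \<and> (\<forall>x. \<forall>y\<in>I. br x y \<in> I)"

definition simple_lie_algebra :: "('g::complex_vector \<Rightarrow> 'g \<Rightarrow> 'g) \<Rightarrow> bool"
  where "simple_lie_algebra br \<longleftrightarrow> lie_algebra br \<and> (\<exists>x y. br x y \<noteq> 0) \<and>
    (\<forall>I. lie_ideal br I \<longrightarrow> I = {0} \<or> I = UNIV)"

primrec lower_central ::
    "('g::complex_vector \<Rightarrow> 'g \<Rightarrow> 'g) \<Rightarrow> 'g set \<Rightarrow> nat \<Rightarrow> 'g set"
  where
    "lower_central br S 0 = S"
  | "lower_central br S (Suc m) = complex_vector.span {br x y | x y. x \<in> S \<and> y \<in> lower_central br S m}"

text \<open>A Cartan subalgebra is a nilpotent subalgebra that is its own normalizer.\<close>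

definition cartan_subalgebra :: "('g::complex_vector \<Rightarrow> 'g \<Rightarrow> 'g) \<Rightarrow> 'g set \<Rightarrow> bool"
  where "cartan_subalgebra br h \<longleftrightarrow> complex_vector.subspace h \<and> (\<forall>x\<in>h. \<forall>y\<in>h. br x y \<in> h) \<and>
    (\<exists>m. lower_central br h m = {0}) \<and> {x. \<forall>y\<in>h. br x y \<in> h} = h"

definition root_space ::
    "('g::complex_vector \<Rightarrow> 'g \<Rightarrow> 'g) \<Rightarrow> 'g set \<Rightarrow> ('g \<Rightarrow> complex) \<Rightarrow> 'g set"
  where "root_space br h \<alpha> = {x. \<forall>y\<in>h. br y x = \<alpha> y *\<^sub>C x}"

definition roots :: "('g::complex_vector \<Rightarrow> 'g \<Rightarrow> 'g) \<Rightarrow> 'g set \<Rightarrow> ('g \<Rightarrow> complex) set"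
  where "roots br h = {\<alpha> \<in> dual h. \<alpha> \<noteq> (\<lambda>_. 0) \<and> root_space br h \<alpha> \<noteq> {0}}"

definition nat_combination :: "('g \<Rightarrow> complex) set \<Rightarrow> ('g \<Rightarrow> complex) \<Rightarrow> bool"
  where "nat_combination base \<alpha> \<longleftrightarrow> (\<exists>c :: _ \<Rightarrow> nat. \<forall>x. \<alpha> x = (\<Sum>\<beta>\<in>base. of_nat (c \<beta>) * \<beta> x))"

definition root_base ::
    "('g::complex_vector \<Rightarrow> 'g \<Rightarrow> 'g) \<Rightarrow> 'g set \<Rightarrow> ('g \<Rightarrow> complex) set \<Rightarrow> bool"
  where "root_base br h base \<longleftrightarrow> finite base \<and> base \<subseteq> roots br h \<and>
    (\<forall>c. (\<forall>x. (\<Sum>\<beta>\<in>base. c \<beta> * \<beta> x) = 0) \<longrightarrow> (\<forall>\<beta>\<in>base. c \<beta> = 0)) \<and>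
    (\<forall>\<alpha>\<in>roots br h. nat_combination base \<alpha> \<or> nat_combination base (\<lambda>x. - \<alpha> x))"

text \<open>The summand \<open>g\<^sup>+\<close> of the triangular decomposition determined by the base \<open>base\<close>.\<close>

definition positive_part ::
    "('g::complex_vector \<Rightarrow> 'g \<Rightarrow> 'g) \<Rightarrow> 'g set \<Rightarrow> ('g \<Rightarrow> complex) set \<Rightarrow> 'g set"
  where "positive_part br h base = complex_vector.span
    (\<Union>\<alpha>\<in>{\<alpha> \<in> roots br h. nat_combination base \<alpha>}. root_space br h \<alpha>)"

definition nondegenerate_form :: "('g::complex_vector \<Rightarrow> 'g \<Rightarrow> complex) \<Rightarrow> bool"
  where "nondegenerate_form form \<longleftrightarrow> (\<forall>x. (\<forall>y. form x y = 0) \<longrightarrow> x = 0)"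

text \<open>The vector of \<open>h\<close> representing the functional \<open>\<alpha>\<close>; it exists and is unique when \<open>form\<close> is
  nondegenerate on the finite dimensional space \<open>h\<close>.\<close>

definition dual_vector ::
    "('g::complex_vector \<Rightarrow> 'g \<Rightarrow> complex) \<Rightarrow> 'g set \<Rightarrow> ('g \<Rightarrow> complex) \<Rightarrow> 'g"
  where "dual_vector form h \<alpha> = (THE t. t \<in> h \<and> (\<forall>x\<in>h. form t x = \<alpha> x))"

definition highest_root ::
    "('g::complex_vector \<Rightarrow> 'g \<Rightarrow> 'g) \<Rightarrow> 'g set \<Rightarrow> ('g \<Rightarrow> complex) set \<Rightarrow> ('g \<Rightarrow> complex) \<Rightarrow> bool"
  where "highest_root br h base \<theta> \<longleftrightarrow> \<theta> \<in> roots br h \<and>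
    (\<forall>\<beta>\<in>roots br h. nat_combination base (\<lambda>x. \<theta> x - \<beta> x))"

text \<open>The usual normalization: \<open>(\<theta>, \<theta>) = 2\<close> for the highest root \<open>\<theta>\<close>, in the form induced on
  the dual of \<open>h\<close>.\<close>

definition normalized_form ::
    "('g::complex_vector \<Rightarrow> 'g \<Rightarrow> 'g) \<Rightarrow> 'g set \<Rightarrow> ('g \<Rightarrow> complex) set \<Rightarrow>
      ('g \<Rightarrow> 'g \<Rightarrow> complex) \<Rightarrow> bool"
  where "normalized_form br h base form \<longleftrightarrow>
    (\<exists>\<theta>. highest_root br h base \<theta> \<and> form (dual_vector form h \<theta>) (dual_vector form h \<theta>) = 2)"


section \<open>Modules over \<open>\<tau>(B)\<close>\<close>

definition lie_module ::
    "('l::complex_vector \<Rightarrow> 'l \<Rightarrow> 'l) \<Rightarrow> ('l \<Rightarrow> 'v::complex_vector \<Rightarrow> 'v) \<Rightarrow> bool"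
  where "lie_module br \<rho> \<longleftrightarrow> bilin \<rho> \<and>
    (\<forall>x y v. \<rho> (br x y) v = \<rho> x (\<rho> y v) - \<rho> y (\<rho> x v))"

definition irreducible_module :: "('l::complex_vector \<Rightarrow> 'v::complex_vector \<Rightarrow> 'v) \<Rightarrow> bool"
  where "irreducible_module \<rho> \<longleftrightarrow> (UNIV :: 'v set) \<noteq> {0} \<and>
    (\<forall>W. complex_vector.subspace W \<and> (\<forall>x. \<forall>w\<in>W. \<rho> x w \<in> W) \<longrightarrow> W = {0} \<or> W = UNIV)"

definition weight_space ::
    "('l::complex_vector \<Rightarrow> 'v::complex_vector \<Rightarrow> 'v) \<Rightarrow> 'l set \<Rightarrow> ('l \<Rightarrow> complex) \<Rightarrow> 'v set"
  where "weight_space \<rho> H \<mu> = {v. \<forall>x\<in>H. \<rho> x v = \<mu> x *\<^sub>C v}"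

definition is_direct_sum :: "('i \<Rightarrow> 'v::complex_vector set) \<Rightarrow> 'i set \<Rightarrow> bool"
  where "is_direct_sum W I \<longleftrightarrow>
    (\<forall>v. \<exists>!f. finite {i. f i \<noteq> 0} \<and> (\<forall>i\<in>I. f i \<in> W i) \<and> (\<forall>i. i \<notin> I \<longrightarrow> f i = 0) \<and>
      v = (\<Sum>i | f i \<noteq> 0. f i))"

text \<open>\<open>H = h \<oplus> \<Oplus>\<^sub>i \<complex>K\<^sub>i \<oplus> \<Oplus>\<^sub>i \<complex>d\<^sub>i\<close>.\<close>

definition toroidal_cartan ::
    "'g::complex_vector set \<Rightarrow> ('g, 'n::finite, 'b::complex_comm_algebra_1) toroidal set"
  where "toroidal_cartan h = complex_vector.span
    ({loop_elt x 0 1 | x. x \<in> h} \<union> range (\<lambda>i. central_elt 0 i 1) \<union> range degree_elt)"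

text \<open>\<open>\<tau>(B)\<^sup>+\<close>; the argument \<open>np\<close> is \<open>g\<^sup>+\<close>.\<close>

definition toroidal_plus ::
    "'g::complex_vector set \<Rightarrow> ('g, 'n::finite, 'b::complex_comm_algebra_1) toroidal set"
  where "toroidal_plus np = complex_vector.span
    ({loop_elt x k b | x k b. x \<in> np \<and> k $ None = 0} \<union>
     {loop_elt x k b | x k b. k $ None \<ge> 1} \<union>
     {central_elt k i b | k i b. k $ None \<ge> 1})"

definition integrable_module ::
    "('g::complex_vector \<Rightarrow> 'g \<Rightarrow> 'g) \<Rightarrow> 'g set \<Rightarrow>
      (('g, 'n::finite, 'b::complex_comm_algebra_1) toroidal \<Rightarrow> 'v::complex_vector \<Rightarrow> 'v) \<Rightarrow> bool"
  where "integrable_module br h \<rho> \<longleftrightarrow>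
    is_direct_sum (weight_space \<rho> (toroidal_cartan h)) (dual (toroidal_cartan h)) \<and>
    (\<forall>\<alpha>\<in>roots br h. \<forall>x\<in>root_space br h \<alpha>. \<forall>m b v. \<exists>k. (\<rho> (loop_elt x m b) ^^ k) v = 0)"

definition vacuum_space ::
    "('g::complex_vector \<Rightarrow> 'g \<Rightarrow> 'g) \<Rightarrow> 'g set \<Rightarrow> ('g \<Rightarrow> complex) set \<Rightarrow>
      (('g, 'n::finite, 'b::complex_comm_algebra_1) toroidal \<Rightarrow> 'v::complex_vector \<Rightarrow> 'v) \<Rightarrow> 'v set"
  where "vacuum_space br h base \<rho> =
    {v. \<forall>x\<in>toroidal_plus (positive_part br h base). \<rho> x v = 0}"

end

theory Submission
  imports Defs
begin

text \<open>
  The multiplicities of \<open>V\<close> itself are bounded along every coset \<open>\<lambda> + \<int>\<^sup>n\<close>, where \<open>\<int>\<^sup>n\<close> is the lattice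
  spanned by the weights \<open>\<delta>\<^sub>1, \<dots>, \<delta>\<^sub>n\<close> dual to \<open>d\<^sub>1, \<dots>, d\<^sub>n\<close>, and all weights of \<open>T\<close> lie in one
  such coset.

  For the first claim let \<open>\<theta>\<close> be the highest root, \<open>\<delta>\<^sub>0\<close> the weight dual to \<open>d\<^sub>0\<close>, and consider the
  \<open>sl\<^sub>2\<close> with root vectors of weights \<open>\<plusminus>(\<theta> + m\<^sub>0 \<delta>\<^sub>0 + \<delta>\<^sub>m)\<close>, \<open>m \<in> \<int>\<^sup>n\<close>. Its coroot is
  \<open>\<theta>\<^sup>\<or> + m\<^sub>0 K\<^sub>0 + \<Sum>\<^sub>i m\<^sub>i K\<^sub>i\<close>, and as \<open>K\<^sub>1, \<dots>, K\<^sub>n\<close> act by zero, its value on \<open>\<lambda> + \<delta>\<^sub>k\<close> is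
  \<open>M = \<lambda> \<theta>\<^sup>\<or> + m\<^sub>0 c\<^sub>0\<close>, independent of \<open>k\<close> and \<open>m\<close>. Since \<open>c\<^sub>0 \<noteq> 0\<close>, some \<open>m\<^sub>0 \<in> {0, 1}\<close> gives
  \<open>M \<noteq> 0\<close>. By local nilpotency the lowering operator of this \<open>sl\<^sub>2\<close> is injective on vectors whose
  \<open>H\<close>-eigenvalue is not in \<open>{0, -1, -2, \<dots>}\<close>, and the raising operator on those whose eigenvalue is
  not in \<open>{0, 1, 2, \<dots>}\<close> (\<open>sl2_lowering_kernel_zero\<close>). Suppose the lowering operator is injective;
  choosing \<open>m = k\<close>, it embeds \<open>V\<close> at \<open>\<lambda> + \<delta>\<^sub>k\<close> into \<open>V\<close> at \<open>\<lambda> - \<theta> - m\<^sub>0 \<delta>\<^sub>0\<close>, a single finite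
  dimensional space that serves all \<open>k\<close>. The other case is symmetric (\<open>multiplicity_bounded\<close>).

  For the second claim, the products of elements of \<open>\<tau>(B)\<^sup>-\<close> and \<open>\<tau>(B)\<^sup>0\<close>, applied to a nonzero weight
  vector of \<open>T\<close>, span a submodule, hence all of \<open>V\<close> (\<open>descendants_stable\<close>). So every weight of \<open>V\<close>
  lies below every weight of \<open>T\<close>; two weights of \<open>T\<close> lie below each other and thus differ by
  an element of \<open>\<int>\<^sup>n\<close> (\<open>lower_weights_antisym\<close>).

  Both arguments use the root space decomposition of \<open>g\<close>. Here \<open>h\<close> is given as a nilpotent
  self-normalizing subalgebra, and the decomposition is read off from \<open>V\<close>: \<open>g\<close> acts faithfully,
  because \<open>K\<^sub>0\<close> does not act by zero, and \<open>h\<close> acts diagonalizably on \<open>V\<close>, hence on \<open>g\<close>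
  (\<open>diagonalizable_adjoint\<close>).
\<close>

section \<open>Joint eigenvectors\<close>

lemma clinear_sum:
  assumes "clinear f"
  shows "f (sum g A) = (\<Sum>i\<in>A. f (g i))"
  by (induction A rule: infinite_finite_induct) (simp_all add: clinearD[OF assms])

lemma clinear_image_span_subset:
  assumes "clinear f" "\<And>x. x \<in> S \<Longrightarrow> f x \<in> complex_vector.span T" "v \<in> complex_vector.span S"
  shows "f v \<in> complex_vector.span T"
  using assms(3)
proof (induction rule: complex_vector.span_induct_alt)
  case base
  show ?case by (simp add: clinearD[OF assms(1)] complex_vector.span_zero)
next
  case (step c x y)
  then show ?case
    by (simp add: clinearD[OF assms(1)] complex_vector.span_add complex_vector.span_scale assms(2))
qed

text \<open>Applying \<open>\<rho> X - c\<close>, for one operator \<open>X\<close> that tells \<open>w\<close> from a summand \<open>u j\<close> with eigenvalue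
  \<open>c\<close>, removes that summand and only rescales \<open>w\<close> and the other summands; so the summands can be
  removed one at a time.\<close>

lemma sum_of_foreign_eigenvectors_zero:
  fixes \<rho> :: "'l \<Rightarrow> 'v::complex_vector \<Rightarrow> 'v" and u :: "'j \<Rightarrow> 'v"
  assumes "finite J" and "\<And>X. X \<in> S \<Longrightarrow> clinear (\<rho> X)"
    and "\<And>X j. X \<in> S \<Longrightarrow> j \<in> J \<Longrightarrow> \<exists>c. \<rho> X (u j) = c *\<^sub>C u j"
    and "\<And>j. j \<in> J \<Longrightarrow> \<exists>X\<in>S. \<exists>c p. \<rho> X (u j) = c *\<^sub>C u j \<and> \<rho> X w = p *\<^sub>C w \<and> c \<noteq> p"
    and "w = sum u J"
  shows "w = 0"
  using assms
proof (induction J arbitrary: u w rule: finite_induct)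
  case (insert j J)
  obtain X c p where X: "X \<in> S" "\<rho> X (u j) = c *\<^sub>C u j" "\<rho> X w = p *\<^sub>C w" "c \<noteq> p"
    using insert.prems(3)[of j] by blast
  have "\<exists>d. \<forall>i\<in>J. \<rho> X (u i) = d i *\<^sub>C u i"
    using insert.prems(2)[OF X(1)] by (intro bchoice) auto
  then obtain d where d: "\<rho> X (u i) = d i *\<^sub>C u i" if "i \<in> J" for i by blast
  note lin = insert.prems(1)
  have "(p - c) *\<^sub>C w = \<rho> X w - c *\<^sub>C w" by (simp add: X scaleC_simps)
  also have "\<dots> = (\<Sum>i\<in>insert j J. \<rho> X (u i) - c *\<^sub>C u i)"
    by (simp add: insert.prems(4) clinear_sum[OF lin[OF X(1)]] sum_subtractf
        complex_vector.scale_sum_right del: sum.insert)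
  also have "\<dots> = (\<Sum>i\<in>J. (d i - c) *\<^sub>C u i)"
    using insert.hyps by (simp add: X d scaleC_simps)
  finally have sum: "(p - c) *\<^sub>C w = (\<Sum>i\<in>J. (d i - c) *\<^sub>C u i)" .
  have "(p - c) *\<^sub>C w = 0"
  proof (rule insert.IH[where u = "\<lambda>i. (d i - c) *\<^sub>C u i"])
    fix Y i assume Y: "Y \<in> S" and i: "i \<in> J"
    show "\<exists>e. \<rho> Y ((d i - c) *\<^sub>C u i) = e *\<^sub>C (d i - c) *\<^sub>C u i"
      using insert.prems(2)[OF Y, of i] i by (auto simp: clinearD[OF lin[OF Y]] mult.commute)
  next
    fix i assume i: "i \<in> J"
    obtain Y e q where Y: "Y \<in> S" "\<rho> Y (u i) = e *\<^sub>C u i" "\<rho> Y w = q *\<^sub>C w" "e \<noteq> q"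
      using insert.prems(3)[of i] i by blast
    show "\<exists>Y\<in>S. \<exists>e q. \<rho> Y ((d i - c) *\<^sub>C u i) = e *\<^sub>C (d i - c) *\<^sub>C u i \<and>
      \<rho> Y ((p - c) *\<^sub>C w) = q *\<^sub>C (p - c) *\<^sub>C w \<and> e \<noteq> q"
      by (rule bexI[of _ Y], rule exI[of _ e], rule exI[of _ q])
        (use Y in \<open>simp_all add: clinearD[OF lin[OF Y(1)]] mult.commute\<close>)
  qed (use sum lin in auto)
  then show ?case using X(4) by simp
qed simp

lemma lie_module_clinear: "lie_module br \<rho> \<Longrightarrow> clinear (\<rho> x)"
  by (simp add: lie_module_def bilin_def)

lemma lie_module_eigenvector_shift:
  assumes "lie_module br \<rho>" "br y x = q *\<^sub>C x" "\<rho> y v = c *\<^sub>C v"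
  shows "\<rho> y (\<rho> x v) = (c + q) *\<^sub>C \<rho> x v"
proof -
  have "\<rho> (br y x) v = \<rho> y (\<rho> x v) - \<rho> x (\<rho> y v)"
    using assms(1) by (auto simp: lie_module_def)
  moreover have "bilin \<rho>" using assms(1) by (simp add: lie_module_def)
  ultimately have "q *\<^sub>C \<rho> x v = \<rho> y (\<rho> x v) - c *\<^sub>C \<rho> x v"
    by (simp add: assms(2,3) bilinD)
  then show ?thesis by (simp add: scaleC_simps algebra_simps)
qed

text \<open>A finite subfamily whose common kernel has least dimension will do: no further map of the
  family can cut this kernel down, so it is the common kernel of the whole family.\<close>

lemma finite_faithful_subfamily:
  fixes T :: "'i \<Rightarrow> 'g::complex_vector \<Rightarrow> 'v::complex_vector"
  assumes "fin_dim (UNIV :: 'g set)" and "\<And>i. i \<in> I \<Longrightarrow> clinear (T i)"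
    and "\<And>y. (\<forall>i\<in>I. T i y = 0) \<Longrightarrow> y = 0"
  obtains F where "finite F" "F \<subseteq> I" "\<And>y. (\<forall>i\<in>F. T i y = 0) \<Longrightarrow> y = 0"
proof -
  obtain E :: "'g set" where E: "finite E" "UNIV \<subseteq> complex_vector.span E"
    using assms(1) by (auto simp: fin_dim_def)
  obtain B where B: "B \<subseteq> (UNIV :: 'g set)" "complex_vector.independent B"
    "UNIV \<subseteq> complex_vector.span B" by (rule complex_vector.basis_exists)
  have "finite B" using complex_vector.independent_span_bound[OF E(1) B(2)] E(2) by auto
  then interpret fd: finite_dimensional_vector_space "scaleC :: complex \<Rightarrow> 'g \<Rightarrow> 'g" B
    by unfold_locales (use B in auto)
  define K where "K F = {y. \<forall>i\<in>F. T i y = 0}" for F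
  have K: "complex_vector.subspace (K F)" if "F \<subseteq> I" for F
    unfolding K_def complex_vector.subspace_def
    using that assms(2) by (auto simp: clinearD subset_iff)
  define F where "F = (ARG_MIN (\<lambda>F. complex_vector.dim (K F)) F. finite F \<and> F \<subseteq> I)"
  have F: "finite F \<and> F \<subseteq> I"
    unfolding F_def by (rule arg_min_natI[of _ "{}"]) auto
  have min: "complex_vector.dim (K F) \<le> complex_vector.dim (K F')" if "finite F'" "F' \<subseteq> I" for F'
    unfolding F_def by (rule arg_min_nat_le) (use that in auto)
  have "y = 0" if y: "\<forall>i\<in>F. T i y = 0" for y
  proof (rule assms(3), intro ballI)
    fix i assume i: "i \<in> I"
    have "K (insert i F) = K F"
      using i F by (intro fd.subspace_dim_equal K min) (auto simp: K_def)
    then show "T i y = 0" using y by (auto simp: K_def)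
  qed
  with F that show thesis by blast
qed

lemma span_Union_finite:
  fixes E :: "'i \<Rightarrow> 'v::complex_vector set"
  assumes "w \<in> complex_vector.span (\<Union>i. E i)"
  shows "\<exists>A. finite A \<and> w \<in> complex_vector.span (\<Union>i\<in>A. E i)"
  using assms
proof (induction rule: complex_vector.span_induct_alt)
  case base
  show ?case by (rule exI[of _ "{}"]) (simp add: complex_vector.span_zero)
next
  case (step c x y)
  obtain A where A: "finite A" "y \<in> complex_vector.span (\<Union>i\<in>A. E i)" using step by blast
  obtain i where i: "x \<in> E i" using step by blast
  have "y \<in> complex_vector.span (\<Union>i\<in>insert i A. E i)"
    using A(2) by (rule complex_vector.span_mono[THEN subsetD, rotated]) auto
  moreover have "x \<in> complex_vector.span (\<Union>i\<in>insert i A. E i)"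
    using i by (intro complex_vector.span_base) auto
  ultimately show ?case using A(1)
    by (intro exI[of _ "insert i A"]) (auto intro: complex_vector.span_add complex_vector.span_scale)
qed

lemma weight_space_cong: "(\<And>x. x \<in> h \<Longrightarrow> a x = b x) \<Longrightarrow> weight_space \<rho> h a = weight_space \<rho> h b"
  by (auto simp: weight_space_def)

lemma subspace_weight_space:
  assumes "\<And>x. x \<in> h \<Longrightarrow> clinear (\<rho> x)"
  shows "complex_vector.subspace (weight_space \<rho> h a)"
  using assms by (auto simp: weight_space_def complex_vector.subspace_def clinearD
      scaleC_simps mult.commute)

text \<open>If \<open>h\<close> acts diagonalizably on a faithful module \<open>V\<close>, then it acts diagonalizably on the finite
  dimensional Lie algebra itself: finitely many weight vectors \<open>v\<close> already separate the elements
  \<open>y\<close>, and the maps \<open>y \<mapsto> \<sigma> y v\<close> carry \<open>ad x\<close> to \<open>\<sigma> x\<close> minus the eigenvalue of \<open>v\<close>. So a fixed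
  \<open>y\<close> involves only a finite set \<open>Q\<close> of functionals, and as long as two of them differ, \<open>y\<close> is
  a combination of two elements that involve fewer.\<close>

lemma diagonalizable_adjoint:
  fixes br :: "'g::complex_vector \<Rightarrow> 'g \<Rightarrow> 'g" and \<sigma> :: "'g \<Rightarrow> 'v::complex_vector \<Rightarrow> 'v"
  assumes fd: "fin_dim (UNIV :: 'g set)" and br: "bilin br" and mod: "lie_module br \<sigma>"
    and diag: "complex_vector.span (\<Union>a. weight_space \<sigma> h a) = UNIV"
    and faithful: "\<And>y. (\<forall>v. \<sigma> y v = 0) \<Longrightarrow> y = 0"
  shows "complex_vector.span (\<Union>q. weight_space br h q) = UNIV"
proof -
  have bil: "bilin \<sigma>" using mod by (simp add: lie_module_def)
  have lin: "clinear (\<sigma> x)" for x using mod by (rule lie_module_clinear)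
  have lin': "clinear (\<lambda>y. \<sigma> y v)" for v using bil by (simp add: bilin_def)
  have "y = 0" if *: "\<forall>v\<in>(\<Union>a. weight_space \<sigma> h a). \<sigma> y v = 0" for y
  proof (rule faithful, rule allI)
    fix v
    have "v \<in> complex_vector.span (\<Union>a. weight_space \<sigma> h a)" by (simp add: diag)
    then show "\<sigma> y v = 0"
      by (induction rule: complex_vector.span_induct_alt) (use * in \<open>auto simp: clinearD[OF lin]\<close>)
  qed
  then obtain F where F: "finite F" "F \<subseteq> (\<Union>a. weight_space \<sigma> h a)"
    "\<And>y. (\<forall>v\<in>F. \<sigma> y v = 0) \<Longrightarrow> y = 0"
    using finite_faithful_subfamily[of "\<Union>a. weight_space \<sigma> h a" "\<lambda>v y. \<sigma> y v"] fd lin' by metis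
  have "\<exists>a. \<forall>v\<in>F. v \<in> weight_space \<sigma> h (a v)"
    using F(2) by (intro bchoice) blast
  then obtain a where a: "\<sigma> x v = a v x *\<^sub>C v" if "v \<in> F" "x \<in> h" for v x
    by (auto simp: weight_space_def)
  define E where "E v Q = complex_vector.span (\<Union>q\<in>Q. weight_space \<sigma> h (\<lambda>x. a v x + q x))" for v Q
  let ?M = "complex_vector.span (\<Union>q. weight_space br h q)"
  \<comment> \<open>\<open>ad x - q x\<close> kills the component of \<open>y\<close> on which \<open>h\<close> acts by \<open>q\<close>.\<close>
  have drop: "\<sigma> (br x y - q x *\<^sub>C y) v \<in> E v (Q - {q})"
    if "\<sigma> y v \<in> E v Q" "x \<in> h" "v \<in> F" for x y v q and Q :: "('g \<Rightarrow> complex) set"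
  proof -
    have "\<sigma> (br x y - q x *\<^sub>C y) v = \<sigma> x (\<sigma> y v) - \<sigma> y (\<sigma> x v) - q x *\<^sub>C \<sigma> y v"
      using mod by (simp add: lie_module_def bilinD[OF bil])
    also have "\<dots> = \<sigma> x (\<sigma> y v) - (a v x + q x) *\<^sub>C \<sigma> y v"
      by (simp add: a[OF that(3,2)] clinearD[OF lin] scaleC_simps)
    also have "\<dots> \<in> E v (Q - {q})"
    proof -
      let ?D = "\<lambda>w. \<sigma> x w - (a v x + q x) *\<^sub>C w"
      have "clinear ?D"
        by (rule clinearI) (simp_all add: clinearD[OF lin] scaleC_simps algebra_simps)
      moreover have "?D w \<in> E v (Q - {q})"
        if w: "w \<in> (\<Union>q\<in>Q. weight_space \<sigma> h (\<lambda>x. a v x + q x))" for w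
      proof -
        obtain p where p: "p \<in> Q" "w \<in> weight_space \<sigma> h (\<lambda>x. a v x + p x)" using w by blast
        have D: "?D w = (p x - q x) *\<^sub>C w"
          using p(2) \<open>x \<in> h\<close> by (simp add: weight_space_def scaleC_simps)
        show ?thesis
        proof (cases "p = q")
          case True
          then show ?thesis unfolding D by (simp add: E_def complex_vector.span_zero)
        next
          case False
          then show ?thesis unfolding D E_def using p
            by (intro complex_vector.span_scale complex_vector.span_base) blast
        qed
      qed
      ultimately show ?thesis
        using that(1) unfolding E_def by (rule clinear_image_span_subset[where f = ?D])
    qed
    finally show ?thesis .
  qed
  have "\<forall>y. (\<forall>v\<in>F. \<sigma> y v \<in> E v Q) \<longrightarrow> y \<in> ?M" if "finite Q" for Q
    using that
  proof (induction Q rule: finite_psubset_induct)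
    case (psubset Q)
    show ?case
    proof (intro allI impI)
      fix y assume y: "\<forall>v\<in>F. \<sigma> y v \<in> E v Q"
      show "y \<in> ?M"
      proof (cases "\<exists>q\<in>Q. \<exists>q'\<in>Q. \<exists>x\<in>h. q x \<noteq> q' x")
        case True
        then obtain q q' x where q: "q \<in> Q" "q' \<in> Q" "x \<in> h" "q x \<noteq> q' x" by blast
        have 1: "br x y - r x *\<^sub>C y \<in> ?M" if r: "r \<in> Q" for r
        proof -
          have "\<forall>v\<in>F. \<sigma> (br x y - r x *\<^sub>C y) v \<in> E v (Q - {r})"
            using drop y q(3) by blast
          then show ?thesis using psubset.IH[of "Q - {r}"] r by blast
        qed
        have "(br x y - q x *\<^sub>C y) - (br x y - q' x *\<^sub>C y) = (q' x - q x) *\<^sub>C y"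
          by (simp add: scaleC_simps)
        then have "(q' x - q x) *\<^sub>C y \<in> ?M"
          using complex_vector.span_diff[OF 1[OF q(1)] 1[OF q(2)]] by simp
        then have "(1 / (q' x - q x)) *\<^sub>C (q' x - q x) *\<^sub>C y \<in> ?M"
          by (rule complex_vector.span_scale)
        then show ?thesis using q(4) by simp
      next
        case False
        then have agree: "\<forall>p\<in>Q. \<forall>p'\<in>Q. \<forall>x\<in>h. p x = p' x" by simp
        show ?thesis
        proof (cases "Q = {}")
          case True
          then have "y = 0" using y by (intro F(3)) (auto simp: E_def)
          then show ?thesis by (simp add: complex_vector.span_zero)
        next
          case nonempty: False
          then obtain q where q: "q \<in> Q" by blast
          have same: "p x = q x" if "p \<in> Q" "x \<in> h" for p x
            by (rule agree[rule_format, OF that(1) q that(2)])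
          have w: "\<sigma> y v \<in> weight_space \<sigma> h (\<lambda>x. a v x + q x)" if v: "v \<in> F" for v
          proof -
            let ?W = "weight_space \<sigma> h (\<lambda>x. a v x + q x)"
            have "weight_space \<sigma> h (\<lambda>x. a v x + p x) = ?W" if p: "p \<in> Q" for p
              by (rule weight_space_cong) (simp add: same[OF p])
            then have "(\<Union>p\<in>Q. weight_space \<sigma> h (\<lambda>x. a v x + p x)) \<subseteq> ?W" by (intro UN_least) simp
            then have "E v Q \<subseteq> ?W"
              unfolding E_def by (intro complex_vector.span_minimal subspace_weight_space lin)
            then show ?thesis using y v by blast
          qed
          have "br x y = q x *\<^sub>C y" if x: "x \<in> h" for x
          proof -
            have "br x y - q x *\<^sub>C y = 0"
            proof (rule F(3), intro ballI)
              fix v assume v: "v \<in> F"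
              have "\<sigma> (br x y) v = \<sigma> x (\<sigma> y v) - \<sigma> y (\<sigma> x v)"
                using mod by (simp add: lie_module_def)
              also have "\<dots> = q x *\<^sub>C \<sigma> y v"
                using w[OF v] x by (simp add: weight_space_def a[OF v x] clinearD[OF lin] scaleC_simps)
              finally show "\<sigma> (br x y - q x *\<^sub>C y) v = 0" by (simp add: bilinD[OF bil])
            qed
            then show ?thesis by simp
          qed
          then have "y \<in> weight_space br h q" by (simp add: weight_space_def)
          then show ?thesis by (intro complex_vector.span_base) blast
        qed
      qed
    qed
  qed
  note reduce = this
  have "y \<in> ?M" for y
  proof -
    have "\<exists>Q. finite Q \<and> \<sigma> y v \<in> E v Q" for v
    proof -
      have "\<sigma> y v \<in> complex_vector.span (\<Union>p. weight_space \<sigma> h p)" by (simp add: diag)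
      then obtain P where P: "finite P" "\<sigma> y v \<in> complex_vector.span (\<Union>p\<in>P. weight_space \<sigma> h p)"
        using span_Union_finite by blast
      then show ?thesis
        by (intro exI[of _ "(\<lambda>p x. p x - a v x) ` P"]) (simp add: E_def)
    qed
    then obtain Q where Q: "finite (Q v)" "\<sigma> y v \<in> E v (Q v)" for v by metis
    have "\<sigma> y v \<in> E v (\<Union>v\<in>F. Q v)" if "v \<in> F" for v
    proof -
      have "E v (Q v) \<subseteq> E v (\<Union>v\<in>F. Q v)"
        unfolding E_def using that by (intro complex_vector.span_mono) blast
      then show ?thesis using Q(2) by blast
    qed
    then show ?thesis using reduce[of "\<Union>v\<in>F. Q v"] Q(1) F(1) by blast
  qed
  then show ?thesis by blast
qed

text \<open>The \<open>sl\<^sub>2\<close> computation: on a vector \<open>u\<close> of \<open>H\<close>-eigenvalue \<open>M\<close> killed by \<open>F\<close> one has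
  \<open>F E\<^sup>k\<^sup>+\<^sup>1 u = -(k + 1) (M + k) E\<^sup>k u\<close>. So if \<open>u\<close> were nonzero, then \<open>E\<close> could be nilpotent on it only
  for \<open>M \<in> {0, -1, -2, \<dots>}\<close>.\<close>

lemma sl2_lowering_kernel_zero:
  fixes E F H :: "'v::complex_vector \<Rightarrow> 'v"
  assumes lin: "clinear E" "clinear F" "clinear H"
    and EF: "\<And>v. E (F v) - F (E v) = H v" and HE: "\<And>v. H (E v) - E (H v) = 2 *\<^sub>C E v"
    and u: "F u = 0" "H u = M *\<^sub>C u" and nil: "(E ^^ k) u = 0"
    and M: "\<And>j::nat. M + of_nat j \<noteq> 0"
  shows "u = 0"
proof -
  have H: "H ((E ^^ j) u) = (M + 2 * of_nat j) *\<^sub>C (E ^^ j) u" for j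
  proof (induction j)
    case (Suc j)
    have "H ((E ^^ Suc j) u) = 2 *\<^sub>C (E ^^ Suc j) u + E (H ((E ^^ j) u))"
      using HE[of "(E ^^ j) u"] by (simp add: algebra_simps)
    then show ?case by (simp add: Suc clinearD[OF lin(1)] algebra_simps flip: scaleC_add_left)
  qed (simp add: u)
  have F: "F ((E ^^ Suc j) u) = - ((of_nat (Suc j) * (M + of_nat j)) *\<^sub>C (E ^^ j) u)" for j
  proof (induction j)
    case 0
    have "- F (E u) = M *\<^sub>C u" using EF[of u] by (simp add: u clinearD[OF lin(1)])
    then have "F (E u) = - (M *\<^sub>C u)" by (metis minus_minus)
    then show ?case by simp
  next
    case (Suc j)
    have "F ((E ^^ Suc (Suc j)) u) = E (F ((E ^^ Suc j) u)) - H ((E ^^ Suc j) u)"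
      using EF[of "(E ^^ Suc j) u"] by (simp add: algebra_simps)
    also have "\<dots> = - ((of_nat (Suc j) * (M + of_nat j)) *\<^sub>C (E ^^ Suc j) u)
        - (M + 2 * of_nat (Suc j)) *\<^sub>C (E ^^ Suc j) u"
      unfolding Suc H by (simp add: clinearD[OF lin(1)])
    also have "\<dots> = - ((of_nat (Suc j) * (M + of_nat j) + (M + 2 * of_nat (Suc j))) *\<^sub>C (E ^^ Suc j) u)"
      by (simp only: scaleC_add_left minus_add_distrib) simp
    also have "of_nat (Suc j) * (M + of_nat j) + (M + 2 * of_nat (Suc j))
        = of_nat (Suc (Suc j)) * (M + of_nat (Suc j))"
      by (simp add: algebra_simps)
    finally show ?case .
  qed
  show ?thesis
    using nil
  proof (induction k)
    case (Suc k)
    have "(of_nat (Suc k) * (M + of_nat k)) *\<^sub>C (E ^^ k) u = 0"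
      using F[of k] unfolding Suc.prems by (simp add: clinearD[OF lin(2)])
    moreover have "of_nat (Suc k) * (M + of_nat k) \<noteq> 0"
      using M[of k] by (simp only: mult_eq_0_iff of_nat_eq_0_iff) simp
    ultimately show ?case using Suc.IH by simp
  qed simp
qed

lemma dim_le_of_injective_map:
  fixes f :: "'v::complex_vector \<Rightarrow> 'w::complex_vector"
  assumes f: "clinear f" and S: "complex_vector.subspace S"
    and inj: "\<And>v. v \<in> S \<Longrightarrow> f v = 0 \<Longrightarrow> v = 0"
    and sub: "\<And>v. v \<in> S \<Longrightarrow> f v \<in> S'" and fd: "fin_dim S'"
  shows "complex_vector.dim S \<le> complex_vector.dim S'"
proof -
  interpret f: Vector_Spaces.linear scaleC scaleC f by (rule f)
  obtain B where B: "B \<subseteq> S" "complex_vector.independent B" "S \<subseteq> complex_vector.span B"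
    "card B = complex_vector.dim S" by (rule complex_vector.basis_exists)
  obtain C where C: "C \<subseteq> S'" "complex_vector.independent C" "S' \<subseteq> complex_vector.span C"
    "card C = complex_vector.dim S'" by (rule complex_vector.basis_exists)
  have "finite C"
    using fd C(1,2) complex_vector.independent_span_bound unfolding fin_dim_def by blast
  have spanB: "complex_vector.span B = S"
    using B S by (metis complex_vector.span_subspace)
  have injS: "inj_on f S"
  proof (rule inj_onI)
    fix x y assume "x \<in> S" "y \<in> S" "f x = f y"
    then show "x = y"
      using inj[of "x - y"] complex_vector.subspace_diff[OF S] by (simp add: clinearD[OF f])
  qed
  have "complex_vector.independent (f ` B)"
    using B(2) injS unfolding spanB[symmetric] by (rule f.independent_inj_on_image)
  moreover have "f ` B \<subseteq> complex_vector.span C" using B(1) sub C(3) by blast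
  ultimately have "card (f ` B) \<le> card C"
    using complex_vector.independent_span_bound[OF \<open>finite C\<close>] by blast
  moreover have "card (f ` B) = card B"
    using injS B(1) by (meson card_image inj_on_subset)
  ultimately show ?thesis using B(4) C(4) by simp
qed


section \<open>Generators of \<open>\<tau>(B)\<close>\<close>

lemma clinear_current_embedding:
  fixes b :: "'b::complex_comm_algebra_1"
  shows "clinear (\<lambda>s. (((s, 0) :: ('g::complex_vector, 'n::finite) tau0) \<otimes> b, 0 :: complex ^ 'n option))"
    and "clinear (\<lambda>z. (((0, z) :: ('g, 'n) tau0) \<otimes> b, 0 :: complex ^ 'n option))"
proof -
  note lin = bilinD(1-4)[OF bilin_tensor]
  show "clinear (\<lambda>s. (((s, 0) :: ('g::complex_vector, 'n::finite) tau0) \<otimes> b, 0 :: complex ^ 'n option))"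
  proof (rule clinearI)
    fix s t :: "('g, 'n laurent) tensor" and c
    have "(s + t, 0) = (s, 0) + (t, 0 :: 'n omega_mod_exact)" by simp
    then show "(((s + t, 0) :: ('g, 'n) tau0) \<otimes> b, 0 :: complex ^ 'n option)
      = ((s, 0) \<otimes> b, 0) + ((t, 0) \<otimes> b, 0)" by (simp only: lin) simp
    have "(c *\<^sub>C s, 0) = c *\<^sub>C (s, 0 :: 'n omega_mod_exact)" by (simp add: scaleC_prod_def)
    then show "(((c *\<^sub>C s, 0) :: ('g, 'n) tau0) \<otimes> b, 0 :: complex ^ 'n option)
      = c *\<^sub>C ((s, 0) \<otimes> b, 0)"
      by (simp only: lin) (simp add: scaleC_prod_def[of _ "(_ \<otimes> _, _)"])
  qed
  show "clinear (\<lambda>z. (((0, z) :: ('g, 'n) tau0) \<otimes> b, 0 :: complex ^ 'n option))"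
  proof (rule clinearI)
    fix s t :: "'n omega_mod_exact" and c
    have "(0, s + t) = (0, s) + (0 :: ('g, 'n laurent) tensor, t)" by simp
    then show "(((0, s + t) :: ('g, 'n) tau0) \<otimes> b, 0 :: complex ^ 'n option)
      = ((0, s) \<otimes> b, 0) + ((0, t) \<otimes> b, 0)" by (simp only: lin) simp
    have "(0, c *\<^sub>C s) = c *\<^sub>C (0 :: ('g, 'n laurent) tensor, s)" by (simp add: scaleC_prod_def)
    then show "(((0, c *\<^sub>C s) :: ('g, 'n) tau0) \<otimes> b, 0 :: complex ^ 'n option)
      = c *\<^sub>C ((0, s) \<otimes> b, 0)"
      by (simp only: lin) (simp add: scaleC_prod_def[of _ "(_ \<otimes> _, _)"])
  qed
qed

lemma clinear_loop_elt: "clinear (\<lambda>x. loop_elt x k b)"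
  unfolding loop_elt_def
  by (rule clinearI) (simp_all only: bilinD[OF bilin_tensor] clinearD[OF clinear_current_embedding(1)])

lemma toroidal_generators_span:
  fixes S :: "('g::complex_vector, 'n::finite, 'b::complex_comm_algebra_1) toroidal set"
  assumes "complex_vector.subspace S" and "\<And>x k b. loop_elt x k b \<in> S"
    and "\<And>k i b. central_elt k i b \<in> S" and "\<And>i. degree_elt i \<in> S"
  shows "S = UNIV"
proof -
  note S_add = complex_vector.subspace_add[OF assms(1)] and S_scale = complex_vector.subspace_scale[OF assms(1)]
    and S_zero = complex_vector.subspace_0[OF assms(1)]
  note lin = clinearD[OF clinear_current_embedding(1)] clinearD[OF clinear_current_embedding(2)]
  have poly: "((x \<otimes> p, 0) \<otimes> b, 0) \<in> S" for x :: 'g and p :: "'n laurent" and b :: 'b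
  proof (induction p rule: free_induct)
    case zero
    show ?case using S_zero by (simp add: bilinD[OF bilin_tensor] flip: zero_prod_def)
  next
    case (single c k)
    have "((x \<otimes> (c *\<^sub>C monom k), 0) \<otimes> b, 0) = c *\<^sub>C loop_elt x k b"
      unfolding loop_elt_def bilinD[OF bilin_tensor] by (rule lin)
    then show ?case using S_scale[OF assms(2)] by simp
  next
    case (add p q)
    have "(((x \<otimes> (p + q), 0) :: ('g, 'n) tau0) \<otimes> b, 0) = ((x \<otimes> p, 0) \<otimes> b, 0) + ((x \<otimes> q, 0) \<otimes> b, 0 :: complex ^ 'n option)"
      unfolding bilinD(3)[OF bilin_tensor] by (rule lin)
    then show ?case using S_add[OF add] by (simp only:)
  qed
  have loop: "((s, 0) \<otimes> b, 0) \<in> S" for s :: "('g, 'n laurent) tensor" and b :: 'b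
  proof (induction s rule: tensor_induct)
    case zero
    show ?case using S_zero by (simp add: bilinD[OF bilin_tensor] flip: zero_prod_def)
  next
    case (add s t)
    then show ?case using S_add by (simp only: lin)
  qed (rule poly)
  have cent: "((0, z) \<otimes> b, 0) \<in> S" for z :: "'n omega_mod_exact" and b :: 'b
  proof (induction z rule: omega_induct)
    case zero
    show ?case using S_zero by (simp add: bilinD[OF bilin_tensor] flip: zero_prod_def)
  next
    case (tK c k i)
    show ?case unfolding lin using S_scale[OF assms(3)] by (simp add: central_elt_def)
  next
    case (add s t)
    then show ?case using S_add by (simp only: lin)
  qed
  have tens: "(u, 0) \<in> S" for u :: "(('g, 'n) tau0, 'b) tensor"
  proof (induction u rule: tensor_induct)
    case zero
    show ?case using S_zero by (simp add: zero_prod_def)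
  next
    case (tensor X b)
    obtain s z where X: "X = (s, z)" by (cases X)
    have "(s, z) = (s, 0) + (0, z)" by simp
    then have "(X \<otimes> b, 0) = ((s, 0) \<otimes> b, 0) + ((0, z) \<otimes> b, 0 :: complex ^ 'n option)"
      unfolding X by (simp only: bilinD(1)[OF bilin_tensor]) simp
    then show ?case using S_add[OF loop cent] by simp
  next
    case (add s t)
    have "(s + t, 0) = (s, 0) + (t, 0 :: complex ^ 'n option)" by simp
    then show ?case using S_add[OF add] by (simp only:)
  qed
  have deg: "(0, \<delta>) \<in> S" for \<delta> :: "complex ^ 'n option"
  proof -
    have "((0 :: (('g, 'n) tau0, 'b) tensor), \<delta>) = (\<Sum>i\<in>UNIV. (\<delta> $ i) *\<^sub>C degree_elt i)"
      by (simp add: prod_eq_iff fst_sum snd_sum degree_elt_def scaleC_prod_def vec_eq_iff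
          scaleC_vec_def axis_def if_distrib cong: if_cong)
    then show ?thesis
      using complex_vector.subspace_sum[OF assms(1), of UNIV "\<lambda>i. (\<delta> $ i) *\<^sub>C degree_elt i"] S_scale[OF assms(4)]
      by simp
  qed
  have "X \<in> S" for X
    using S_add[OF tens[of "fst X"] deg[of "snd X"]] by simp
  then show ?thesis by blast
qed


section \<open>Integrable modules and their weight spaces\<close>

locale integrable_toroidal_module =
  fixes br :: "'g::complex_vector \<Rightarrow> 'g \<Rightarrow> 'g"
    and form :: "'g \<Rightarrow> 'g \<Rightarrow> complex"
    and h :: "'g set"
    and base :: "('g \<Rightarrow> complex) set"
    and \<rho> :: "('g, 'n::finite, 'b::complex_comm_algebra_1) toroidal \<Rightarrow> 'v::complex_vector \<Rightarrow> 'v"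
    and c0 :: nat
  assumes simple: "simple_lie_algebra br" and fin_dim_g: "fin_dim (UNIV :: 'g set)"
    and cartan: "cartan_subalgebra br h" and base: "root_base br h base"
    and form: "invariant_form br form" and nondeg: "nondegenerate_form form"
    and normalized: "normalized_form br h base form"
    and module: "lie_module (toroidal_bracket br form) \<rho>"
    and irreducible: "irreducible_module \<rho>"
    and integrable: "integrable_module br h \<rho>"
    and fin_dim_weight_space:
      "\<forall>\<mu>\<in>dual (toroidal_cartan h). fin_dim (weight_space \<rho> (toroidal_cartan h) \<mu>)"
    and level_pos: "c0 > 0" and K0: "\<forall>v. \<rho> (central_elt 0 None 1) v = of_nat c0 *\<^sub>C v"
    and Ki: "\<forall>i v. \<rho> (central_elt 0 (Some i) 1) v = 0"
begin

lemma lie: "lie_algebra br" using simple by (simp add: simple_lie_algebra_def)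
lemma bilin_br: "bilin br" using lie by (rule lie_algebra.bilin_br)
lemma bilin_form: "bilin form" using form by (simp add: invariant_form_def)
lemma form_inv: "form (br x y) z = form x (br y z)" using form unfolding invariant_form_def by blast
lemma bilin_rho: "bilin \<rho>" using module by (simp add: lie_module_def)
lemma clinear_rho: "clinear (\<rho> X)" using module by (rule lie_module_clinear)

lemma rho_bracket: "\<rho> (toroidal_bracket br form X Y) v = \<rho> X (\<rho> Y v) - \<rho> Y (\<rho> X v)"
  using module unfolding lie_module_def by blast

lemma subspace_h: "complex_vector.subspace h" using cartan by (simp add: cartan_subalgebra_def)

lemmas rel = toroidal_bracket_relations[OF bilin_br bilin_form]

lemma toroidal_anti:
  "toroidal_bracket br form Y X = - toroidal_bracket br form X (Y :: ('g, 'n, 'b) toroidal)"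
  by (rule lie_algebra.br_anti[OF lie_algebra_toroidal[OF lie form]])

lemma bracket_finite_loop:
  "toroidal_bracket br form (loop_elt x 0 1) (loop_elt y k (b::'b)) = loop_elt (br x y) (k :: 'n mdeg) b"
  by (simp add: rel(1))

lemma bracket_loop_finite:
  "toroidal_bracket br form (loop_elt x k (b::'b)) (loop_elt y 0 1) = loop_elt (br x y) (k :: 'n mdeg) b"
  by (simp add: rel(1) rel(7))

text \<open>The weight spaces for \<open>H\<close>, with a weight recorded by its values \<open>a\<close> on \<open>h\<close> and \<open>z\<close> on the
  \<open>d\<^sub>i\<close>; its values on the \<open>K\<^sub>i\<close> are the same for all weights of \<open>V\<close>. Weights can then be shifted
  without extending functionals linearly to the span \<open>H\<close>.\<close>

definition wt :: "('g \<Rightarrow> complex) \<Rightarrow> ('n option \<Rightarrow> complex) \<Rightarrow> 'v set"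
  where "wt a z = {v. (\<forall>x\<in>h. \<rho> (loop_elt x 0 1) v = a x *\<^sub>C v) \<and>
    (\<forall>i. \<rho> (degree_elt i) v = z i *\<^sub>C v)}"

lemma cartan_generators:
  "x \<in> h \<Longrightarrow> loop_elt x 0 1 \<in> toroidal_cartan h" "central_elt 0 i 1 \<in> toroidal_cartan h"
  "degree_elt i \<in> toroidal_cartan h"
  unfolding toroidal_cartan_def by (intro complex_vector.span_base; blast)+

lemma weight_space_subset_wt:
  "weight_space \<rho> (toroidal_cartan h) \<mu> \<subseteq> wt (\<lambda>x. \<mu> (loop_elt x 0 1)) (\<lambda>i. \<mu> (degree_elt i))"
  by (auto simp: weight_space_def wt_def cartan_generators)

lemma fin_dim_wt: "fin_dim (wt a z)"
proof (cases "wt a z \<subseteq> {0}")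
  case True
  then show ?thesis unfolding fin_dim_def by (intro exI[of _ "{}"]) auto
next
  case False
  then obtain v where v: "v \<in> wt a z" "v \<noteq> 0" by blast
  have "\<exists>c. \<forall>u\<in>wt a z. \<rho> X u = c *\<^sub>C u" if "X \<in> toroidal_cartan h" for X
    using that unfolding toroidal_cartan_def
  proof (induction rule: complex_vector.span_induct_alt)
    case base
    show ?case by (rule exI[of _ 0]) (simp add: bilinD[OF bilin_rho])
  next
    case (step c X Y)
    obtain d where d: "\<rho> Y u = d *\<^sub>C u" if "u \<in> wt a z" for u using step by blast
    have "\<exists>e. \<forall>u\<in>wt a z. \<rho> X u = e *\<^sub>C u"
      using step(1)
    proof (elim UnE)
      assume "X \<in> range (\<lambda>i. central_elt 0 i 1)"
      then obtain i where i: "X = central_elt 0 i 1" by blast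
      show ?thesis
      proof (cases i)
        case None
        then show ?thesis using K0 i by (intro exI[of _ "of_nat c0"]) simp
      next
        case (Some j)
        then show ?thesis using Ki i by (intro exI[of _ 0]) simp
      qed
    next
      assume "X \<in> {loop_elt x 0 1 | x. x \<in> h}"
      then obtain x where "X = loop_elt x 0 1" "x \<in> h" by blast
      then show ?thesis by (intro exI[of _ "a x"]) (simp add: wt_def)
    next
      assume "X \<in> range degree_elt"
      then obtain i where "X = degree_elt i" by blast
      then show ?thesis by (intro exI[of _ "z i"]) (simp add: wt_def)
    qed
    then obtain e where e: "\<rho> X u = e *\<^sub>C u" if "u \<in> wt a z" for u by blast
    show ?case
      by (rule exI[of _ "c * e + d"]) (simp add: bilinD[OF bilin_rho] d e scaleC_simps)
  qed
  then obtain c where c: "\<rho> X u = c X *\<^sub>C u" if "X \<in> toroidal_cartan h" "u \<in> wt a z" for X u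
    by metis
  define \<mu> where "\<mu> X = (if X \<in> toroidal_cartan h then c X else 0)" for X
  have sub: "complex_vector.subspace (toroidal_cartan h)"
    unfolding toroidal_cartan_def by (rule complex_vector.subspace_span)
  have "\<mu> \<in> dual (toroidal_cartan h)"
    unfolding dual_def
  proof (intro CollectI conjI ballI allI impI)
    fix X Y :: "('g, 'n, 'b) toroidal"
    assume XY: "X \<in> toroidal_cartan h" "Y \<in> toroidal_cartan h"
    have XY': "X + Y \<in> toroidal_cartan h" using sub XY by (rule complex_vector.subspace_add)
    have "c (X + Y) *\<^sub>C v = (c X + c Y) *\<^sub>C v"
      using c[OF XY' v(1)] by (simp add: bilinD[OF bilin_rho] c[OF XY(1) v(1)] c[OF XY(2) v(1)] scaleC_simps)
    then show "\<mu> (X + Y) = \<mu> X + \<mu> Y"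
      using XY XY' v(2) by (simp add: \<mu>_def)
  next
    fix d and X :: "('g, 'n, 'b) toroidal"
    assume X: "X \<in> toroidal_cartan h"
    have X': "d *\<^sub>C X \<in> toroidal_cartan h" using sub X by (rule complex_vector.subspace_scale)
    have "c (d *\<^sub>C X) *\<^sub>C v = (d * c X) *\<^sub>C v"
      unfolding c[OF X' v(1), symmetric] by (simp add: bilinD[OF bilin_rho] c[OF X v(1)])
    then show "\<mu> (d *\<^sub>C X) = d * \<mu> X" using X X' v(2) by (auto simp: \<mu>_def)
  qed (simp add: \<mu>_def)
  then have "fin_dim (weight_space \<rho> (toroidal_cartan h) \<mu>)" using fin_dim_weight_space by blast
  moreover have "wt a z \<subseteq> weight_space \<rho> (toroidal_cartan h) \<mu>"
    by (auto simp: weight_space_def \<mu>_def c)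
  ultimately show ?thesis unfolding fin_dim_def by (meson subset_trans)
qed

lemma span_wt: "complex_vector.span (\<Union>a z. wt a z) = UNIV"
proof -
  have "v \<in> complex_vector.span (\<Union>a z. wt a z)" for v
  proof -
    have "\<exists>f. (\<forall>\<mu>\<in>dual (toroidal_cartan h). f \<mu> \<in> weight_space \<rho> (toroidal_cartan h) \<mu>) \<and>
      (\<forall>\<mu>. \<mu> \<notin> dual (toroidal_cartan h) \<longrightarrow> f \<mu> = 0) \<and> v = (\<Sum>\<mu> | f \<mu> \<noteq> 0. f \<mu>)"
      using integrable unfolding integrable_module_def is_direct_sum_def by blast
    then obtain f where f: "\<And>\<mu>. \<mu> \<in> dual (toroidal_cartan h) \<Longrightarrow> f \<mu> \<in> weight_space \<rho> (toroidal_cartan h) \<mu>"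
      "\<And>\<mu>. \<mu> \<notin> dual (toroidal_cartan h) \<Longrightarrow> f \<mu> = 0" "v = (\<Sum>\<mu> | f \<mu> \<noteq> 0. f \<mu>)"
      by blast
    have "f \<mu> \<in> complex_vector.span (\<Union>a z. wt a z)" if "f \<mu> \<noteq> 0" for \<mu>
    proof (rule complex_vector.span_base)
      have "f \<mu> \<in> weight_space \<rho> (toroidal_cartan h) \<mu>" using f(1,2)[of \<mu>] that by blast
      then have "f \<mu> \<in> wt (\<lambda>x. \<mu> (loop_elt x 0 1)) (\<lambda>i. \<mu> (degree_elt i))"
        by (rule subsetD[OF weight_space_subset_wt])
      then show "f \<mu> \<in> (\<Union>a z. wt a z)" by (intro UN_I[OF UNIV_I])
    qed
    then show ?thesis unfolding f(3) by (intro complex_vector.span_sum) blast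
  qed
  then show ?thesis by blast
qed

lemma wt_shift:
  assumes X: "\<And>y. y \<in> h \<Longrightarrow> toroidal_bracket br form (loop_elt y 0 1) X = q y *\<^sub>C X"
    "\<And>i. toroidal_bracket br form (degree_elt i) X = of_int (k $ i) *\<^sub>C X"
    and v: "v \<in> wt a z"
  shows "\<rho> X v \<in> wt (\<lambda>y. a y + q y) (\<lambda>i. z i + of_int (k $ i))"
  unfolding wt_def
proof (intro CollectI conjI ballI allI)
  fix y assume "y \<in> h"
  then show "\<rho> (loop_elt y 0 1) (\<rho> X v) = (a y + q y) *\<^sub>C \<rho> X v"
    using v by (intro lie_module_eigenvector_shift[OF module] X) (auto simp: wt_def)
next
  fix i
  show "\<rho> (degree_elt i) (\<rho> X v) = (z i + of_int (k $ i)) *\<^sub>C \<rho> X v"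
    using v by (intro lie_module_eigenvector_shift[OF module] X) (auto simp: wt_def)
qed

lemma loop_shift:
  assumes "x \<in> weight_space br h q" "v \<in> wt a z"
  shows "\<rho> (loop_elt x k b) v \<in> wt (\<lambda>y. a y + q y) (\<lambda>i. z i + of_int (k $ i))"
  using assms
  by (intro wt_shift) (simp_all add: bracket_finite_loop rel weight_space_def clinearD[OF clinear_loop_elt])

lemma central_shift:
  assumes "v \<in> wt a z"
  shows "\<rho> (central_elt k j b) v \<in> wt a (\<lambda>i. z i + of_int (k $ i))"
  using wt_shift[of "central_elt k j b" "\<lambda>_. 0" k, OF _ _ assms]
  by (simp add: rel toroidal_anti[of "loop_elt _ _ _" "central_elt _ _ _"])

lemma degree_shift: "v \<in> wt a z \<Longrightarrow> \<rho> (degree_elt j) v \<in> wt a z"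
  using wt_shift[of "degree_elt j" "\<lambda>_. 0" 0 v a z]
  by (simp add: rel toroidal_anti[of "loop_elt _ _ _" "degree_elt _"])

text \<open>Two weights that differ are told apart by an element of \<open>h\<close> or by a \<open>d\<^sub>i\<close>, so the elimination
  of foreign eigenvectors applies.\<close>

lemma weight_in_span:
  assumes w: "w \<in> wt a z" "w \<noteq> 0" and span: "w \<in> complex_vector.span (\<Union>(a', z')\<in>P. wt a' z')"
  shows "\<exists>(a', z')\<in>P. (\<forall>x\<in>h. a' x = a x) \<and> z' = z"
proof (rule ccontr)
  assume no: "\<not> (\<exists>(a', z')\<in>P. (\<forall>x\<in>h. a' x = a x) \<and> z' = z)"
  obtain J r where J: "finite J" "J \<subseteq> (\<Union>(a', z')\<in>P. wt a' z')" "w = (\<Sum>u\<in>J. r u *\<^sub>C u)"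
    using span unfolding complex_vector.span_explicit by blast
  let ?S = "{loop_elt x 0 1 | x. x \<in> h} \<union> range degree_elt :: ('g, 'n, 'b) toroidal set"
  have eig: "\<exists>(a', z')\<in>P. r u *\<^sub>C u \<in> wt a' z'" if "u \<in> J" for u
  proof -
    obtain a' z' where *: "(a', z') \<in> P" "u \<in> wt a' z'" using J(2) \<open>u \<in> J\<close> by blast
    have "r u *\<^sub>C u \<in> wt a' z'"
      using *(2) by (auto simp: wt_def clinearD[OF clinear_rho] mult.commute)
    with * show ?thesis by blast
  qed
  have "w = 0"
  proof (rule sum_of_foreign_eigenvectors_zero[OF J(1), where \<rho> = \<rho> and S = ?S and u = "\<lambda>u. r u *\<^sub>C u"])
    show "clinear (\<rho> X)" for X by (rule clinear_rho)
    show "w = (\<Sum>u\<in>J. r u *\<^sub>C u)" by (rule J)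
  next
    fix X u assume "X \<in> ?S" "u \<in> J"
    then show "\<exists>c. \<rho> X (r u *\<^sub>C u) = c *\<^sub>C r u *\<^sub>C u"
      using eig[of u] unfolding wt_def by blast
  next
    fix u assume u: "u \<in> J"
    obtain a' z' where P: "(a', z') \<in> P" "r u *\<^sub>C u \<in> wt a' z'" using eig[OF u] by blast
    consider x where "x \<in> h" "a' x \<noteq> a x" | i where "z' i \<noteq> z i" using no P(1) by blast
    then show "\<exists>X\<in>?S. \<exists>c p. \<rho> X (r u *\<^sub>C u) = c *\<^sub>C r u *\<^sub>C u \<and> \<rho> X w = p *\<^sub>C w \<and> c \<noteq> p"
    proof cases
      case (1 x)
      have "\<rho> (loop_elt x 0 1) (r u *\<^sub>C u) = a' x *\<^sub>C r u *\<^sub>C u" "\<rho> (loop_elt x 0 1) w = a x *\<^sub>C w"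
        using P(2) w(1) 1(1) unfolding wt_def by blast+
      moreover have "loop_elt x 0 1 \<in> ?S" using 1 by blast
      ultimately show ?thesis using 1(2) by blast
    next
      case (2 i)
      have "\<rho> (degree_elt i) (r u *\<^sub>C u) = z' i *\<^sub>C r u *\<^sub>C u" "\<rho> (degree_elt i) w = z i *\<^sub>C w"
        using P(2) w(1) unfolding wt_def by blast+
      moreover have "degree_elt i \<in> ?S" by blast
      ultimately show ?thesis using 2 by blast
    qed
  qed
  with w(2) show False by blast
qed


section \<open>The root space decomposition\<close>

text \<open>The elements of \<open>g\<close> that act by zero form an ideal. If it were all of \<open>g\<close>, then
  \<open>[g, g \<otimes> t\<^sub>0] = g \<otimes> t\<^sub>0\<close> would act by zero as well, and so would \<open>K\<^sub>0\<close>, which is obtained by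
  bracketing \<open>g \<otimes> t\<^sub>0\<close> with \<open>g \<otimes> t\<^sub>0\<^sup>-\<^sup>1\<close>.\<close>

lemma faithful:
  assumes y: "\<And>v. \<rho> (loop_elt y 0 1) v = 0"
  shows "y = 0"
proof -
  let ?I = "{x. \<forall>v. \<rho> (loop_elt x 0 1) v = 0}"
  note zero = clinearD(3)[OF clinear_rho]
  have "lie_ideal br ?I"
    unfolding lie_ideal_def complex_vector.subspace_def
  proof (intro conjI allI ballI impI)
    fix x y assume y: "y \<in> ?I"
    have "\<rho> (loop_elt (br x y) 0 1) v = 0" for v
      unfolding bracket_finite_loop[symmetric] rho_bracket using y by (simp add: zero)
    then show "br x y \<in> ?I" by simp
  qed (simp_all add: clinearD[OF clinear_loop_elt] bilinD[OF bilin_rho])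
  moreover have "?I \<noteq> UNIV"
  proof
    assume "?I = UNIV"
    then have all: "\<rho> (loop_elt x 0 1) v = 0" for x v by blast
    obtain x x' where "br x x' \<noteq> 0" using simple by (auto simp: simple_lie_algebra_def)
    then obtain x'' where f: "form (br x x') x'' \<noteq> 0"
      using nondeg by (auto simp: nondegenerate_form_def)
    let ?k = "axis None 1 :: 'n mdeg"
    have 1: "\<rho> (loop_elt (br x x') ?k 1) v = 0" for v
      using rho_bracket[of "loop_elt x ?k 1" "loop_elt x' 0 1" v]
      by (simp add: bracket_loop_finite all zero)
    have "toroidal_bracket br form (loop_elt (br x x') ?k 1) (loop_elt x'' (- ?k) 1)
      = loop_elt (br (br x x') x'') 0 1 + form (br x x') x'' *\<^sub>C (central_elt 0 None 1 :: ('g, 'n, 'b) toroidal)"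
    proof -
      have "(\<Sum>i\<in>UNIV. of_int (?k $ i) *\<^sub>C (central_elt 0 i 1 :: ('g, 'n, 'b) toroidal)) =
         (\<Sum>i\<in>UNIV. if i = None then central_elt 0 i 1 else 0)"
        by (rule sum.cong) (auto simp: axis_def)
      then show ?thesis by (simp add: rel)
    qed
    then have "form (br x x') x'' *\<^sub>C of_nat c0 *\<^sub>C v = 0" for v :: 'v
      using rho_bracket[of "loop_elt (br x x') ?k 1" "loop_elt x'' (- ?k) 1" v]
      by (simp add: 1 all zero bilinD[OF bilin_rho] K0)
    then have "v = 0" for v :: 'v using f level_pos by simp
    then show False using irreducible by (auto simp: irreducible_module_def)
  qed
  ultimately have "?I = {0}" using simple by (auto simp: simple_lie_algebra_def)
  then show ?thesis using y by blast
qed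

lemma span_joint_eigenvectors: "complex_vector.span (\<Union>q. weight_space br h q) = UNIV"
proof (rule diagonalizable_adjoint[where \<sigma> = "\<lambda>x. \<rho> (loop_elt x 0 1)", OF fin_dim_g bilin_br])
  have "bilin (\<lambda>x. \<rho> (loop_elt x 0 1))"
    by (rule bilinI) (simp_all add: clinearD[OF clinear_loop_elt] bilinD[OF bilin_rho])
  then show "lie_module br (\<lambda>x. \<rho> (loop_elt x 0 1))"
    unfolding lie_module_def bracket_finite_loop[symmetric] rho_bracket by simp
  have "(\<Union>a z. wt a z) \<subseteq> (\<Union>a. weight_space (\<lambda>x. \<rho> (loop_elt x 0 1)) h a)"
    by (intro subsetI, elim UN_E, rule UN_I[OF UNIV_I]) (auto simp: wt_def weight_space_def)
  from complex_vector.span_mono[OF this]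
  show "complex_vector.span (\<Union>a. weight_space (\<lambda>x. \<rho> (loop_elt x 0 1)) h a) = UNIV"
    unfolding span_wt by (rule top.extremum_uniqueI)
  show "y = 0" if "\<forall>v. \<rho> (loop_elt y 0 1) v = 0" for y
    by (rule faithful) (rule that[rule_format])
qed

lemma br_h_h:
  assumes "x \<in> h" "y \<in> h"
  shows "br x y = 0"
proof (rule faithful)
  fix v
  have "v \<in> complex_vector.span (\<Union>a z. wt a z)" unfolding span_wt by (rule UNIV_I)
  then show "\<rho> (loop_elt (br x y) 0 1) v = 0"
  proof (induction rule: complex_vector.span_induct_alt)
    case (step c u w)
    then obtain a z where u: "u \<in> wt a z" by blast
    have "\<rho> (loop_elt (br x y) 0 1) u = 0"
      unfolding bracket_finite_loop[symmetric] rho_bracket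
      using u assms by (simp add: wt_def clinearD[OF clinear_rho] mult.commute)
    then show ?case by (simp add: step clinearD[OF clinear_rho])
  qed (simp add: clinearD[OF clinear_rho])
qed

lemma centralizer_h:
  assumes "\<And>y. y \<in> h \<Longrightarrow> br y x = 0"
  shows "x \<in> h"
proof -
  have "0 \<in> h" using subspace_h by (rule complex_vector.subspace_0)
  moreover have "br x y = 0" if "y \<in> h" for y
    using assms[OF that] lie_algebra.br_anti[OF lie, of y x] by simp
  ultimately have "x \<in> {x. \<forall>y\<in>h. br x y \<in> h}" by auto
  then show ?thesis using cartan unfolding cartan_subalgebra_def by blast
qed

lemma root_space_eq: "root_space br h \<alpha> = weight_space br h \<alpha>"
  by (simp add: root_space_def weight_space_def)

lemma joint_eigenvector_cases:
  assumes x: "x \<in> weight_space br h q"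
  obtains "x \<in> h" | \<alpha> where "\<alpha> \<in> roots br h" "x \<in> root_space br h \<alpha>" "\<And>y. y \<in> h \<Longrightarrow> \<alpha> y = q y"
proof (cases "x = 0 \<or> (\<forall>y\<in>h. q y = 0)")
  case True
  then have "x \<in> h" using x by (intro centralizer_h) (auto simp: weight_space_def bilinD[OF bilin_br])
  then show ?thesis by (rule that)
next
  case False
  define \<alpha> where "\<alpha> y = (if y \<in> h then q y else 0)" for y
  have x\<alpha>: "x \<in> root_space br h \<alpha>" using x by (simp add: root_space_eq weight_space_def \<alpha>_def)
  have eig: "br y x = q y *\<^sub>C x" if "y \<in> h" for y using x that by (simp add: weight_space_def)
  have "\<alpha> \<in> dual h"
    unfolding dual_def
  proof (intro CollectI conjI ballI allI impI)
    fix y y' assume y: "y \<in> h" "y' \<in> h"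
    have y': "y + y' \<in> h" using subspace_h y by (rule complex_vector.subspace_add)
    have "q (y + y') *\<^sub>C x = (q y + q y') *\<^sub>C x"
      using eig[OF y'] by (simp add: bilinD[OF bilin_br] eig y scaleC_simps)
    then show "\<alpha> (y + y') = \<alpha> y + \<alpha> y'" using False y y' by (simp add: \<alpha>_def)
  next
    fix c y assume y: "y \<in> h"
    have y': "c *\<^sub>C y \<in> h" using subspace_h y by (rule complex_vector.subspace_scale)
    have "q (c *\<^sub>C y) *\<^sub>C x = (c * q y) *\<^sub>C x"
      unfolding eig[OF y', symmetric] by (simp add: bilinD[OF bilin_br] eig y)
    then show "\<alpha> (c *\<^sub>C y) = c * \<alpha> y" using False y y' by (simp add: \<alpha>_def)
  qed (simp add: \<alpha>_def)
  moreover have "\<alpha> \<noteq> (\<lambda>_. 0)" using False by (auto simp: \<alpha>_def fun_eq_iff)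
  moreover have "root_space br h \<alpha> \<noteq> {0}" using x\<alpha> False by auto
  ultimately have "\<alpha> \<in> roots br h" by (simp add: roots_def)
  then show ?thesis using x\<alpha> by (rule that(2)) (simp add: \<alpha>_def)
qed

text \<open>A root vector \<open>x\<close> of the highest root pairs non-trivially with some joint eigenvector \<open>y\<close> of
  \<open>h\<close>, which by invariance has weight \<open>-\<theta>\<close>. Then \<open>[x, y]\<close> represents \<open>\<theta>\<close>, and the normalization
  of the form says \<open>\<theta> [x, y] = 2\<close>.\<close>

lemma highest_root_triple:
  obtains \<theta> x y t where "\<theta> \<in> roots br h" "x \<in> root_space br h \<theta>"
    "(\<lambda>u. - \<theta> u) \<in> roots br h" "y \<in> root_space br h (\<lambda>u. - \<theta> u)"
    "t \<in> h" "br x y = t" "form x y = 1" "br t x = 2 *\<^sub>C x" "br t y = - (2 *\<^sub>C y)"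
proof -
  obtain \<theta> where \<theta>: "\<theta> \<in> roots br h"
    and norm: "form (dual_vector form h \<theta>) (dual_vector form h \<theta>) = 2"
    using normalized by (auto simp: normalized_form_def highest_root_def)
  note f = bilinD[OF bilin_form]
  have "complex_vector.subspace (root_space br h \<theta>)"
    unfolding root_space_eq by (rule subspace_weight_space) (use bilin_br in \<open>simp add: bilin_def\<close>)
  moreover have "root_space br h \<theta> \<noteq> {0}" using \<theta> by (simp add: roots_def)
  ultimately obtain x where x: "x \<in> root_space br h \<theta>" "x \<noteq> 0"
    using complex_vector.subspace_0 by blast
  have move: "form (br u w) w' = - form w (br u w')" for u w w'
    using form_inv[of w u w'] lie_algebra.br_anti[OF lie, of w u] by (simp add: f) (metis minus_minus)
  have "\<exists>q. \<exists>y\<in>weight_space br h q. form x y \<noteq> 0"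
  proof (rule ccontr)
    assume no: "\<not> (\<exists>q. \<exists>y\<in>weight_space br h q. form x y \<noteq> 0)"
    have "form x y = 0" for y
    proof -
      have "y \<in> complex_vector.span (\<Union>q. weight_space br h q)" by (simp add: span_joint_eigenvectors)
      then show ?thesis
        by (induction rule: complex_vector.span_induct_alt) (use no in \<open>auto simp: f\<close>)
    qed
    then show False using x(2) nondeg by (auto simp: nondegenerate_form_def)
  qed
  then obtain q y' where y': "y' \<in> weight_space br h q" "form x y' \<noteq> 0" by blast
  have q: "q u = - \<theta> u" if u: "u \<in> h" for u
  proof -
    have "\<theta> u * form x y' = - (q u * form x y')"
      using move[of u x y'] x(1) y'(1) u by (simp add: root_space_eq weight_space_def f)
    then have "(\<theta> u + q u) * form x y' = 0" by (simp add: algebra_simps)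
    then show ?thesis using y'(2) by (simp add: eq_neg_iff_add_eq_0 add.commute)
  qed
  define y where "y = (1 / form x y') *\<^sub>C y'"
  have xy: "form x y = 1" using y'(2) by (simp add: y_def f)
  have y: "y \<in> root_space br h (\<lambda>u. - \<theta> u)"
    using y'(1) by (simp add: y_def root_space_def weight_space_def bilinD[OF bilin_br] q)
  have y0: "y \<noteq> 0" using xy by (auto simp: f)
  have neg: "(\<lambda>u. - \<theta> u) \<in> roots br h"
  proof -
    have "root_space br h (\<lambda>u. - \<theta> u) \<noteq> {0}" using y y0 by blast
    then show ?thesis using \<theta> by (auto simp: roots_def dual_def fun_eq_iff)
  qed
  have eig: "br u x = \<theta> u *\<^sub>C x" "br u y = - (\<theta> u *\<^sub>C y)" if "u \<in> h" for u
    using x(1) y that by (auto simp: root_space_def)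
  define t where "t = br x y"
  have t: "t \<in> h"
  proof (rule centralizer_h)
    fix u assume u: "u \<in> h"
    have "br u (br x y) = - br x (br y u) - br y (br u x)"
      using lie_algebra.jacobi[OF lie, of u x y] by (simp add: eq_neg_iff_add_eq_0 algebra_simps)
    also have "br y u = \<theta> u *\<^sub>C y" using lie_algebra.br_anti[OF lie, of y u] eig(2)[OF u] by simp
    also have "br y (br u x) = - (\<theta> u *\<^sub>C br x y)"
      using lie_algebra.br_anti[OF lie, of y x] by (simp add: eig u bilinD[OF bilin_br])
    finally show "br u t = 0" by (simp add: t_def bilinD[OF bilin_br])
  qed
  have tu: "form t u = \<theta> u" if "u \<in> h" for u
    using form_inv[of x y u] lie_algebra.br_anti[OF lie, of y u] eig(2)[OF that] xy
    by (simp add: t_def f)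
  have "dual_vector form h \<theta> = t"
    unfolding dual_vector_def
  proof (rule the_equality)
    fix t' assume t': "t' \<in> h \<and> (\<forall>u\<in>h. form t' u = \<theta> u)"
    have "t' - t \<in> h" using t' t subspace_h by (simp add: complex_vector.subspace_diff)
    have "form (t' - t) w = 0" for w
    proof -
      have "w \<in> complex_vector.span (\<Union>q. weight_space br h q)" by (simp add: span_joint_eigenvectors)
      then show ?thesis
      proof (induction rule: complex_vector.span_induct_alt)
        case (step c w w')
        then obtain q where w: "w \<in> weight_space br h q" by blast
        have "form (t' - t) w = 0"
        proof (cases "\<forall>u\<in>h. q u = 0")
          case True
          then have "w \<in> h" using w by (intro centralizer_h) (auto simp: weight_space_def)
          then show ?thesis using t' tu by (simp add: f)
        next
          case False
          then obtain u where u: "u \<in> h" "q u \<noteq> 0" by blast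
          have "q u * form (t' - t) w = form (t' - t) (br u w)"
            using w u by (simp add: weight_space_def f)
          also have "\<dots> = form (br (t' - t) u) w" by (simp add: form_inv)
          also have "\<dots> = 0" using br_h_h[OF \<open>t' - t \<in> h\<close> u(1)] by (simp add: f)
          finally show ?thesis using u(2) by simp
        qed
        then show ?case using step by (simp add: f)
      qed (simp add: f)
    qed
    then have "t' - t = 0" using nondeg unfolding nondegenerate_form_def by blast
    then show "t' = t" by simp
  qed (use t tu in auto)
  then have "\<theta> t = 2" using norm tu[OF t] by simp
  then show thesis
    using that[OF \<theta> x(1) neg y t t_def[symmetric] xy] eig[OF t] by simp
qed


section \<open>Bounded multiplicities along \<open>\<int>\<^sup>n\<close>\<close>

lemma subspace_wt: "complex_vector.subspace (wt a z)"
  by (auto simp: wt_def complex_vector.subspace_def clinearD[OF clinear_rho] scaleC_simps mult.commute)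

lemma central_sum_action:
  "\<rho> (\<Sum>i\<in>UNIV. of_int (k $ i) *\<^sub>C central_elt 0 i 1) v = (of_int (k $ None) * of_nat c0) *\<^sub>C v"
proof -
  have "\<rho> (\<Sum>i\<in>UNIV. of_int (k $ i) *\<^sub>C central_elt 0 i 1) v
      = (\<Sum>i\<in>UNIV. \<rho> (of_int (k $ i) *\<^sub>C central_elt 0 i 1) v)"
    using bilin_rho by (intro clinear_sum[of "\<lambda>X. \<rho> X v"]) (simp add: bilin_def)
  also have "\<dots> = (\<Sum>i\<in>(UNIV :: 'n option set). if i = None then (of_int (k $ None) * of_nat c0) *\<^sub>C v else 0)"
  proof (rule sum.cong)
    fix i
    show "\<rho> (of_int (k $ i) *\<^sub>C central_elt 0 i 1) v
      = (if i = None then (of_int (k $ None) * of_nat c0) *\<^sub>C v else 0)"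
      by (cases i) (simp_all add: bilinD[OF bilin_rho] K0 Ki)
  qed simp
  finally show ?thesis by simp
qed

text \<open>Since the \<open>K\<^sub>i\<close> with \<open>i \<ge> 1\<close> act by zero, the coroot of \<open>\<theta> + m\<^sub>0 \<delta>\<^sub>0 + \<delta>\<^sub>m\<close> takes the same
  value \<open>M\<close> on all weights \<open>\<lambda> + \<delta>\<^sub>k\<close>, whatever \<open>m\<close> is; so \<open>m\<close> can be chosen, depending on \<open>k\<close>, such that the root
  vector sends \<open>\<lambda> + \<delta>\<^sub>k\<close> to one fixed weight. Because \<open>c\<^sub>0 \<noteq> 0\<close>, one of \<open>m\<^sub>0 = 0\<close> and \<open>m\<^sub>0 = 1\<close>
  makes \<open>M\<close> nonzero, and then the root vector of one of the two opposite roots is injective.\<close>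

lemma multiplicity_bounded:
  "\<exists>N. \<forall>k :: 'n mdeg. k $ None = 0 \<longrightarrow> complex_vector.dim (wt a (\<lambda>i. z i + of_int (k $ i))) \<le> N"
proof -
  obtain \<theta> x y t where triple: "\<theta> \<in> roots br h" "x \<in> root_space br h \<theta>"
    "(\<lambda>u. - \<theta> u) \<in> roots br h" "y \<in> root_space br h (\<lambda>u. - \<theta> u)"
    "t \<in> h" "br x y = t" "form x y = 1" "br t x = 2 *\<^sub>C x" "br t y = - (2 *\<^sub>C y)"
    by (rule highest_root_triple)
  define H where "H m v = \<rho> (loop_elt t 0 1) v + (of_int (m $ None) * of_nat c0) *\<^sub>C v" for m :: "'n mdeg" and v
  have EF: "\<rho> (loop_elt x m 1) (\<rho> (loop_elt y (- m) 1) v) - \<rho> (loop_elt y (- m) 1) (\<rho> (loop_elt x m 1) v) = H m v"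
    for m v
  proof -
    have "toroidal_bracket br form (loop_elt x m 1) (loop_elt y (- m) 1)
      = loop_elt t 0 1 + (\<Sum>i\<in>UNIV. of_int (m $ i) *\<^sub>C (central_elt 0 i 1 :: ('g, 'n, 'b) toroidal))"
      by (simp add: rel triple)
    then show ?thesis
      unfolding H_def central_sum_action[symmetric]
      by (simp add: bilinD[OF bilin_rho] flip: rho_bracket)
  qed
  have HE: "H m (\<rho> (loop_elt x k 1) v) - \<rho> (loop_elt x k 1) (H m v) = 2 *\<^sub>C \<rho> (loop_elt x k 1) v"
    and HF: "H m (\<rho> (loop_elt y k 1) v) - \<rho> (loop_elt y k 1) (H m v) = - (2 *\<^sub>C \<rho> (loop_elt y k 1) v)" for k m v
    using rho_bracket[of "loop_elt t 0 1" "loop_elt x k 1" v] rho_bracket[of "loop_elt t 0 1" "loop_elt y k 1" v]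
    by (simp_all add: H_def bracket_finite_loop triple clinearD[OF clinear_loop_elt]
        bilinD[OF bilin_rho])
  have lin_H: "clinear (H m)" for m
    by (rule clinearI) (simp_all add: H_def clinearD[OF clinear_rho] scaleC_simps mult.commute)
  have nil: "\<exists>k. (\<rho> (loop_elt x m 1) ^^ k) u = 0" "\<exists>k. (\<rho> (loop_elt y m 1) ^^ k) u = 0" for m u
    using integrable triple(1-4) unfolding integrable_module_def by blast+
  have H_wt: "H m u = (a t + of_int (m $ None) * of_nat c0) *\<^sub>C u" if "u \<in> wt a z'" for m u z'
    using that triple(5) by (simp add: H_def wt_def scaleC_simps)
  \<comment> \<open>one of the two values for \<open>m0 = 0\<close> and \<open>m0 = 1\<close> is nonzero, as they differ by \<open>c0 > 0\<close>\<close>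
  obtain m0 :: int where m0: "a t + of_int m0 * of_nat c0 \<noteq> 0"
  proof (cases "a t = 0")
    case True
    then show ?thesis using that[of 1] level_pos by simp
  next
    case False
    then show ?thesis using that[of 0] by simp
  qed
  let ?M = "a t + of_int m0 * of_nat c0" and ?e = "axis None m0 :: 'n mdeg"
  \<comment> \<open>In both cases the exponent \<open>?m\<close> is the one for which the \<open>k\<close> in the weight cancels.\<close>
  show ?thesis
  proof (cases "\<forall>j::nat. ?M + of_nat j \<noteq> 0")
    case True
    let ?W = "wt (\<lambda>u. a u + - \<theta> u) (\<lambda>i. z i + of_int ((- ?e) $ i))"
    have "complex_vector.dim (wt a (\<lambda>i. z i + of_int (k $ i))) \<le> complex_vector.dim ?W"
      if k: "k $ None = 0" for k :: "'n mdeg"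
    proof (rule dim_le_of_injective_map[OF clinear_rho subspace_wt])
      let ?m = "?e + k"
      fix u assume u: "u \<in> wt a (\<lambda>i. z i + of_int (k $ i))"
      have "\<rho> (loop_elt y (- ?m) 1) u
          \<in> wt (\<lambda>u. a u + - \<theta> u) (\<lambda>i. z i + of_int (k $ i) + of_int ((- ?m) $ i))"
        using triple(4) u unfolding root_space_eq by (rule loop_shift)
      then show "\<rho> (loop_elt y (- ?m) 1) u \<in> ?W" by simp
      have m: "?m $ None = m0" using k by (simp add: axis_def)
      obtain l where l: "(\<rho> (loop_elt x ?m 1) ^^ l) u = 0" using nil by blast
      assume "\<rho> (loop_elt y (- ?m) 1) u = 0"
      then show "u = 0"
        by (rule sl2_lowering_kernel_zero[OF clinear_rho clinear_rho lin_H EF HE _ H_wt[OF u] l])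
          (use True m in simp)
    qed (rule fin_dim_wt)
    then show ?thesis by blast
  next
    case False
    then obtain j :: nat where j: "?M = - of_nat j" by (auto simp: eq_neg_iff_add_eq_0)
    then have "j \<noteq> 0" using m0 by auto
    have M': "- ?M + of_nat i \<noteq> 0" for i :: nat
      unfolding j minus_minus of_nat_add[symmetric] of_nat_eq_0_iff using \<open>j \<noteq> 0\<close> by simp
    let ?W = "wt (\<lambda>u. a u + \<theta> u) (\<lambda>i. z i + of_int (?e $ i))"
    have "complex_vector.dim (wt a (\<lambda>i. z i + of_int (k $ i))) \<le> complex_vector.dim ?W"
      if k: "k $ None = 0" for k :: "'n mdeg"
    proof (rule dim_le_of_injective_map[OF clinear_rho subspace_wt])
      let ?m = "?e - k"
      fix u assume u: "u \<in> wt a (\<lambda>i. z i + of_int (k $ i))"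
      have "\<rho> (loop_elt x ?m 1) u
          \<in> wt (\<lambda>u. a u + \<theta> u) (\<lambda>i. z i + of_int (k $ i) + of_int (?m $ i))"
        using triple(2) u unfolding root_space_eq by (rule loop_shift)
      then show "\<rho> (loop_elt x ?m 1) u \<in> ?W" by simp
      have m: "?m $ None = m0" using k by (simp add: axis_def)
      obtain l where l: "(\<rho> (loop_elt y (- ?m) 1) ^^ l) u = 0" using nil by blast
      assume E: "\<rho> (loop_elt x ?m 1) u = 0"
      show "u = 0"
      proof (rule sl2_lowering_kernel_zero[OF clinear_rho clinear_rho _ _ _ E _ l,
            where H = "\<lambda>v. - H ?m v" and M = "- (a t + of_int (?m $ None) * of_nat c0)"])
        show "clinear (\<lambda>v. - H ?m v)"
          by (rule clinearI) (simp_all add: clinearD[OF lin_H])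
        show "\<rho> (loop_elt y (- ?m) 1) (\<rho> (loop_elt x ?m 1) v)
          - \<rho> (loop_elt x ?m 1) (\<rho> (loop_elt y (- ?m) 1) v) = - H ?m v" for v
          unfolding EF[symmetric] by simp
        show "- H ?m (\<rho> (loop_elt y (- ?m) 1) v) - \<rho> (loop_elt y (- ?m) 1) (- H ?m v)
          = 2 *\<^sub>C \<rho> (loop_elt y (- ?m) 1) v" for v
          using arg_cong[OF HF[of ?m "- ?m" v], of uminus] by (simp add: clinearD[OF clinear_rho])
        show "- H ?m u = - (a t + of_int (?m $ None) * of_nat c0) *\<^sub>C u"
          unfolding H_wt[OF u] by (rule complex_vector.scale_minus_left[symmetric])
      qed (use M' m in simp)
    qed (rule fin_dim_wt)
    then show ?thesis by blast
  qed
qed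


section \<open>The weights of the vacuum space\<close>

text \<open>A superset of the weights that can be reached from \<open>(a, z)\<close> by \<open>\<tau>(B)\<^sup>-\<close> and \<open>\<tau>(B)\<^sup>0\<close>: when the
  degree in \<open>t\<^sub>0\<close> drops, the values on \<open>h\<close> are left free, since the order is lexicographic with
  the \<open>d\<^sub>0\<close>-degree first.\<close>

definition lower_weights ::
    "('g \<Rightarrow> complex) \<Rightarrow> ('n option \<Rightarrow> complex) \<Rightarrow> (('g \<Rightarrow> complex) \<times> ('n option \<Rightarrow> complex)) set"
  where "lower_weights a z = {(a', z'). \<exists>(k :: 'n mdeg) (c :: _ \<Rightarrow> nat).
    (\<forall>i. z' i = z i + of_int (k $ i)) \<and>
    (k $ None < 0 \<or> k $ None = 0 \<and> (\<forall>x\<in>h. a' x = a x - (\<Sum>\<beta>\<in>base. of_nat (c \<beta>) * \<beta> x)))}"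

lemma lower_weights_refl: "(a, z) \<in> lower_weights a z"
  unfolding lower_weights_def
  by (intro CollectI case_prodI exI[of _ 0] exI[of _ "\<lambda>_. 0"]) simp

lemma lower_weights_trans:
  assumes "(a', z') \<in> lower_weights a z" "(a'', z'') \<in> lower_weights a' z'"
  shows "(a'', z'') \<in> lower_weights a z"
proof -
  obtain k c where 1: "\<And>i. z' i = z i + of_int (k $ i)"
    "k $ None < 0 \<or> k $ None = 0 \<and> (\<forall>x\<in>h. a' x = a x - (\<Sum>\<beta>\<in>base. of_nat (c \<beta>) * \<beta> x))"
    using assms(1) by (auto simp: lower_weights_def)
  obtain k' c' where 2: "\<And>i. z'' i = z' i + of_int (k' $ i)"
    "k' $ None < 0 \<or> k' $ None = 0 \<and> (\<forall>x\<in>h. a'' x = a' x - (\<Sum>\<beta>\<in>base. of_nat (c' \<beta>) * \<beta> x))"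
    using assms(2) by (auto simp: lower_weights_def)
  show ?thesis
    unfolding lower_weights_def
    by (intro CollectI case_prodI exI[of _ "k + k'"] exI[of _ "\<lambda>\<beta>. c \<beta> + c' \<beta>"])
      (use 1 2 in \<open>auto simp: distrib_right sum.distrib\<close>)
qed

text \<open>The two shifts add up to zero. So neither lowers the degree in \<open>t\<^sub>0\<close>, and by linear
  independence of the base neither subtracts a simple root.\<close>

lemma lower_weights_antisym:
  assumes "(a', z') \<in> lower_weights a z" "(a, z) \<in> lower_weights a' z'"
  shows "\<exists>k :: 'n mdeg. k $ None = 0 \<and> (\<forall>i. z' i = z i + of_int (k $ i)) \<and> (\<forall>x\<in>h. a' x = a x)"
proof -
  obtain k c where 1: "\<And>i. z' i = z i + of_int (k $ i)"
    "k $ None < 0 \<or> k $ None = 0 \<and> (\<forall>x\<in>h. a' x = a x - (\<Sum>\<beta>\<in>base. of_nat (c \<beta>) * \<beta> x))"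
    using assms(1) by (auto simp: lower_weights_def)
  obtain k' c' where 2: "\<And>i. z i = z' i + of_int (k' $ i)"
    "k' $ None < 0 \<or> k' $ None = 0 \<and> (\<forall>x\<in>h. a x = a' x - (\<Sum>\<beta>\<in>base. of_nat (c' \<beta>) * \<beta> x))"
    using assms(2) by (auto simp: lower_weights_def)
  have "of_int (k $ None + k' $ None) = (0 :: complex)"
    using 1(1)[of None] 2(1)[of None] by (simp add: add.commute)
  then have "k $ None + k' $ None = 0" by (simp only: of_int_eq_0_iff)
  then have 0: "k $ None = 0" "k' $ None = 0" using 1(2) 2(2) by auto
  have a: "a' x = a x - (\<Sum>\<beta>\<in>base. of_nat (c \<beta>) * \<beta> x)" "a x = a' x - (\<Sum>\<beta>\<in>base. of_nat (c' \<beta>) * \<beta> x)"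
    if "x \<in> h" for x
    using 0 1(2) 2(2) that by auto
  have "(\<Sum>\<beta>\<in>base. of_nat (c \<beta> + c' \<beta>) * \<beta> x) = 0" for x
  proof (cases "x \<in> h")
    case True
    have "(\<Sum>\<beta>\<in>base. of_nat (c \<beta> + c' \<beta>) * \<beta> x) = (a x - a' x) + (a' x - a x)"
      using a[OF True] by (simp only: of_nat_add distrib_right sum.distrib) (simp add: algebra_simps)
    then show ?thesis by simp
  next
    case False
    have "\<beta> x = 0" if "\<beta> \<in> base" for \<beta>
      using that base False by (auto simp: root_base_def roots_def dual_def)
    then show ?thesis by (intro sum.neutral) simp
  qed
  moreover have "\<forall>d. (\<forall>x. (\<Sum>\<beta>\<in>base. d \<beta> * \<beta> x) = 0) \<longrightarrow> (\<forall>\<beta>\<in>base. d \<beta> = 0)"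
    using base unfolding root_base_def by blast
  ultimately have "\<forall>\<beta>\<in>base. of_nat (c \<beta> + c' \<beta>) = (0 :: complex)"
    by (auto dest!: spec[of _ "\<lambda>\<beta>. of_nat (c \<beta> + c' \<beta>)"])
  then have "c \<beta> = 0" if "\<beta> \<in> base" for \<beta>
    using that by (metis add_is_0 of_nat_eq_0_iff)
  then have "a' x = a x" if "x \<in> h" for x using a(1)[OF that] by simp
  then show ?thesis using 0(1) 1(1) by blast
qed

text \<open>Weight vectors that span \<open>\<tau>(B)\<^sup>- + \<tau>(B)\<^sup>0\<close>.\<close>

definition lowering_generators :: "('g, 'n, 'b) toroidal set"
  where "lowering_generators =
    {loop_elt x k b | x k b. k $ None < 0 \<and> x \<in> (\<Union>q. weight_space br h q)} \<union>
    {loop_elt x k b | x k b. k $ None = 0 \<and>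
      (x \<in> h \<or> (\<exists>\<alpha>\<in>roots br h. nat_combination base (\<lambda>y. - \<alpha> y) \<and> x \<in> root_space br h \<alpha>))} \<union>
    {central_elt k i b | k i b. k $ None \<le> 0} \<union> range degree_elt"

lemma lowering_generator_shift:
  assumes X: "X \<in> lowering_generators" and v: "v \<in> wt a z"
  shows "\<exists>(a', z') \<in> lower_weights a z. \<rho> X v \<in> wt a' z'"
  using X unfolding lowering_generators_def
proof (elim UnE)
  assume "X \<in> {loop_elt x k b | x k b. k $ None < 0 \<and> x \<in> (\<Union>q. weight_space br h q)}"
  then obtain x k b q where *: "X = loop_elt x k b" "k $ None < 0" "x \<in> weight_space br h q" by blast
  have "(\<lambda>y. a y + q y, \<lambda>i. z i + of_int (k $ i)) \<in> lower_weights a z"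
    unfolding lower_weights_def
    by (intro CollectI case_prodI exI[of _ k] exI[of _ "\<lambda>_. 0"]) (use * in simp)
  then show ?thesis unfolding *(1) using loop_shift[OF *(3) v] by blast
next
  assume "X \<in> {loop_elt x k b | x k b. k $ None = 0 \<and>
      (x \<in> h \<or> (\<exists>\<alpha>\<in>roots br h. nat_combination base (\<lambda>y. - \<alpha> y) \<and> x \<in> root_space br h \<alpha>))}"
  then obtain x k b where *: "X = loop_elt x k b" "k $ None = 0"
    "x \<in> h \<or> (\<exists>\<alpha>\<in>roots br h. nat_combination base (\<lambda>y. - \<alpha> y) \<and> x \<in> root_space br h \<alpha>)" by blast
  have "\<exists>q. x \<in> weight_space br h q \<and> nat_combination base (\<lambda>y. - q y)"
    using *(3)
  proof
    assume "x \<in> h"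
    moreover have "nat_combination base (\<lambda>y. - 0)"
      unfolding nat_combination_def by (rule exI[of _ "\<lambda>_. 0"]) simp
    ultimately show ?thesis
      by (intro exI[of _ "\<lambda>_. 0"]) (simp add: weight_space_def br_h_h)
  qed (auto simp: root_space_eq)
  then obtain q c where q: "x \<in> weight_space br h q"
    "\<And>y. - q y = (\<Sum>\<beta>\<in>base. of_nat (c \<beta>) * \<beta> y)" unfolding nat_combination_def by blast
  have "(\<lambda>y. a y + q y, \<lambda>i. z i + of_int (k $ i)) \<in> lower_weights a z"
    unfolding lower_weights_def
    by (intro CollectI case_prodI exI[of _ k] exI[of _ c]) (simp add: *(2) flip: q(2))
  then show ?thesis unfolding *(1) using loop_shift[OF q(1) v] by blast
next
  assume "X \<in> {central_elt k i b | k i b. k $ None \<le> 0}"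
  then obtain k i b where *: "X = central_elt k i b" "k $ None \<le> 0" by blast
  have "(a, \<lambda>i. z i + of_int (k $ i)) \<in> lower_weights a z"
    unfolding lower_weights_def
    by (intro CollectI case_prodI exI[of _ k] exI[of _ "\<lambda>_. 0"]) (use *(2) in auto)
  then show ?thesis unfolding *(1) using central_shift[OF v] by blast
next
  assume "X \<in> range degree_elt"
  then obtain i where "X = degree_elt i" by blast
  then show ?thesis using degree_shift[OF v] lower_weights_refl by blast
qed

lemma triangular_decomposition:
  "complex_vector.span (lowering_generators \<union> toroidal_plus (positive_part br h base)) = UNIV"
    (is "complex_vector.span ?G = UNIV")
proof (rule toroidal_generators_span)
  note subspace = complex_vector.subspace_span[of ?G]
  note subset = complex_vector.span_base[of _ ?G]
  show "complex_vector.subspace (complex_vector.span ?G)" by (rule subspace)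
  show "degree_elt i \<in> complex_vector.span ?G" for i
    by (rule subset) (simp add: lowering_generators_def)
  show "central_elt k i b \<in> complex_vector.span ?G" for k i b
  proof (cases "k $ None \<le> 0")
    case True
    then have "central_elt k i b \<in> lowering_generators" unfolding lowering_generators_def by blast
    then show ?thesis by (intro subset UnI1)
  next
    case False
    then have "k $ None \<ge> 1" by simp
    then have "central_elt k i b \<in> toroidal_plus (positive_part br h base)"
      unfolding toroidal_plus_def by (intro complex_vector.span_base) blast
    then show ?thesis by (intro subset UnI2)
  qed
  show "loop_elt x k b \<in> complex_vector.span ?G" for x k b
  proof -
    have "x \<in> complex_vector.span (\<Union>q. weight_space br h q)" by (simp add: span_joint_eigenvectors)
    then show ?thesis
    proof (induction rule: complex_vector.span_induct_alt)
      case base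
      show ?case by (simp add: clinearD[OF clinear_loop_elt] complex_vector.span_zero)
    next
      case (step c x y)
      then obtain q where x: "x \<in> weight_space br h q" by blast
      have "loop_elt x k b \<in> ?G"
      proof (cases "k $ None" "0 :: int" rule: linorder_cases)
        case less
        then have "loop_elt x k b \<in> lowering_generators"
          using x unfolding lowering_generators_def by blast
        then show ?thesis by blast
      next
        case equal
        show ?thesis
          using x
        proof (cases rule: joint_eigenvector_cases)
          case 1
          then have "loop_elt x k b \<in> lowering_generators"
            using equal unfolding lowering_generators_def by blast
          then show ?thesis by blast
        next
          case (2 \<alpha>)
          show ?thesis
          proof (cases "nat_combination base \<alpha>")
            case True
            then have "x \<in> positive_part br h base"
              unfolding positive_part_def using 2 by (intro complex_vector.span_base) blast
            then have "loop_elt x k b \<in> toroidal_plus (positive_part br h base)"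
              unfolding toroidal_plus_def using equal by (intro complex_vector.span_base) blast
            then show ?thesis by blast
          next
            case False
            then have "nat_combination base (\<lambda>y. - \<alpha> y)"
              using integrable_toroidal_module.base[OF integrable_toroidal_module_axioms] 2(1)
              unfolding root_base_def by blast
            then have "loop_elt x k b \<in> lowering_generators"
              using equal 2 unfolding lowering_generators_def by blast
            then show ?thesis by blast
          qed
        qed
      next
        case greater
        then have "k $ None \<ge> 1" by simp
        then have "loop_elt x k b \<in> toroidal_plus (positive_part br h base)"
          unfolding toroidal_plus_def by (intro complex_vector.span_base) blast
        then show ?thesis by blast
      qed
      then show ?case using step
        by (simp add: clinearD[OF clinear_loop_elt] complex_vector.span_add complex_vector.span_scale subset)
    qed
  qed
qed

inductive_set descendants :: "'v \<Rightarrow> 'v set" for v0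
  where
    root: "v0 \<in> descendants v0"
  | lower: "w \<in> descendants v0 \<Longrightarrow> X \<in> lowering_generators \<Longrightarrow> \<rho> X w \<in> descendants v0"

text \<open>The part of the Poincare-Birkhoff-Witt theorem that matters here: products of lowering
  generators applied to a vacuum vector already span a submodule. An arbitrary \<open>X\<close> is moved to the
  right through such a product by \<open>X X\<^sub>1 = [X, X\<^sub>1] + X\<^sub>1 X\<close>, until it hits the vacuum vector, where
  its component in \<open>\<tau>(B)\<^sup>+\<close> vanishes.\<close>

lemma descendants_stable:
  assumes v0: "v0 \<in> vacuum_space br h base \<rho>" and w: "w \<in> descendants v0"
  shows "\<rho> X w \<in> complex_vector.span (descendants v0)"
  using w
proof (induction arbitrary: X rule: descendants.induct)
  case root
  have "X \<in> complex_vector.span (lowering_generators \<union> toroidal_plus (positive_part br h base))"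
    by (simp add: triangular_decomposition)
  then show ?case
  proof (induction rule: complex_vector.span_induct_alt)
    case base
    show ?case by (simp add: bilinD[OF bilin_rho] complex_vector.span_zero)
  next
    case (step c X Y)
    have "\<rho> X v0 \<in> complex_vector.span (descendants v0)"
      using step(1)
    proof
      assume "X \<in> lowering_generators"
      then show ?thesis
        by (intro complex_vector.span_base descendants.lower descendants.root)
    next
      assume "X \<in> toroidal_plus (positive_part br h base)"
      then show ?thesis using v0 by (simp add: vacuum_space_def complex_vector.span_zero)
    qed
    then show ?case using step(2)
      by (simp add: bilinD[OF bilin_rho] complex_vector.span_add complex_vector.span_scale)
  qed
next
  case (lower w Y)
  have "\<rho> X (\<rho> Y w) = \<rho> (toroidal_bracket br form X Y) w + \<rho> Y (\<rho> X w)"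
    by (simp add: rho_bracket)
  moreover have "\<rho> Y (\<rho> X w) \<in> complex_vector.span (descendants v0)"
    by (rule clinear_image_span_subset[OF clinear_rho _ lower.IH])
      (intro complex_vector.span_base descendants.lower lower.hyps(2))
  ultimately show ?case using lower.IH by (simp add: complex_vector.span_add)
qed

lemma weights_below_vacuum:
  assumes v0: "v0 \<in> vacuum_space br h base \<rho>" "v0 \<in> wt a z" "v0 \<noteq> 0"
    and w: "w \<in> wt a' z'" "w \<noteq> 0"
  shows "(a', z') \<in> lower_weights a z"
proof -
  let ?S = "complex_vector.span (descendants v0)"
  have "\<rho> X u \<in> ?S" if "u \<in> ?S" for X u
    using clinear_rho descendants_stable[OF v0(1)] that by (rule clinear_image_span_subset)
  moreover have "v0 \<in> ?S" by (intro complex_vector.span_base descendants.root)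
  ultimately have S: "?S = UNIV"
    using irreducible v0(3) complex_vector.subspace_span[of "descendants v0"]
    unfolding irreducible_module_def by blast
  have "descendants v0 \<subseteq> (\<Union>(a', z')\<in>lower_weights a z. wt a' z')"
  proof
    fix u assume "u \<in> descendants v0"
    then show "u \<in> (\<Union>(a', z')\<in>lower_weights a z. wt a' z')"
    proof (induction rule: descendants.induct)
      case root
      then show ?case using v0(2) lower_weights_refl by blast
    next
      case (lower u X)
      then obtain b y where u: "(b, y) \<in> lower_weights a z" "u \<in> wt b y" by blast
      obtain b' y' where X: "(b', y') \<in> lower_weights b y" "\<rho> X u \<in> wt b' y'"
        using lowering_generator_shift[OF lower.hyps(2) u(2)] by blast
      show ?case using lower_weights_trans[OF u(1) X(1)] X(2) by blast
    qed
  qed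
  then have "w \<in> complex_vector.span (\<Union>(a', z')\<in>lower_weights a z. wt a' z')"
    using complex_vector.span_mono S by blast
  from weight_in_span[OF w this] obtain b where "(b, z') \<in> lower_weights a z" "\<forall>x\<in>h. b x = a' x"
    by blast
  then show ?thesis by (simp add: lower_weights_def)
qed

lemma vacuum_multiplicity_bounded:
  "\<exists>N::nat. \<forall>\<mu>\<in>dual (toroidal_cartan h).
    fin_dim (vacuum_space br h base \<rho> \<inter> weight_space \<rho> (toroidal_cartan h) \<mu>) \<and>
    complex_vector.dim (vacuum_space br h base \<rho> \<inter> weight_space \<rho> (toroidal_cartan h) \<mu>) \<le> N"
proof -
  let ?T = "\<lambda>\<mu>. vacuum_space br h base \<rho> \<inter> weight_space \<rho> (toroidal_cartan h) \<mu>"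
  let ?a = "\<lambda>\<mu> x. \<mu> (loop_elt x 0 1)" and ?z = "\<lambda>\<mu> i. \<mu> (degree_elt i)"
  have fd: "fin_dim (?T \<mu>)" if "\<mu> \<in> dual (toroidal_cartan h)" for \<mu>
    using fin_dim_weight_space that unfolding fin_dim_def by (meson le_infI2)
  have T_wt: "?T \<mu> \<subseteq> wt (?a \<mu>) (?z \<mu>)" for \<mu> using weight_space_subset_wt by blast
  have sub: "complex_vector.subspace (?T \<mu>)" for \<mu>
    by (auto simp: complex_vector.subspace_def vacuum_space_def weight_space_def
        clinearD[OF clinear_rho] scaleC_simps mult.commute)
  have "\<exists>N. \<forall>\<mu>. complex_vector.dim (?T \<mu>) \<le> N"
  proof (cases "\<exists>\<mu>. \<exists>v\<in>?T \<mu>. v \<noteq> 0")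
    case False
    then have "?T \<mu> \<subseteq> complex_vector.span {}" for \<mu> by auto
    from complex_vector.dim_le_card[OF this] show ?thesis by auto
  next
    case True
    then obtain \<mu>0 v0 where v0: "v0 \<in> ?T \<mu>0" "v0 \<noteq> 0" by blast
    obtain N where N: "\<forall>k :: 'n mdeg. k $ None = 0 \<longrightarrow>
      complex_vector.dim (wt (?a \<mu>0) (\<lambda>i. ?z \<mu>0 i + of_int (k $ i))) \<le> N"
      using multiplicity_bounded[of "?a \<mu>0" "?z \<mu>0"] by (elim exE)
    have "complex_vector.dim (?T \<mu>) \<le> N" for \<mu>
    proof (cases "\<exists>v\<in>?T \<mu>. v \<noteq> 0")
      case False
      then have "?T \<mu> \<subseteq> complex_vector.span {}" by auto
      from complex_vector.dim_le_card[OF this] show ?thesis by auto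
    next
      case True
      then obtain v where v: "v \<in> ?T \<mu>" "v \<noteq> 0" by blast
      note wt0 = subsetD[OF T_wt v0(1)] and wt = subsetD[OF T_wt v(1)]
      have "\<exists>k :: 'n mdeg. k $ None = 0 \<and> (\<forall>i. ?z \<mu> i = ?z \<mu>0 i + of_int (k $ i)) \<and>
        (\<forall>x\<in>h. ?a \<mu> x = ?a \<mu>0 x)"
        using v0(1) v(1)
        by (intro lower_weights_antisym weights_below_vacuum[OF _ wt0 v0(2) wt v(2)]
            weights_below_vacuum[OF _ wt v(2) wt0 v0(2)]) simp_all
      then obtain k :: "'n mdeg" where k: "k $ None = 0" "\<And>i. ?z \<mu> i = ?z \<mu>0 i + of_int (k $ i)"
        "\<And>x. x \<in> h \<Longrightarrow> ?a \<mu> x = ?a \<mu>0 x" by blast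
      have "?T \<mu> \<subseteq> wt (?a \<mu>0) (\<lambda>i. ?z \<mu>0 i + of_int (k $ i))"
        using T_wt[of \<mu>] by (auto simp: wt_def k(2,3))
      then have "complex_vector.dim (?T \<mu>) \<le> complex_vector.dim (wt (?a \<mu>0) (\<lambda>i. ?z \<mu>0 i + of_int (k $ i)))"
        by (intro dim_le_of_injective_map[OF complex_vector.linear_id sub _ _ fin_dim_wt]) auto
      then show ?thesis using N[rule_format, OF k(1)] by (rule order_trans)
    qed
    then show ?thesis by blast
  qed
  then show ?thesis using fd by blast
qed

end


section \<open>Uniform boundedness\<close>

theorem theorem4p2:
  fixes br :: "'g::complex_vector \<Rightarrow> 'g \<Rightarrow> 'g"
    and form :: "'g \<Rightarrow> 'g \<Rightarrow> complex"
    and h :: "'g set"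
    and base :: "('g \<Rightarrow> complex) set"
    and \<rho> :: "('g, 'n::finite, 'b::complex_comm_algebra_1) toroidal \<Rightarrow> 'v::complex_vector \<Rightarrow> 'v"
    and c0 :: nat
  assumes "simple_lie_algebra br" and "fin_dim (UNIV :: 'g set)"
    and "cartan_subalgebra br h" and "root_base br h base"
    and "invariant_form br form" and "nondegenerate_form form" and "normalized_form br h base form"
    and "finitely_generated_algebra TYPE('b)"
    and "lie_module (toroidal_bracket br form) \<rho>"
    and "irreducible_module \<rho>"
    and "integrable_module br h \<rho>"
    and "\<forall>\<mu>\<in>dual (toroidal_cartan h). fin_dim (weight_space \<rho> (toroidal_cartan h) \<mu>)"
    and "c0 > 0" and "\<forall>v. \<rho> (central_elt 0 None 1) v = of_nat c0 *\<^sub>C v"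
    and "\<forall>i v. \<rho> (central_elt 0 (Some i) 1) v = 0"
  shows "\<exists>N::nat. \<forall>\<mu>\<in>dual (toroidal_cartan h).
    fin_dim (vacuum_space br h base \<rho> \<inter> weight_space \<rho> (toroidal_cartan h) \<mu>) \<and>
    complex_vector.dim (vacuum_space br h base \<rho> \<inter> weight_space \<rho> (toroidal_cartan h) \<mu>) \<le> N"
proof -
  interpret integrable_toroidal_module br form h base \<rho> c0
    using assms(1-7,9-15) by (rule integrable_toroidal_module.intro)
  show ?thesis by (rule vacuum_multiplicity_bounded)
qed

end
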